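(* Let $k\ge1$ and let $\Sigma_{L^k}=(M,L,Fe)$ be a Lagrangian mechanical system of order $k$. Then: 1. The operator $$S=y^{(1)i}\frac{\partial}{\partial x^i}+2y^{(2)i}\frac{\partial}{\partial y^{(1)i}}+\dots+ky^{(k)i}\frac{\partial}{\partial y^{(k-1)i}}-(k+1)\mathring G^i\frac{\partial}{\partial y^{(k)i}}+\frac12F^i\frac{\partial}{\partial y^{(k)i}}$$ is a $k$-semispray which depends only on the mechanical system $\Sigma_{L^k}$. 2. The integral curves of $S$ are the evolution curves given by the Lagrange equations of $\Sigma_{L^k}$, written in the form $$y^{(1)i}=\frac{dx^i}{dt},\ \dots,\ y^{(k)i}=\frac1{k!}\frac{d^kx^i}{dt^k},\qquad \frac{dy^{(k)i}}{dt}+(k+1)\mathring G^i(x,y^{(1)},\dots,y^{(k)})=\frac12F^i(x,y^{(1)},\dots,y^{(k)}).$$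
   Context: The summation convention is used. $M$ is a real $n$-dimensional smooth manifold. $T^kM$ is the bundle of accelerations of order $k$ (the manifold of $k$-jets at $0$ of curves in $M$), with local coordinates $(x^i,y^{(1)i},\dots,y^{(k)i})$, where the $k$-jet of a curve $x(t)$ has $y^{(\alpha)i}=\frac1{\alpha!}\frac{d^\alpha x^i}{dt^\alpha}(0)$; $y^{(0)i}=x^i$; $\widetilde{T^kM}$ is $T^kM$ without the null section. The $k$-tangent structure is $J=\frac{\partial}{\partial y^{(1)i}}\otimes dx^i+\frac{\partial}{\partial y^{(2)i}}\otimes dy^{(1)i}+\dots+\frac{\partial}{\partial y^{(k)i}}\otimes dy^{(k-1)i}$, and $\overset{k}{\Gamma}=y^{(1)i}\frac{\partial}{\partial y^{(1)i}}+2y^{(2)i}\frac{\partial}{\partial y^{(2)i}}+\dots+ky^{(k)i}\frac{\partial}{\partial y^{(k)i}}$ is the ($k$-th) Liouville vector field; both are globally defined. A $k$-semispray is a (globally defined) vector field $S$ with $JS=\overset{k}{\Gamma}$. $\Gamma$ is the local operator $\Gamma=y^{(1)i}\frac{\partial}{\partial x^i}+2y^{(2)i}\frac{\partial}{\partial y^{(1)i}}+\dots+ky^{(k)i}\frac{\partial}{\partial y^{(k-1)i}}$. A Lagrange space of order $k$ is a pair $(M,L)$ with $L:T^kM\to\mathbb R$ smooth on $\widetilde{T^kM}$ and continuous on the null section, such that $g_{ij}=\frac12\frac{\partial^2L}{\partial y^{(k)i}\partial y^{(k)j}}$ is nonsingular and of constant signature on $\widetilde{T^kM}$; $(g^{ij})$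 is the inverse matrix, and $(k+1)\mathring G^i=\frac12g^{ij}\left[\Gamma\left(\frac{\partial L}{\partial y^{(k)j}}\right)-\frac{\partial L}{\partial y^{(k-1)j}}\right]$. A Lagrangian mechanical system of order $k$ is a triple $\Sigma_{L^k}=(M,L,Fe)$ where $(M,L)$ is a Lagrange space of order $k$ and $Fe=F^i(x,y^{(1)},\dots,y^{(k)})\frac{\partial}{\partial y^{(k)i}}$ is a given vertical vector field; $F_i=g_{ij}F^j$. Its Lagrange equations are $\frac{d}{dt}\frac{\partial L}{\partial y^{(k)i}}-\frac{\partial L}{\partial y^{(k-1)i}}=F_i$, $y^{(\alpha)i}=\frac1{\alpha!}\frac{d^\alpha x^i}{dt^\alpha}$ $(\alpha=1,\dots,k)$. All objects involving $g^{ij}$ are considered on $\widetilde{T^kM}$. *)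

theory Defs
  imports "HOL-Analysis.Analysis"
begin

subsection \<open>Smooth manifolds\<close>

text \<open>\<open>C\<close>-infinity maps on open subsets of normed spaces.\<close>

primrec Ck_on :: "nat \<Rightarrow> 'a::real_normed_vector set \<Rightarrow> ('a \<Rightarrow> 'b::real_normed_vector) \<Rightarrow> bool" where
  "Ck_on 0 S f \<longleftrightarrow> continuous_on S f"
| "Ck_on (Suc m) S f \<longleftrightarrow>
     (\<forall>x\<in>S. f differentiable (at x)) \<and> (\<forall>v. Ck_on m S (\<lambda>x. frechet_derivative f (at x) v))"

definition smooth_map_on :: "'a::real_normed_vector set \<Rightarrow> ('a \<Rightarrow> 'b::real_normed_vector) \<Rightarrow> bool" where
  "smooth_map_on S f \<longleftrightarrow> (\<forall>m. Ck_on m S f)"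

text \<open>A chart is a domain together with a coordinate map; only the values of the map on the
  domain matter.  The manifold \<open>M\<close> is the whole type \<open>'m\<close>, and \<open>n = CARD('n)\<close>.\<close>

type_synonym ('m, 'n) chart = "'m set \<times> ('m \<Rightarrow> (real, 'n) vec)"

abbreviation cdom :: "('m, 'n::finite) chart \<Rightarrow> 'm set" where "cdom c \<equiv> fst c"
abbreviation cmap :: "('m, 'n::finite) chart \<Rightarrow> 'm \<Rightarrow> real^'n" where "cmap c \<equiv> snd c"

definition is_chart :: "('m::topological_space, 'n::finite) chart \<Rightarrow> bool" where
  "is_chart c \<longleftrightarrow> open (cdom c) \<and> open (cmap c ` cdom c) \<and>
     (\<exists>g. homeomorphism (cdom c) (cmap c ` cdom c) (cmap c) g)"

definition smooth_transition :: "('m, 'n::finite) chart \<Rightarrow> ('m, 'n) chart \<Rightarrow> bool" where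
  "smooth_transition c c' \<longleftrightarrow>
     smooth_map_on (cmap c ` (cdom c \<inter> cdom c')) (cmap c' \<circ> inv_into (cdom c) (cmap c))"

text \<open>A smooth structure is a maximal smooth atlas.\<close>

definition smooth_structure ::
  "('m::{t2_space, second_countable_topology}, 'n::finite) chart set \<Rightarrow> bool" where
  "smooth_structure A \<longleftrightarrow>
     (\<forall>c\<in>A. is_chart c) \<and> (\<Union>c\<in>A. cdom c) = UNIV \<and>
     (\<forall>c\<in>A. \<forall>c'\<in>A. smooth_transition c c') \<and>
     (\<forall>c. is_chart c \<and> (\<forall>c'\<in>A. smooth_transition c c' \<and> smooth_transition c' c) \<longrightarrow> c \<in> A)"

subsection \<open>The bundle of accelerations of order \<open>k\<close>\<close>

definition curve_at_0 :: "('m, 'n::finite) chart set \<Rightarrow> (real \<Rightarrow> 'm) \<Rightarrow> bool" where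
  "curve_at_0 A \<gamma> \<longleftrightarrow> (\<exists>c\<in>A. \<exists>e>0. (\<forall>t\<in>{-e<..<e}. \<gamma> t \<in> cdom c) \<and>
     smooth_map_on {-e<..<e} (cmap c \<circ> \<gamma>))"

type_synonym 'm jet = "(real \<Rightarrow> 'm) set"

definition jet_of :: "('m, 'n::finite) chart set \<Rightarrow> nat \<Rightarrow> (real \<Rightarrow> 'm) \<Rightarrow> 'm jet" where
  "jet_of A k \<gamma> = {\<delta>. curve_at_0 A \<delta> \<and> \<delta> 0 = \<gamma> 0 \<and>
     (\<forall>c\<in>A. \<gamma> 0 \<in> cdom c \<longrightarrow> (\<forall>\<alpha>\<le>k. \<forall>i.
        (deriv ^^ \<alpha>) (\<lambda>t. cmap c (\<delta> t) $ i) 0 = (deriv ^^ \<alpha>) (\<lambda>t. cmap c (\<gamma> t) $ i) 0))}"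

definition jets :: "('m, 'n::finite) chart set \<Rightarrow> nat \<Rightarrow> 'm jet set" where
  "jets A k = {jet_of A k \<gamma> | \<gamma>. curve_at_0 A \<gamma>}"

definition null_section :: "('m, 'n::finite) chart set \<Rightarrow> nat \<Rightarrow> 'm jet set" where
  "null_section A k = {jet_of A k (\<lambda>t. p) | p. True}"

definition slit_jets :: "('m, 'n::finite) chart set \<Rightarrow> nat \<Rightarrow> 'm jet set" where
  "slit_jets A k = jets A k - null_section A k"

definition jet_rep :: "'m jet \<Rightarrow> real \<Rightarrow> 'm" where
  "jet_rep u = (SOME \<gamma>. \<gamma> \<in> u)"

definition jdom :: "('m, 'n::finite) chart set \<Rightarrow> nat \<Rightarrow> ('m, 'n) chart \<Rightarrow> 'm jet set" where
  "jdom A k c = {u \<in> jets A k. jet_rep u 0 \<in> cdom c}"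

text \<open>The induced coordinates: \<open>jcoord k c u \<alpha> $ i\<close> is the coordinate \<open>y^(\<alpha>)i\<close> of \<open>u\<close>, with
  \<open>y^(0) = x\<close>.  Coordinate tuples \<open>(x, y^(1), \<dots>, y^(k))\<close> are sequences in \<open>real^'n\<close> that vanish
  beyond \<open>k\<close>; the product topology on sequences restricts to the Euclidean topology on them.\<close>

definition jcoord :: "nat \<Rightarrow> ('m, 'n::finite) chart \<Rightarrow> 'm jet \<Rightarrow> nat \<Rightarrow> real^'n" where
  "jcoord k c u \<alpha> =
     (if \<alpha> \<le> k then \<chi> i. (deriv ^^ \<alpha>) (\<lambda>t. cmap c (jet_rep u t) $ i) 0 / fact \<alpha> else 0)"

definition jpoint ::
  "('m, 'n::finite) chart set \<Rightarrow> nat \<Rightarrow> ('m, 'n) chart \<Rightarrow> (nat \<Rightarrow> real^'n) \<Rightarrow> 'm jet" where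
  "jpoint A k c = inv_into (jdom A k c) (jcoord k c)"

subsection \<open>Calculus in induced coordinates\<close>

definition along_axis :: "(nat \<Rightarrow> real^'n::finite) \<Rightarrow> nat \<Rightarrow> 'n \<Rightarrow> real \<Rightarrow> nat \<Rightarrow> real^'n" where
  "along_axis y \<alpha> i s = y(\<alpha> := y \<alpha> + axis i s)"

definition partial :: "nat \<Rightarrow> 'n::finite \<Rightarrow> ((nat \<Rightarrow> real^'n) \<Rightarrow> real) \<Rightarrow> (nat \<Rightarrow> real^'n) \<Rightarrow> real" where
  "partial \<alpha> i f y = deriv (\<lambda>s. f (along_axis y \<alpha> i s)) 0"

text \<open>\<open>C\<close>-infinity on open sets of coordinate tuples: all iterated partial derivatives exist
  and are continuous.\<close>

primrec coord_Ck ::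
  "nat \<Rightarrow> nat \<Rightarrow> (nat \<Rightarrow> real^'n::finite) set \<Rightarrow> ((nat \<Rightarrow> real^'n) \<Rightarrow> real) \<Rightarrow> bool" where
  "coord_Ck 0 k D f \<longleftrightarrow> continuous_on D f"
| "coord_Ck (Suc m) k D f \<longleftrightarrow> (\<forall>\<alpha>\<le>k. \<forall>i.
     (\<forall>y\<in>D. (\<lambda>s. f (along_axis y \<alpha> i s)) differentiable (at 0)) \<and> coord_Ck m k D (partial \<alpha> i f))"

definition coord_smooth ::
  "nat \<Rightarrow> (nat \<Rightarrow> real^'n::finite) set \<Rightarrow> ((nat \<Rightarrow> real^'n) \<Rightarrow> real) \<Rightarrow> bool" where
  "coord_smooth k D f \<longleftrightarrow> (\<forall>m. coord_Ck m k D f)"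

definition smooth_in_chart ::
  "('m, 'n::finite) chart set \<Rightarrow> nat \<Rightarrow> ('m, 'n) chart \<Rightarrow> 'm jet set \<Rightarrow> ('m jet \<Rightarrow> real) \<Rightarrow> bool" where
  "smooth_in_chart A k c W f \<longleftrightarrow>
     coord_smooth k (jcoord k c ` (W \<inter> jdom A k c)) (f \<circ> jpoint A k c)"

text \<open>The partial derivative of a function on the jet bundle with respect to the induced
  coordinate \<open>y^(\<alpha>)i\<close> of the chart \<open>c\<close>.\<close>

definition jpartial ::
  "('m, 'n::finite) chart set \<Rightarrow> nat \<Rightarrow> ('m, 'n) chart \<Rightarrow> nat \<Rightarrow> 'n \<Rightarrow> ('m jet \<Rightarrow> real) \<Rightarrow> 'm jet \<Rightarrow> real" where
  "jpartial A k c \<alpha> i f u = partial \<alpha> i (f \<circ> jpoint A k c) (jcoord k c u)"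

subsection \<open>Vector fields on the jet bundle\<close>

text \<open>A tangent vector \<open>v\<close> at \<open>u\<close> is a family of components, one tuple for every chart around
  \<open>u\<close>, related by the Jacobians of the changes of induced coordinates: \<open>v c \<alpha> $ i\<close> is the
  coefficient of the coordinate vector field of \<open>y^(\<alpha>)i\<close>.\<close>

type_synonym ('m, 'n) tangent = "('m, 'n) chart \<Rightarrow> nat \<Rightarrow> (real, 'n) vec"

definition tangent_vector ::
  "('m, 'n::finite) chart set \<Rightarrow> nat \<Rightarrow> 'm jet \<Rightarrow> ('m, 'n) tangent \<Rightarrow> bool" where
  "tangent_vector A k u v \<longleftrightarrow>
     (\<forall>c\<in>A. \<forall>c'\<in>A. u \<in> jdom A k c \<inter> jdom A k c' \<longrightarrow> (\<forall>\<alpha>\<le>k. \<forall>i.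
        v c' \<alpha> $ i =
          (\<Sum>\<beta>\<le>k. \<Sum>j\<in>UNIV. jpartial A k c \<beta> j (\<lambda>w. jcoord k c' w \<alpha> $ i) u * v c \<beta> $ j)))"

definition vector_field ::
  "('m, 'n::finite) chart set \<Rightarrow> nat \<Rightarrow> 'm jet set \<Rightarrow> ('m jet \<Rightarrow> ('m, 'n) tangent) \<Rightarrow> bool" where
  "vector_field A k W X \<longleftrightarrow>
     (\<forall>u\<in>W. tangent_vector A k u (X u)) \<and>
     (\<forall>c\<in>A. \<forall>\<alpha>\<le>k. \<forall>i. smooth_in_chart A k c W (\<lambda>u. X u c \<alpha> $ i))"

definition tangent_eq ::
  "('m, 'n::finite) chart set \<Rightarrow> nat \<Rightarrow> 'm jet \<Rightarrow> ('m, 'n) tangent \<Rightarrow> ('m, 'n) tangent \<Rightarrow> bool" where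
  "tangent_eq A k u v w \<longleftrightarrow> (\<forall>c\<in>A. u \<in> jdom A k c \<longrightarrow> (\<forall>\<alpha>\<le>k. v c \<alpha> = w c \<alpha>))"

definition tangent_structure :: "nat \<Rightarrow> ('m, 'n::finite) tangent \<Rightarrow> ('m, 'n) tangent" where
  "tangent_structure k v = (\<lambda>c \<alpha>. if 1 \<le> \<alpha> \<and> \<alpha> \<le> k then v c (\<alpha> - 1) else 0)"

definition liouville :: "nat \<Rightarrow> 'm jet \<Rightarrow> ('m, 'n::finite) tangent" where
  "liouville k u = (\<lambda>c \<alpha>. real \<alpha> *\<^sub>R jcoord k c u \<alpha>)"

definition k_semispray ::
  "('m, 'n::finite) chart set \<Rightarrow> nat \<Rightarrow> 'm jet set \<Rightarrow> ('m jet \<Rightarrow> ('m, 'n) tangent) \<Rightarrow> bool" where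
  "k_semispray A k W S \<longleftrightarrow> vector_field A k W S \<and>
     (\<forall>u\<in>W. tangent_eq A k u (tangent_structure k (S u)) (liouville k u))"

subsection \<open>Lagrange spaces and Lagrangian mechanical systems of order \<open>k\<close>\<close>

text \<open>The local operator \<open>\<Gamma>\<close>; the summation index \<open>\<alpha>\<close> is that of the derivation
  with respect to \<open>y^(\<alpha>)\<close>.\<close>

definition Gam ::
  "('m, 'n::finite) chart set \<Rightarrow> nat \<Rightarrow> ('m, 'n) chart \<Rightarrow> ('m jet \<Rightarrow> real) \<Rightarrow> 'm jet \<Rightarrow> real" where
  "Gam A k c f u =
     (\<Sum>\<alpha><k. \<Sum>i\<in>UNIV. real (\<alpha> + 1) * jcoord k c u (\<alpha> + 1) $ i * jpartial A k c \<alpha> i f u)"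

definition metric ::
  "('m, 'n::finite) chart set \<Rightarrow> nat \<Rightarrow> ('m jet \<Rightarrow> real) \<Rightarrow> ('m, 'n) chart \<Rightarrow> 'm jet \<Rightarrow> real^'n^'n" where
  "metric A k L c u = (\<chi> i j. 1/2 * jpartial A k c k i (jpartial A k c k j L) u)"

text \<open>\<open>has_signature B p q\<close>: the symmetric matrix \<open>B\<close> is congruent to a diagonal matrix with
  \<open>p\<close> entries \<open>1\<close>, \<open>q\<close> entries \<open>-1\<close> and all other entries \<open>0\<close>.\<close>

definition has_signature :: "real^'n^'n::finite \<Rightarrow> nat \<Rightarrow> nat \<Rightarrow> bool" where
  "has_signature B p q \<longleftrightarrow> (\<exists>(P::real^'n^'n) d. invertible P \<and> (\<forall>i. d i \<in> {-1, 0, 1}) \<and>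
     transpose P ** B ** P = (\<chi> i j. if i = j then d i else 0) \<and>
     card {i. d i = (1::real)} = p \<and> card {i. d i = -1} = q)"

definition lagrange_space ::
  "('m::{t2_space, second_countable_topology}, 'n::finite) chart set \<Rightarrow> nat \<Rightarrow> ('m jet \<Rightarrow> real) \<Rightarrow> bool" where
  "lagrange_space A k L \<longleftrightarrow> smooth_structure A \<and>
     (\<forall>c\<in>A. smooth_in_chart A k c (slit_jets A k) L) \<and>
     (\<forall>c\<in>A. \<forall>u \<in> null_section A k \<inter> jdom A k c.
        continuous (at (jcoord k c u) within jcoord k c ` jdom A k c) (L \<circ> jpoint A k c)) \<and>
     (\<forall>c\<in>A. \<forall>u \<in> slit_jets A k \<inter> jdom A k c. invertible (metric A k L c u)) \<and>
     (\<exists>p q. \<forall>c\<in>A. \<forall>u \<in> slit_jets A k \<inter> jdom A k c. has_signature (metric A k L c u) p q)"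

definition Gring ::
  "('m, 'n::finite) chart set \<Rightarrow> nat \<Rightarrow> ('m jet \<Rightarrow> real) \<Rightarrow> ('m, 'n) chart \<Rightarrow> 'm jet \<Rightarrow> real^'n" where
  "Gring A k L c u = (\<chi> i. 1 / real (k + 1) * (1/2 * (\<Sum>j\<in>UNIV.
     matrix_inv (metric A k L c u) $ i $ j *
       (Gam A k c (jpartial A k c k j L) u - jpartial A k c (k - 1) j L u))))"

text \<open>The external force \<open>Fe\<close> is vertical: it only has components \<open>F^i = Fe u c k $ i\<close> along
  the coordinate vector fields of \<open>y^(k)i\<close>.\<close>

definition mechanical_system ::
  "('m::{t2_space, second_countable_topology}, 'n::finite) chart set \<Rightarrow> nat \<Rightarrow> ('m jet \<Rightarrow> real) \<Rightarrow>
     ('m jet \<Rightarrow> ('m, 'n) tangent) \<Rightarrow> bool" where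
  "mechanical_system A k L Fe \<longleftrightarrow> lagrange_space A k L \<and> vector_field A k (slit_jets A k) Fe \<and>
     (\<forall>u \<in> slit_jets A k. \<forall>c\<in>A. u \<in> jdom A k c \<longrightarrow> (\<forall>\<alpha><k. Fe u c \<alpha> = 0))"

definition mech_semispray ::
  "('m, 'n::finite) chart set \<Rightarrow> nat \<Rightarrow> ('m jet \<Rightarrow> real) \<Rightarrow> ('m jet \<Rightarrow> ('m, 'n) tangent) \<Rightarrow>
     'm jet \<Rightarrow> ('m, 'n) tangent" where
  "mech_semispray A k L Fe u = (\<lambda>c \<alpha>.
     if \<alpha> < k then real (\<alpha> + 1) *\<^sub>R jcoord k c u (\<alpha> + 1)
     else if \<alpha> = k then - (real (k + 1) *\<^sub>R Gring A k L c u) + (1/2) *\<^sub>R Fe u c k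
     else 0)"

subsection \<open>Curves in the jet bundle\<close>

text \<open>Differentiable curves; the \<open>eventually\<close> clause is continuity, since the coordinates of
  \<open>\<sigma> s\<close> in the chart \<open>c\<close> are meaningful only while \<open>\<sigma> s\<close> lies in its domain.\<close>

definition diff_curve ::
  "('m, 'n::finite) chart set \<Rightarrow> nat \<Rightarrow> 'm jet set \<Rightarrow> real set \<Rightarrow> (real \<Rightarrow> 'm jet) \<Rightarrow> bool" where
  "diff_curve A k W I \<sigma> \<longleftrightarrow> (\<forall>t\<in>I. \<sigma> t \<in> W \<and> (\<forall>c\<in>A. \<sigma> t \<in> jdom A k c \<longrightarrow>
     (\<forall>\<^sub>F s in at t. \<sigma> s \<in> jdom A k c) \<and>
     (\<forall>\<alpha>\<le>k. (\<lambda>s. jcoord k c (\<sigma> s) \<alpha>) differentiable (at t))))"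

definition integral_curve ::
  "('m, 'n::finite) chart set \<Rightarrow> nat \<Rightarrow> 'm jet set \<Rightarrow> ('m jet \<Rightarrow> ('m, 'n) tangent) \<Rightarrow>
     real set \<Rightarrow> (real \<Rightarrow> 'm jet) \<Rightarrow> bool" where
  "integral_curve A k W X I \<sigma> \<longleftrightarrow> diff_curve A k W I \<sigma> \<and>
     (\<forall>t\<in>I. \<forall>c\<in>A. \<sigma> t \<in> jdom A k c \<longrightarrow>
        (\<forall>\<alpha>\<le>k. ((\<lambda>s. jcoord k c (\<sigma> s) \<alpha>) has_vector_derivative X (\<sigma> t) c \<alpha>) (at t)))"

text \<open>The relations \<open>y^(\<alpha>)i = 1/\<alpha>! d^\<alpha>x^i/dt^\<alpha>\<close>, \<open>\<alpha> = 1, \<dots>, k\<close>, along a curve.\<close>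

definition lifted_at ::
  "nat \<Rightarrow> ('m, 'n::finite) chart \<Rightarrow> (real \<Rightarrow> 'm jet) \<Rightarrow> real \<Rightarrow> bool" where
  "lifted_at k c \<sigma> t \<longleftrightarrow> (\<forall>\<alpha>\<in>{1..k}. \<forall>i.
     jcoord k c (\<sigma> t) \<alpha> $ i = 1 / fact \<alpha> * (deriv ^^ \<alpha>) (\<lambda>s. jcoord k c (\<sigma> s) 0 $ i) t)"

definition lagrange_curve ::
  "('m, 'n::finite) chart set \<Rightarrow> nat \<Rightarrow> ('m jet \<Rightarrow> real) \<Rightarrow> ('m jet \<Rightarrow> ('m, 'n) tangent) \<Rightarrow>
     real set \<Rightarrow> (real \<Rightarrow> 'm jet) \<Rightarrow> bool" where
  "lagrange_curve A k L Fe I \<sigma> \<longleftrightarrow> diff_curve A k (slit_jets A k) I \<sigma> \<and>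
     (\<forall>t\<in>I. \<forall>c\<in>A. \<sigma> t \<in> jdom A k c \<longrightarrow> lifted_at k c \<sigma> t \<and>
        (\<forall>i. \<exists>p'. ((\<lambda>s. jpartial A k c k i L (\<sigma> s)) has_real_derivative p') (at t) \<and>
           p' - jpartial A k c (k - 1) i L (\<sigma> t) =
             (\<Sum>j\<in>UNIV. metric A k L c (\<sigma> t) $ i $ j * Fe (\<sigma> t) c k $ j)))"

definition evolution_curve ::
  "('m, 'n::finite) chart set \<Rightarrow> nat \<Rightarrow> ('m jet \<Rightarrow> real) \<Rightarrow> ('m jet \<Rightarrow> ('m, 'n) tangent) \<Rightarrow>
     real set \<Rightarrow> (real \<Rightarrow> 'm jet) \<Rightarrow> bool" where
  "evolution_curve A k L Fe I \<sigma> \<longleftrightarrow> diff_curve A k (slit_jets A k) I \<sigma> \<and>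
     (\<forall>t\<in>I. \<forall>c\<in>A. \<sigma> t \<in> jdom A k c \<longrightarrow> lifted_at k c \<sigma> t \<and>
        (\<forall>i. \<exists>y'. ((\<lambda>s. jcoord k c (\<sigma> s) k $ i) has_real_derivative y') (at t) \<and>
           y' + real (k + 1) * Gring A k L c (\<sigma> t) $ i = 1/2 * Fe (\<sigma> t) c k $ i))"

end

theory Submission
  imports Defs
begin

text \<open>
In a chart write \<open>p\<^sub>i\<close> for \<open>\<partial>L/\<partial>y^(k)i\<close> and \<open>E\<^sub>i = \<Gamma>(p\<^sub>i) - \<partial>L/\<partial>y^(k-1)i\<close>; by its definition
\<open>2(k+1) g G = E\<close>, where \<open>G\<close> is \<open>Gring\<close>.  The proof rests on how \<open>E\<close> behaves under a change of
chart \<open>x \<mapsto> x'\<close> with Jacobian \<open>a = \<partial>x'/\<partial>x\<close>.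

The induced coordinates of a jet in the new chart are functions \<open>y'^(\<alpha>)\<close> of the old ones, and the
chain rule along curves says \<open>(\<alpha>+1) y'^(\<alpha>+1) = \<Gamma>(y'^(\<alpha>))\<close>.  So the change of chart is generated from
\<open>x'\<close> by iterating \<open>\<Gamma>\<close> (\<open>prolong\<close>).  Commuting \<open>\<partial>/\<partial>y^(\<beta>)\<close> with \<open>\<Gamma>\<close> then yields the three facts about
the Jacobian matrix that are needed: it is block triangular, its diagonal blocks all equal \<open>a\<close>, and the
blocks just below the diagonal all equal \<open>\<Gamma>(a)\<close> (\<open>jac_above\<close>, \<open>jac_diag\<close>, \<open>jac_subdiag\<close>).
Consequently \<open>p = a\<^sup>T p'\<close> and \<open>\<partial>L/\<partial>y^(k-1) = a\<^sup>T \<partial>L/\<partial>y'^(k-1) + \<Gamma>(a)\<^sup>T p'\<close>, so the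
terms with \<open>\<Gamma>(a)\<close> cancel in \<open>E\<close>.  What remains is \<open>E = a\<^sup>T (E' + 2 g' h)\<close> with \<open>h = \<Gamma>(y'^(k))\<close>
(\<open>euler_change\<close>), and with \<open>g = a\<^sup>T g' a\<close> this becomes \<open>-(k+1) G' = h - (k+1) a G\<close>
(\<open>Gring_change\<close>).  That is precisely the transformation law of the last components of a vector whose
lower components are \<open>(\<alpha>+1) y^(\<alpha>+1)\<close>; the force contributes a vertical vector and does no harm.
Smoothness of \<open>S\<close> in a chart comes from Cramer's rule for the inverse of \<open>g\<close>.

For the curves, the first \<open>k\<close> blocks of the equation of integral curves, \<open>dy^(\<alpha>)/dt = (\<alpha>+1) y^(\<alpha>+1)\<close>,
say exactly that the curve is the lift of its projection to \<open>M\<close> (\<open>lifted_iff\<close>).  Along such a curve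
\<open>dp/dt = \<Gamma>(p) + 2 g dy^(k)/dt\<close>, so the Lagrange equations read
\<open>E + 2 g dy^(k)/dt = g F\<close>, and since \<open>g\<close> is invertible they say \<open>dy^(k)/dt = -(k+1) G + F/2\<close>.

Smoothness of functions of coordinate tuples is expressed by partial derivatives; the chain rule and the
symmetry of second derivatives are derived from their existence and continuity alone.
\<close>

section \<open>Partial derivatives of functions of coordinate tuples\<close>

text \<open>
Openness relative to the tuples that agree beyond the order \<open>k\<close>: only the coordinates that partial
derivatives can move are allowed to vary.  The coordinate domains of jets vanish beyond \<open>k\<close> and so are not
open for the product topology.
\<close>
definition coord_open :: "nat \<Rightarrow> (nat \<Rightarrow> real^'n::finite) set \<Rightarrow> bool" where
  "coord_open k D \<longleftrightarrow> (\<forall>y\<in>D. \<exists>e>0. \<forall>z. (\<forall>\<alpha>>k. z \<alpha> = y \<alpha>) \<and>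
     (\<forall>\<alpha>\<le>k. norm (z \<alpha> - y \<alpha>) < e) \<longrightarrow> z \<in> D)"

text \<open>
Unlike \<open>partial\<close>, which is a total function with an arbitrary value where the derivative fails to
exist, this also asserts existence.
\<close>
definition has_partial ::
  "nat \<Rightarrow> 'n::finite \<Rightarrow> ((nat \<Rightarrow> real^'n) \<Rightarrow> real) \<Rightarrow> real \<Rightarrow> (nat \<Rightarrow> real^'n) \<Rightarrow> bool" where
  "has_partial \<alpha> i f d y \<longleftrightarrow> ((\<lambda>s. f (along_axis y \<alpha> i s)) has_real_derivative d) (at 0)"

lemma axis_add: "axis i a + axis i b = axis i (a + b :: real)"
  by (simp add: axis_def vec_eq_iff)

lemma norm_axis_real: "norm (axis i (r::real)) = \<bar>r\<bar>"
  by (simp add: norm_eq_sqrt_inner inner_axis_axis)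

lemma along_axis_0 [simp]: "along_axis y \<alpha> i 0 = y"
  by (simp add: along_axis_def axis_def fun_eq_iff vec_eq_iff)

lemma along_axis_add: "along_axis (along_axis y \<alpha> i s) \<alpha> i r = along_axis y \<alpha> i (s + r)"
  by (simp add: along_axis_def axis_add add.assoc)

lemma along_axis_commute:
  "along_axis (along_axis y \<alpha> i s) \<beta> j r = along_axis (along_axis y \<beta> j r) \<alpha> i s"
  by (auto simp: along_axis_def fun_eq_iff add_ac)

lemma along_axis_component:
  "along_axis y \<alpha> i s \<beta> $ j = y \<beta> $ j + (if \<beta> = \<alpha> \<and> j = i then s else 0)"
  by (simp add: along_axis_def axis_def)

lemma along_axis_other [simp]: "\<beta> \<noteq> \<alpha> \<Longrightarrow> along_axis y \<alpha> i s \<beta> = y \<beta>"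
  by (simp add: along_axis_def)

lemma norm_along_axis_le: "norm (along_axis z \<alpha> i s \<beta> - y \<beta>) \<le> norm (z \<beta> - y \<beta>) + \<bar>s\<bar>"
proof -
  have eq: "along_axis z \<alpha> i s \<beta> - y \<beta> = (z \<beta> - y \<beta>) + (if \<beta> = \<alpha> then axis i s else 0)"
    by (simp add: along_axis_def)
  show ?thesis
    unfolding eq using norm_triangle_ineq[of "z \<beta> - y \<beta>" "axis i s"]
    by (cases "\<beta> = \<alpha>") (simp_all add: norm_axis_real)
qed

lemma coord_openE:
  assumes "coord_open k D" "y \<in> D"
  obtains e where "e > 0"
    "\<forall>z. (\<forall>\<alpha>>k. z \<alpha> = y \<alpha>) \<and> (\<forall>\<alpha>\<le>k. norm (z \<alpha> - y \<alpha>) < e) \<longrightarrow> z \<in> D"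
  using bspec[OF assms(1)[unfolded coord_open_def] assms(2)]
  by (elim exE conjE) (rule that)

lemma coord_open_along_axis:
  assumes "coord_open k D" "y \<in> D" "\<alpha> \<le> k"
  shows "\<forall>\<^sub>F s in nhds 0. along_axis y \<alpha> i s \<in> D"
proof -
  obtain e where e: "e > 0" and *: "\<forall>z. (\<forall>\<alpha>>k. z \<alpha> = y \<alpha>) \<and>
      (\<forall>\<alpha>\<le>k. norm (z \<alpha> - y \<alpha>) < e) \<longrightarrow> z \<in> D"
    using coord_openE[OF assms(1,2)] .
  have "\<forall>\<^sub>F s in nhds (0::real). \<bar>s\<bar> < e"
    using e by (auto simp: eventually_nhds_metric dist_real_def)
  then show ?thesis
  proof eventually_elim
    case (elim s)
    have "norm (along_axis y \<alpha> i s \<beta> - y \<beta>) < e" for \<beta>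
      using norm_along_axis_le[of y \<alpha> i s \<beta> y] elim by simp
    then show ?case using assms by (intro *[rule_format]) auto
  qed
qed

lemma has_partial_partial: "has_partial \<alpha> i f d y \<Longrightarrow> partial \<alpha> i f y = d"
  unfolding has_partial_def partial_def by (rule DERIV_imp_deriv)

lemma differentiable_iff_has_partial:
  "(\<lambda>s. f (along_axis y \<alpha> i s)) differentiable (at 0) \<longleftrightarrow> has_partial \<alpha> i f (partial \<alpha> i f y) y"
  unfolding has_partial_def partial_def
  by (metis DERIV_imp_deriv real_differentiable_def)

lemma has_partial_cong:
  assumes "coord_open k D" "y \<in> D" "\<alpha> \<le> k" "\<And>z. z \<in> D \<Longrightarrow> f z = g z"
  shows "has_partial \<alpha> i f d y \<longleftrightarrow> has_partial \<alpha> i g d y"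
  unfolding has_partial_def
proof (rule DERIV_cong_ev[OF refl _ refl])
  show "\<forall>\<^sub>F s in nhds 0. f (along_axis y \<alpha> i s) = g (along_axis y \<alpha> i s)"
    using coord_open_along_axis[OF assms(1-3), where i = i]
    by (rule eventually_mono) (rule assms(4))
qed

lemma partial_cong:
  assumes "coord_open k D" "y \<in> D" "\<alpha> \<le> k" "\<And>z. z \<in> D \<Longrightarrow> f z = g z"
  shows "partial \<alpha> i f y = partial \<alpha> i g y"
  unfolding partial_def
proof (rule deriv_cong_ev[OF _ refl])
  show "\<forall>\<^sub>F s in nhds 0. f (along_axis y \<alpha> i s) = g (along_axis y \<alpha> i s)"
    using coord_open_along_axis[OF assms(1-3), where i = i]
    by (rule eventually_mono) (rule assms(4))
qed

lemma has_partial_const: "has_partial \<alpha> i (\<lambda>y. c) 0 y"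
  by (simp add: has_partial_def)

lemma has_partial_add:
  "has_partial \<alpha> i f a y \<Longrightarrow> has_partial \<alpha> i g b y \<Longrightarrow> has_partial \<alpha> i (\<lambda>y. f y + g y) (a + b) y"
  unfolding has_partial_def by (rule DERIV_add)

lemma has_partial_mult:
  "has_partial \<alpha> i f a y \<Longrightarrow> has_partial \<alpha> i g b y \<Longrightarrow>
    has_partial \<alpha> i (\<lambda>y. f y * g y) (a * g y + f y * b) y"
  unfolding has_partial_def by (rule DERIV_cong[OF DERIV_mult]) (auto simp: algebra_simps)

lemma has_partial_sum:
  assumes "\<And>x. x \<in> X \<Longrightarrow> has_partial \<alpha> i (f x) (d x) y"
  shows "has_partial \<alpha> i (\<lambda>y. \<Sum>x\<in>X. f x y) (\<Sum>x\<in>X. d x) y"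
  using assms unfolding has_partial_def by (intro DERIV_sum) auto

lemma has_partial_inverse:
  "has_partial \<alpha> i f a y \<Longrightarrow> f y \<noteq> 0 \<Longrightarrow>
    has_partial \<alpha> i (\<lambda>y. inverse (f y)) (- (a * (inverse (f y) * inverse (f y)))) y"
  unfolding has_partial_def
  by (rule DERIV_cong[OF DERIV_inverse']) (auto simp: algebra_simps)

lemma has_partial_component:
  "has_partial \<alpha> i (\<lambda>y. y \<beta> $ j) (if \<beta> = \<alpha> \<and> j = i then 1 else 0) y"
  unfolding has_partial_def along_axis_component
  by (auto intro!: derivative_eq_intros)

lemma has_partial_independent:
  assumes "\<And>s. f (along_axis y \<alpha> i s) = f y"
  shows "has_partial \<alpha> i f 0 y"
  unfolding has_partial_def assms by simp

lemma has_partial_along_axis: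
  assumes "has_partial \<alpha> i f d (along_axis y \<alpha> i s)"
  shows "((\<lambda>s. f (along_axis y \<alpha> i s)) has_real_derivative d) (at s)"
  using assms unfolding has_partial_def along_axis_add
  by (simp add: DERIV_shift[of _ d 0 s, simplified] add.commute)

section \<open>Smooth functions of coordinate tuples\<close>

text \<open>
\<open>coord_Ck\<close> imposes continuity only on the derivatives of the highest order.  The variant imposes it at
every order on the way, which makes it descend from \<open>Suc m\<close> to \<open>m\<close> by mere unfolding; the
inductions for products and inverses need this descent.  Over all orders both notions agree.
\<close>
primrec coord_upto ::
  "nat \<Rightarrow> nat \<Rightarrow> (nat \<Rightarrow> real^'n::finite) set \<Rightarrow> ((nat \<Rightarrow> real^'n) \<Rightarrow> real) \<Rightarrow> bool" where
  "coord_upto 0 k D f \<longleftrightarrow> continuous_on D f"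
| "coord_upto (Suc m) k D f \<longleftrightarrow> continuous_on D f \<and> (\<forall>\<alpha>\<le>k. \<forall>i.
     (\<forall>y\<in>D. has_partial \<alpha> i f (partial \<alpha> i f y) y) \<and> coord_upto m k D (partial \<alpha> i f))"

lemma coord_smooth_continuous: "coord_smooth k D f \<Longrightarrow> continuous_on D f"
  unfolding coord_smooth_def by (drule spec[of _ 0]) simp

lemma coord_smooth_has_partial:
  assumes "coord_smooth k D f" "\<alpha> \<le> k" "y \<in> D"
  shows "has_partial \<alpha> i f (partial \<alpha> i f y) y"
proof -
  have "coord_Ck (Suc 0) k D f"
    using assms(1) unfolding coord_smooth_def by blast
  then show ?thesis
    using assms by (simp add: differentiable_iff_has_partial)
qed

lemma coord_smooth_partial:
  assumes "coord_smooth k D f" "\<alpha> \<le> k"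
  shows "coord_smooth k D (partial \<alpha> i f)"
  using assms unfolding coord_smooth_def by (meson coord_Ck.simps(2))

lemma coord_smooth_iff: "coord_smooth k D f \<longleftrightarrow> (\<forall>m. coord_upto m k D f)"
proof
  assume "coord_smooth k D f"
  then have "coord_upto m k D f" for m
  proof (induction m arbitrary: f)
    case (Suc m)
    then show ?case
      using coord_smooth_continuous coord_smooth_has_partial coord_smooth_partial
      by (metis coord_upto.simps(2))
  qed (simp add: coord_smooth_continuous)
  then show "\<forall>m. coord_upto m k D f" ..
next
  have "coord_upto m k D f \<Longrightarrow> coord_Ck m k D f" for m
    by (induction m arbitrary: f) (auto simp: differentiable_iff_has_partial)
  moreover assume "\<forall>m. coord_upto m k D f"
  ultimately show "coord_smooth k D f" by (simp add: coord_smooth_def)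
qed

lemma coord_upto_Suc_D: "coord_upto (Suc m) k D f \<Longrightarrow> coord_upto m k D f"
  by (induction m arbitrary: f) auto

lemma coord_upto_cong:
  assumes "coord_open k D" "\<And>y. y \<in> D \<Longrightarrow> f y = g y" "coord_upto m k D f"
  shows "coord_upto m k D g"
  using assms(2,3)
proof (induction m arbitrary: f g)
  case 0
  then show ?case using continuous_on_cong[of D D f g] by simp
next
  case (Suc m)
  have "continuous_on D g" using Suc.prems continuous_on_cong[of D D f g] by simp
  moreover have "partial \<alpha> i g y = partial \<alpha> i f y" if "\<alpha> \<le> k" "y \<in> D" for \<alpha> i y
    using partial_cong[OF assms(1) that(2,1), of f g] Suc.prems(1) by simp
  moreover have "has_partial \<alpha> i g (partial \<alpha> i f y) y" if "\<alpha> \<le> k" "y \<in> D" for \<alpha> i y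
    using Suc.prems(2) that
    by (subst has_partial_cong[OF assms(1) that(2,1), of g f]) (simp_all add: Suc.prems(1))
  moreover have "coord_upto m k D (partial \<alpha> i g)" if "\<alpha> \<le> k" for \<alpha> i
    using Suc.IH[of "partial \<alpha> i f" "partial \<alpha> i g"] Suc.prems calculation(2) that by simp
  ultimately show ?case by simp
qed

lemma coord_smooth_cong:
  assumes "coord_open k D" "\<And>y. y \<in> D \<Longrightarrow> f y = g y" "coord_smooth k D f"
  shows "coord_smooth k D g"
  using assms coord_upto_cong unfolding coord_smooth_iff by blast

text \<open>
Any explicit formula for the derivatives may stand in for \<open>partial\<close>, since on \<open>D\<close> the two agree
and smoothness on \<open>D\<close> is local.
\<close>
lemma coord_upto_SucI:
  assumes "coord_open k D" "continuous_on D f"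
    and "\<And>\<alpha> i y. \<alpha> \<le> k \<Longrightarrow> y \<in> D \<Longrightarrow> has_partial \<alpha> i f (g \<alpha> i y) y"
    and "\<And>\<alpha> i. \<alpha> \<le> k \<Longrightarrow> coord_upto m k D (g \<alpha> i)"
  shows "coord_upto (Suc m) k D f"
proof -
  have eq: "g \<alpha> i y = partial \<alpha> i f y" if "\<alpha> \<le> k" "y \<in> D" for \<alpha> i y
    using has_partial_partial[OF assms(3)[OF that]] by simp
  then have "coord_upto m k D (partial \<alpha> i f)" if "\<alpha> \<le> k" for \<alpha> i
    using coord_upto_cong[OF assms(1) _ assms(4)] that by blast
  then show ?thesis
    using assms(2,3) eq by simp
qed

lemma coord_upto_const: "coord_open k D \<Longrightarrow> coord_upto m k D (\<lambda>y. c)"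
  by (induction m arbitrary: c)
    (auto intro!: coord_upto_SucI[where g = "\<lambda>_ _ _. 0"] has_partial_const continuous_intros
      simp del: coord_upto.simps(2))

lemma coord_upto_component: "coord_open k D \<Longrightarrow> coord_upto m k D (\<lambda>y. y \<beta> $ j)"
proof -
  assume D: "coord_open k D"
  have c: "continuous_on D (\<lambda>y. y \<beta> $ j)"
    by (intro continuous_intros continuous_on_subset[OF continuous_on_product_coordinates]) simp
  show ?thesis
    using c by (cases m) (auto intro!: coord_upto_SucI[OF D c has_partial_component] coord_upto_const D
        simp del: coord_upto.simps(2))
qed

lemma coord_upto_add:
  assumes "coord_open k D" "coord_upto m k D f" "coord_upto m k D g"
  shows "coord_upto m k D (\<lambda>y. f y + g y)"
  using assms(2,3)
proof (induction m arbitrary: f g)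
  case (Suc m)
  show ?case
    by (rule coord_upto_SucI[OF assms(1), where g = "\<lambda>\<alpha> i y. partial \<alpha> i f y + partial \<alpha> i g y"])
      (use Suc in \<open>auto intro!: continuous_intros has_partial_add\<close>)
qed (auto intro: continuous_intros)

lemma coord_upto_mult:
  assumes "coord_open k D" "coord_upto m k D f" "coord_upto m k D g"
  shows "coord_upto m k D (\<lambda>y. f y * g y)"
  using assms(2,3)
proof (induction m arbitrary: f g)
  case (Suc m)
  have "coord_upto m k D f" "coord_upto m k D g"
    using Suc.prems coord_upto_Suc_D by auto
  then show ?case
    by (intro coord_upto_SucI[OF assms(1),
          where g = "\<lambda>\<alpha> i y. partial \<alpha> i f y * g y + f y * partial \<alpha> i g y"])
      (use Suc in \<open>auto intro!: continuous_intros has_partial_mult coord_upto_add[OF assms(1)]\<close>)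
qed (auto intro: continuous_intros)

lemma coord_upto_minus:
  assumes "coord_open k D" "coord_upto m k D f"
  shows "coord_upto m k D (\<lambda>y. - f y)"
  using coord_upto_mult[OF assms(1) coord_upto_const[OF assms(1), of m "-1"] assms(2)] by simp

lemma coord_upto_inverse:
  assumes "coord_open k D" "coord_upto m k D f" "\<And>y. y \<in> D \<Longrightarrow> f y \<noteq> 0"
  shows "coord_upto m k D (\<lambda>y. inverse (f y))"
  using assms(2)
proof (induction m)
  case (Suc m)
  have "coord_upto m k D f" using Suc.prems coord_upto_Suc_D by auto
  then have "coord_upto m k D (\<lambda>y. inverse (f y))" by (rule Suc.IH)
  then show ?case
    by (intro coord_upto_SucI[OF assms(1),
          where g = "\<lambda>\<alpha> i y. - (partial \<alpha> i f y * (inverse (f y) * inverse (f y)))"])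
      (use Suc assms in \<open>auto intro!: continuous_on_inverse has_partial_inverse
          coord_upto_mult[OF assms(1)] coord_upto_minus[OF assms(1)]\<close>)
qed (use assms in \<open>auto intro: continuous_on_inverse\<close>)

lemma coord_smooth_const: "coord_open k D \<Longrightarrow> coord_smooth k D (\<lambda>y. c)"
  by (simp add: coord_smooth_iff coord_upto_const)

lemma coord_smooth_component: "coord_open k D \<Longrightarrow> coord_smooth k D (\<lambda>y. y \<beta> $ j)"
  by (simp add: coord_smooth_iff coord_upto_component)

lemma coord_smooth_add:
  "coord_open k D \<Longrightarrow> coord_smooth k D f \<Longrightarrow> coord_smooth k D g \<Longrightarrow> coord_smooth k D (\<lambda>y. f y + g y)"
  by (simp add: coord_smooth_iff coord_upto_add)

lemma coord_smooth_mult: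
  "coord_open k D \<Longrightarrow> coord_smooth k D f \<Longrightarrow> coord_smooth k D g \<Longrightarrow> coord_smooth k D (\<lambda>y. f y * g y)"
  by (simp add: coord_smooth_iff coord_upto_mult)

lemma coord_smooth_inverse:
  "coord_open k D \<Longrightarrow> coord_smooth k D f \<Longrightarrow> (\<And>y. y \<in> D \<Longrightarrow> f y \<noteq> 0) \<Longrightarrow>
    coord_smooth k D (\<lambda>y. inverse (f y))"
  by (simp add: coord_smooth_iff coord_upto_inverse)

lemma coord_smooth_sum:
  assumes "coord_open k D" "\<And>x. x \<in> X \<Longrightarrow> coord_smooth k D (f x)"
  shows "coord_smooth k D (\<lambda>y. \<Sum>x\<in>X. f x y)"
  using assms(2)
  by (induction X rule: infinite_finite_induct)
    (auto intro: coord_smooth_const coord_smooth_add assms(1))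

lemma coord_smooth_prod:
  assumes "coord_open k D" "\<And>x. x \<in> X \<Longrightarrow> coord_smooth k D (f x)"
  shows "coord_smooth k D (\<lambda>y. \<Prod>x\<in>X. f x y)"
  using assms(2)
  by (induction X rule: infinite_finite_induct)
    (auto intro: coord_smooth_const coord_smooth_mult assms(1))

lemma coord_smooth_minus:
  "coord_open k D \<Longrightarrow> coord_smooth k D f \<Longrightarrow> coord_smooth k D (\<lambda>y. - f y)"
  by (simp add: coord_smooth_iff coord_upto_minus)

section \<open>Chain rule along curves\<close>

lemma tendsto_coordinatewise:
  fixes f :: "'a \<Rightarrow> 'b \<Rightarrow> 'c::topological_space"
  assumes "\<And>a. ((\<lambda>x. f x a) \<longlongrightarrow> l a) F"
  shows "(f \<longlongrightarrow> l) F"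
  using assms limitin_componentwise[of "\<lambda>_. euclidean" UNIV f l F]
  by (simp add: euclidean_product_topology)

lemma tendsto_if_zero:
  fixes f :: "'a \<Rightarrow> real"
  shows "(f \<longlongrightarrow> 0) F \<Longrightarrow> ((\<lambda>x. if b then f x else 0) \<longlongrightarrow> 0) F"
  by (cases b) simp_all

lemma mean_value_along_axis:
  assumes "\<And>r. \<bar>r\<bar> \<le> \<bar>h\<bar> \<Longrightarrow> has_partial \<alpha> i f (g (along_axis z \<alpha> i r)) (along_axis z \<alpha> i r)"
  shows "\<exists>\<xi>. \<bar>\<xi>\<bar> \<le> \<bar>h\<bar> \<and> f (along_axis z \<alpha> i h) - f z = h * g (along_axis z \<alpha> i \<xi>)"
proof -
  define \<phi> where "\<phi> = (\<lambda>s. f (along_axis z \<alpha> i s))"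
  have d: "(\<phi> has_real_derivative g (along_axis z \<alpha> i r)) (at r)" if "\<bar>r\<bar> \<le> \<bar>h\<bar>" for r
    unfolding \<phi>_def by (rule has_partial_along_axis[OF assms[OF that]])
  consider "h = 0" | "h > 0" | "h < 0" by linarith
  then show ?thesis
  proof cases
    case 1
    then show ?thesis by (auto intro: exI[of _ 0])
  next
    case 2
    then obtain \<xi> where "0 < \<xi>" "\<xi> < h" "\<phi> h - \<phi> 0 = (h - 0) * g (along_axis z \<alpha> i \<xi>)"
      using MVT2[of 0 h \<phi> "\<lambda>r. g (along_axis z \<alpha> i r)"] d by auto
    then show ?thesis by (intro exI[of _ \<xi>]) (simp add: \<phi>_def)
  next
    case 3
    then obtain \<xi> where "h < \<xi>" "\<xi> < 0" "\<phi> 0 - \<phi> h = (0 - h) * g (along_axis z \<alpha> i \<xi>)"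
      using MVT2[of h 0 \<phi> "\<lambda>r. g (along_axis z \<alpha> i r)"] d by auto
    then show ?thesis by (intro exI[of _ \<xi>]) (simp add: \<phi>_def algebra_simps)
  qed
qed

text \<open>
Continuous partial derivatives suffice for the chain rule: \<open>Y t\<close> is turned into \<open>Y s\<close> by changing one
scalar coordinate at a time, each change is evaluated by the mean value theorem, and the intermediate points
all tend to \<open>Y t\<close>.  Only finitely many coordinates change because those beyond \<open>k\<close> are constant.
\<close>
lemma has_derivative_along_curve:
  fixes f :: "(nat \<Rightarrow> real^'n::finite) \<Rightarrow> real"
  assumes D: "coord_open k D"
    and f: "\<And>\<alpha> i y. \<alpha> \<le> k \<Longrightarrow> y \<in> D \<Longrightarrow> has_partial \<alpha> i f (partial \<alpha> i f y) y"
    and cont: "\<And>\<alpha> i. \<alpha> \<le> k \<Longrightarrow> continuous_on D (partial \<alpha> i f)"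
    and Yt: "Y t \<in> D"
    and Y: "\<And>\<alpha> i. \<alpha> \<le> k \<Longrightarrow> ((\<lambda>s. Y s \<alpha> $ i) has_real_derivative Y' \<alpha> i) (at t)"
    and high: "\<And>s \<alpha>. \<alpha> > k \<Longrightarrow> Y s \<alpha> = Y t \<alpha>"
  shows "((\<lambda>s. f (Y s)) has_real_derivative
    (\<Sum>\<alpha>\<le>k. \<Sum>i\<in>UNIV. partial \<alpha> i f (Y t) * Y' \<alpha> i)) (at t)"
proof -
  \<comment> \<open>\<open>Z B s\<close> has the coordinates of \<open>Y s\<close> at the indices in \<open>B\<close> and those of \<open>Y t\<close> elsewhere.\<close>
  define Z where "Z B s \<alpha> = (\<chi> i. if (\<alpha>, i) \<in> B then Y s \<alpha> $ i else Y t \<alpha> $ i)" for B s \<alpha>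
  have Zt: "Z B t = Y t" for B
    by (simp add: Z_def fun_eq_iff vec_eq_iff)
  have Ylim: "((\<lambda>s. Y s \<alpha> $ i) \<longlongrightarrow> Y t \<alpha> $ i) (at t)" for \<alpha> i
  proof (cases "\<alpha> \<le> k")
    case True
    then show ?thesis using DERIV_isCont[OF Y] by (simp add: isCont_def)
  next
    case False
    then have "(\<lambda>s. Y s \<alpha> $ i) = (\<lambda>s. Y t \<alpha> $ i)" using high[of \<alpha>] by (metis not_le)
    then show ?thesis by simp
  qed
  have Zlim: "((\<lambda>s. Z B s \<alpha>) \<longlongrightarrow> Y t \<alpha>) (at t)" for B \<alpha>
  proof (rule vec_tendstoI)
    fix i
    show "((\<lambda>s. Z B s \<alpha> $ i) \<longlongrightarrow> Y t \<alpha> $ i) (at t)"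
      by (cases "(\<alpha>, i) \<in> B") (simp_all add: Z_def Ylim)
  qed
  obtain e where e: "e > 0" and box0: "\<forall>z. (\<forall>\<alpha>>k. z \<alpha> = Y t \<alpha>) \<and>
      (\<forall>\<alpha>\<le>k. norm (z \<alpha> - Y t \<alpha>) < e) \<longrightarrow> z \<in> D"
    using coord_openE[OF D Yt] .
  have box: "z \<in> D" if "\<And>\<alpha>. \<alpha> > k \<Longrightarrow> z \<alpha> = Y t \<alpha>"
      "\<And>\<alpha>. \<alpha> \<le> k \<Longrightarrow> norm (z \<alpha> - Y t \<alpha>) < e" for z
    using box0 that by simp
  have near: "\<forall>\<^sub>F s in at t. \<forall>\<alpha>\<in>{..k}. norm (Z B s \<alpha> - Y t \<alpha>) < e / 2" for B
  proof (rule eventually_ball_finite)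
    show "\<forall>\<alpha>\<in>{..k}. \<forall>\<^sub>F s in at t. norm (Z B s \<alpha> - Y t \<alpha>) < e / 2"
      using tendstoD[OF Zlim, of "e/2"] e by (simp add: dist_norm)
  qed simp
  have claim: "((\<lambda>s. f (Z B s)) has_real_derivative
      (\<Sum>(\<alpha>, i)\<in>B. partial \<alpha> i f (Y t) * Y' \<alpha> i)) (at t)"
    if "finite B" "B \<subseteq> {..k} \<times> UNIV" for B
    using that
  proof (induction B rule: finite_induct)
    case empty
    have "Z {} s = Y t" for s by (simp add: Z_def fun_eq_iff vec_eq_iff)
    then show ?case by simp
  next
    case (insert p B)
    obtain \<alpha> i where p: "p = (\<alpha>, i)" by (cases p)
    have \<alpha>: "\<alpha> \<le> k" using insert.prems p by simp
    define h where "h = (\<lambda>s. Y s \<alpha> $ i - Y t \<alpha> $ i)"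
    have Zins: "Z (insert p B) s = along_axis (Z B s) \<alpha> i (h s)" for s
      using insert.hyps(2)
      by (auto simp: fun_eq_iff vec_eq_iff along_axis_component Z_def p h_def)
    have hlim: "(h \<longlongrightarrow> 0) (at t)"
      using tendsto_diff[OF Ylim tendsto_const[of "Y t \<alpha> $ i"], of \<alpha> i] by (simp add: h_def)
    define Q where "Q s \<xi> \<longleftrightarrow> along_axis (Z B s) \<alpha> i \<xi> \<in> D \<and> \<bar>\<xi>\<bar> \<le> \<bar>h s\<bar> \<and>
      f (along_axis (Z B s) \<alpha> i (h s)) - f (Z B s) = h s * partial \<alpha> i f (along_axis (Z B s) \<alpha> i \<xi>)"
      for s \<xi>
    have "\<forall>\<^sub>F s in at t. \<exists>\<xi>. Q s \<xi>"
      using near[of B] tendstoD[OF hlim, of "e/2", simplified, OF e]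
    proof eventually_elim
      case (elim s)
      have inD: "along_axis (Z B s) \<alpha> i r \<in> D" if r: "\<bar>r\<bar> \<le> \<bar>h s\<bar>" for r
      proof (rule box)
        fix \<beta> assume "\<beta> > k"
        then show "along_axis (Z B s) \<alpha> i r \<beta> = Y t \<beta>"
          using \<alpha> high[of \<beta>] by (simp add: Z_def vec_eq_iff)
      next
        fix \<beta> assume "\<beta> \<le> k"
        then have "norm (Z B s \<beta> - Y t \<beta>) < e / 2" using elim(1) by simp
        then show "norm (along_axis (Z B s) \<alpha> i r \<beta> - Y t \<beta>) < e"
          using norm_along_axis_le[of "Z B s" \<alpha> i r \<beta> "Y t"] r elim(2) by linarith
      qed
      have "\<exists>\<xi>. \<bar>\<xi>\<bar> \<le> \<bar>h s\<bar> \<and> f (along_axis (Z B s) \<alpha> i (h s)) - f (Z B s) =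
          h s * partial \<alpha> i f (along_axis (Z B s) \<alpha> i \<xi>)"
        by (rule mean_value_along_axis) (intro f \<alpha> inD)
      then show ?case unfolding Q_def using inD by blast
    qed
    then have \<xi>: "\<forall>\<^sub>F s in at t. Q s (SOME \<xi>. Q s \<xi>)"
      by eventually_elim (rule someI_ex)
    define \<xi> where "\<xi> s = (SOME \<xi>. Q s \<xi>)" for s
    have Q: "\<forall>\<^sub>F s in at t. Q s (\<xi> s)" using \<xi> by (simp add: \<xi>_def)
    have \<xi>lim: "(\<xi> \<longlongrightarrow> 0) (at t)"
    proof (rule Lim_null_comparison)
      show "\<forall>\<^sub>F s in at t. norm (\<xi> s) \<le> \<bar>h s\<bar>"
        using Q by eventually_elim (simp add: Q_def)
      show "((\<lambda>s. \<bar>h s\<bar>) \<longlongrightarrow> 0) (at t)" using hlim by (rule tendsto_rabs_zero)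
    qed
    have "((\<lambda>s. along_axis (Z B s) \<alpha> i (\<xi> s)) \<longlongrightarrow> Y t) (at t)"
    proof (intro tendsto_coordinatewise vec_tendstoI)
      fix \<beta> j
      have "((\<lambda>s. Z B s \<beta> $ j + (if \<beta> = \<alpha> \<and> j = i then \<xi> s else 0)) \<longlongrightarrow> Y t \<beta> $ j + 0) (at t)"
        by (intro tendsto_add tendsto_vec_nth[OF Zlim]) (rule tendsto_if_zero[OF \<xi>lim])
      then show "((\<lambda>s. along_axis (Z B s) \<alpha> i (\<xi> s) \<beta> $ j) \<longlongrightarrow> Y t \<beta> $ j) (at t)"
        by (simp add: along_axis_component)
    qed
    then have Plim: "((\<lambda>s. partial \<alpha> i f (along_axis (Z B s) \<alpha> i (\<xi> s))) \<longlongrightarrow> partial \<alpha> i f (Y t)) (at t)"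
      by (rule continuous_on_tendsto_compose[OF cont[OF \<alpha>] _ Yt])
        (use Q in eventually_elim, simp add: Q_def)
    have hder: "((\<lambda>s. h s / (s - t)) \<longlongrightarrow> Y' \<alpha> i) (at t)"
      using Y[OF \<alpha>, of i] by (simp add: has_field_derivative_iff h_def)
    define g where "g s = f (Z (insert p B) s) - f (Z B s)" for s
    have "((\<lambda>s. partial \<alpha> i f (along_axis (Z B s) \<alpha> i (\<xi> s)) * (h s / (s - t))) \<longlongrightarrow>
        partial \<alpha> i f (Y t) * Y' \<alpha> i) (at t)"
      by (rule tendsto_mult[OF Plim hder])
    moreover have "\<forall>\<^sub>F s in at t. partial \<alpha> i f (along_axis (Z B s) \<alpha> i (\<xi> s)) * (h s / (s - t)) =
        (g s - g t) / (s - t)"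
      using Q by eventually_elim (simp add: Q_def g_def Zins Zt h_def)
    ultimately have "(g has_real_derivative partial \<alpha> i f (Y t) * Y' \<alpha> i) (at t)"
      unfolding has_field_derivative_iff by (rule Lim_transform_eventually)
    then have "((\<lambda>s. f (Z B s) + g s) has_real_derivative
        (\<Sum>(\<alpha>, i)\<in>B. partial \<alpha> i f (Y t) * Y' \<alpha> i) + partial \<alpha> i f (Y t) * Y' \<alpha> i) (at t)"
      using insert.IH insert.prems by (intro DERIV_add) auto
    then show ?case
      using insert.hyps by (simp add: g_def p add.commute)
  qed
  have "Z ({..k} \<times> UNIV) s = Y s" for s
    using high[of _ s] by (auto simp: Z_def fun_eq_iff vec_eq_iff not_le)
  then show ?thesis
    using claim[of "{..k} \<times> UNIV"] by (simp add: sum.cartesian_product)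
qed

section \<open>Symmetry of second partial derivatives\<close>

text \<open>
The second difference of \<open>f\<close> over a square is the first difference, in one direction, of the first
difference in the other; two applications of the mean value theorem express it by the mixed derivative.
\<close>
lemma double_difference:
  assumes f: "\<And>z. z \<in> D \<Longrightarrow> has_partial \<alpha> i f (partial \<alpha> i f z) z"
    and f2: "\<And>z. z \<in> D \<Longrightarrow> has_partial \<beta> j (partial \<alpha> i f) (partial \<beta> j (partial \<alpha> i f) z) z"
    and box: "\<And>r s. \<bar>r\<bar> \<le> \<bar>h\<bar> \<Longrightarrow> \<bar>s\<bar> \<le> \<bar>h\<bar> \<Longrightarrow> along_axis (along_axis y \<alpha> i r) \<beta> j s \<in> D"
  shows "\<exists>\<xi> \<eta>. \<bar>\<xi>\<bar> \<le> \<bar>h\<bar> \<and> \<bar>\<eta>\<bar> \<le> \<bar>h\<bar> \<and>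
    f (along_axis (along_axis y \<alpha> i h) \<beta> j h) - f (along_axis y \<alpha> i h) - f (along_axis y \<beta> j h) + f y =
      h * h * partial \<beta> j (partial \<alpha> i f) (along_axis (along_axis y \<alpha> i \<xi>) \<beta> j \<eta>)"
proof -
  define F where "F z = f (along_axis z \<beta> j h) - f z" for z
  define F' where "F' z = partial \<alpha> i f (along_axis z \<beta> j h) - partial \<alpha> i f z" for z
  have "has_partial \<alpha> i F (F' (along_axis y \<alpha> i r)) (along_axis y \<alpha> i r)" if r: "\<bar>r\<bar> \<le> \<bar>h\<bar>" for r
  proof -
    have "along_axis y \<alpha> i r \<in> D" "along_axis (along_axis y \<alpha> i r) \<beta> j h \<in> D"
      using box[OF r, of 0] box[OF r, of h] by simp_all
    then show ?thesis
      using f unfolding has_partial_def F_def F'_def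
      by (subst along_axis_commute) (intro DERIV_diff, auto)
  qed
  from mean_value_along_axis[OF this]
  obtain \<xi> where \<xi>: "\<bar>\<xi>\<bar> \<le> \<bar>h\<bar>" "F (along_axis y \<alpha> i h) - F y = h * F' (along_axis y \<alpha> i \<xi>)"
    by blast
  have "has_partial \<beta> j (partial \<alpha> i f) (partial \<beta> j (partial \<alpha> i f) (along_axis (along_axis y \<alpha> i \<xi>) \<beta> j r))
      (along_axis (along_axis y \<alpha> i \<xi>) \<beta> j r)" if r: "\<bar>r\<bar> \<le> \<bar>h\<bar>" for r
    by (rule f2[OF box[OF \<xi>(1) r]])
  from mean_value_along_axis[OF this]
  obtain \<eta> where \<eta>: "\<bar>\<eta>\<bar> \<le> \<bar>h\<bar>" "F' (along_axis y \<alpha> i \<xi>) =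
      h * partial \<beta> j (partial \<alpha> i f) (along_axis (along_axis y \<alpha> i \<xi>) \<beta> j \<eta>)"
    unfolding F'_def by blast
  have "f (along_axis (along_axis y \<alpha> i h) \<beta> j h) - f (along_axis y \<alpha> i h) - f (along_axis y \<beta> j h) + f y =
      F (along_axis y \<alpha> i h) - F y"
    by (simp add: F_def)
  also have "\<dots> = h * h * partial \<beta> j (partial \<alpha> i f) (along_axis (along_axis y \<alpha> i \<xi>) \<beta> j \<eta>)"
    by (simp add: \<xi>(2) \<eta>(2))
  finally show ?thesis using \<xi>(1) \<eta>(1) by blast
qed

text \<open>
The second difference over a square is symmetric in the two directions, so the mixed derivatives in either
order are limits of the same quotients.
\<close>
lemma mixed_partials_commute:
  assumes D: "coord_open k D" and f: "coord_smooth k D f"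
    and y: "y \<in> D" and le: "\<alpha> \<le> k" "\<beta> \<le> k"
  shows "partial \<alpha> i (partial \<beta> j f) y = partial \<beta> j (partial \<alpha> i f) y"
proof -
  obtain e where e: "e > 0" and box0: "\<forall>z. (\<forall>\<alpha>>k. z \<alpha> = y \<alpha>) \<and>
      (\<forall>\<alpha>\<le>k. norm (z \<alpha> - y \<alpha>) < e) \<longrightarrow> z \<in> D"
    using coord_openE[OF D y] .
  \<comment> \<open>Squares of side \<open>h n\<close>, which stay inside the box of radius \<open>e\<close> even after two displacements.\<close>
  define h where "h n = (e / 4) / real (Suc n)" for n
  have h: "0 < h n" "h n \<le> e / 4" for n
    using e by (auto simp: h_def field_simps)
  have box: "along_axis (along_axis y \<alpha> i r) \<beta> j s \<in> D" if "\<bar>r\<bar> \<le> \<bar>h n\<bar>" "\<bar>s\<bar> \<le> \<bar>h n\<bar>"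
    and "\<alpha> \<le> k" "\<beta> \<le> k" for r s n \<alpha> i \<beta> j
  proof (intro box0[rule_format] conjI allI impI)
    fix \<gamma> assume "\<gamma> > k"
    then show "along_axis (along_axis y \<alpha> i r) \<beta> j s \<gamma> = y \<gamma>"
      using that by simp
  next
    fix \<gamma>
    show "norm (along_axis (along_axis y \<alpha> i r) \<beta> j s \<gamma> - y \<gamma>) < e"
      using norm_along_axis_le[of "along_axis y \<alpha> i r" \<beta> j s \<gamma> y]
        norm_along_axis_le[of y \<alpha> i r \<gamma> y] that h[of n] e by simp
  qed
  have limit: "\<exists>A. (\<forall>n. f (along_axis (along_axis y \<alpha> i (h n)) \<beta> j (h n)) - f (along_axis y \<alpha> i (h n))
        - f (along_axis y \<beta> j (h n)) + f y = h n * h n * A n)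
      \<and> A \<longlonglongrightarrow> partial \<beta> j (partial \<alpha> i f) y"
    if le: "\<alpha> \<le> k" "\<beta> \<le> k" for \<alpha> i \<beta> j
  proof -
    have "\<exists>\<xi> \<eta>. \<bar>\<xi>\<bar> \<le> \<bar>h n\<bar> \<and> \<bar>\<eta>\<bar> \<le> \<bar>h n\<bar> \<and>
      f (along_axis (along_axis y \<alpha> i (h n)) \<beta> j (h n)) - f (along_axis y \<alpha> i (h n))
          - f (along_axis y \<beta> j (h n)) + f y =
        h n * h n * partial \<beta> j (partial \<alpha> i f) (along_axis (along_axis y \<alpha> i \<xi>) \<beta> j \<eta>)" for n
      by (rule double_difference[where D = D])
        (use le in \<open>auto intro: coord_smooth_has_partial[OF f] box
          coord_smooth_has_partial[OF coord_smooth_partial[OF f]]\<close>)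
    then obtain \<xi> \<eta> where small: "\<And>n. \<bar>\<xi> n\<bar> \<le> \<bar>h n\<bar>" "\<And>n. \<bar>\<eta> n\<bar> \<le> \<bar>h n\<bar>"
      and eq: "\<And>n. f (along_axis (along_axis y \<alpha> i (h n)) \<beta> j (h n)) - f (along_axis y \<alpha> i (h n))
          - f (along_axis y \<beta> j (h n)) + f y =
        h n * h n * partial \<beta> j (partial \<alpha> i f) (along_axis (along_axis y \<alpha> i (\<xi> n)) \<beta> j (\<eta> n))"
      by metis
    have "(\<lambda>n. (e / 4) * (1 / real (Suc n))) \<longlonglongrightarrow> (e / 4) * 0"
      by (intro tendsto_mult tendsto_const lim_1_over_real_power[of 1, simplified] LIMSEQ_Suc[OF lim_1_over_n])
    then have "h \<longlonglongrightarrow> 0" by (simp add: h_def[abs_def])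
    then have hl: "(\<lambda>n. \<bar>h n\<bar>) \<longlonglongrightarrow> 0" by (rule tendsto_rabs_zero)
    have \<xi>l: "\<xi> \<longlonglongrightarrow> 0" by (rule Lim_null_comparison[OF _ hl]) (simp add: small)
    have \<eta>l: "\<eta> \<longlonglongrightarrow> 0" by (rule Lim_null_comparison[OF _ hl]) (simp add: small)
    have "(\<lambda>n. along_axis (along_axis y \<alpha> i (\<xi> n)) \<beta> j (\<eta> n)) \<longlonglongrightarrow> y"
    proof (intro tendsto_coordinatewise vec_tendstoI)
      fix \<gamma> l
      have "(\<lambda>n. y \<gamma> $ l + (if \<gamma> = \<alpha> \<and> l = i then \<xi> n else 0) + (if \<gamma> = \<beta> \<and> l = j then \<eta> n else 0))
          \<longlonglongrightarrow> y \<gamma> $ l + 0 + 0"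
        by (intro tendsto_add tendsto_const tendsto_if_zero \<xi>l \<eta>l)
      then show "(\<lambda>n. along_axis (along_axis y \<alpha> i (\<xi> n)) \<beta> j (\<eta> n) \<gamma> $ l) \<longlonglongrightarrow> y \<gamma> $ l"
        by (simp add: along_axis_component)
    qed
    then have "(\<lambda>n. partial \<beta> j (partial \<alpha> i f) (along_axis (along_axis y \<alpha> i (\<xi> n)) \<beta> j (\<eta> n)))
        \<longlonglongrightarrow> partial \<beta> j (partial \<alpha> i f) y"
      by (intro continuous_on_tendsto_compose[OF coord_smooth_continuous[of k D] _ y]
          coord_smooth_partial f le always_eventually allI box[OF small]) auto
    with eq show ?thesis
      by (intro exI[of _ "\<lambda>n. partial \<beta> j (partial \<alpha> i f)
        (along_axis (along_axis y \<alpha> i (\<xi> n)) \<beta> j (\<eta> n))"] conjI allI)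
  qed
  obtain A where A: "\<And>n. f (along_axis (along_axis y \<alpha> i (h n)) \<beta> j (h n)) - f (along_axis y \<alpha> i (h n))
        - f (along_axis y \<beta> j (h n)) + f y = h n * h n * A n"
      "A \<longlonglongrightarrow> partial \<beta> j (partial \<alpha> i f) y"
    using limit[OF le] by blast
  obtain B where B: "\<And>n. f (along_axis (along_axis y \<beta> j (h n)) \<alpha> i (h n)) - f (along_axis y \<beta> j (h n))
        - f (along_axis y \<alpha> i (h n)) + f y = h n * h n * B n"
      "B \<longlonglongrightarrow> partial \<alpha> i (partial \<beta> j f) y"
    using limit[OF le(2,1)] by blast
  have "A n = B n" for n
  proof -
    have "h n * h n * A n = h n * h n * B n"
      using A(1)[of n] B(1)[of n] unfolding along_axis_commute[of y \<beta> j "h n" \<alpha> i "h n"]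
      by linarith
    then show ?thesis using h(1)[of n] by simp
  qed
  then have "A = B" by (rule ext)
  then show ?thesis using A(2) B(2) LIMSEQ_unique by blast
qed

section \<open>The operator \<open>\<Gamma>\<close> on functions of coordinate tuples\<close>

text \<open>
The coordinate form of the operator \<open>Gam\<close>, see \<open>Gam_eq_total_der\<close> below.
\<close>
definition total_der :: "nat \<Rightarrow> ((nat \<Rightarrow> real^'n::finite) \<Rightarrow> real) \<Rightarrow> (nat \<Rightarrow> real^'n) \<Rightarrow> real" where
  "total_der k f y = (\<Sum>\<alpha><k. \<Sum>i\<in>UNIV. real (\<alpha> + 1) * y (\<alpha> + 1) $ i * partial \<alpha> i f y)"

lemma coord_smooth_total_der:
  assumes "coord_open k D" "coord_smooth k D f"
  shows "coord_smooth k D (total_der k f)"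
  unfolding total_der_def
  by (intro coord_smooth_sum coord_smooth_mult coord_smooth_const coord_smooth_component
      coord_smooth_partial assms) auto

lemma total_der_cong:
  assumes "coord_open k D" "y \<in> D" "\<And>z. z \<in> D \<Longrightarrow> f z = g z"
  shows "total_der k f y = total_der k g y"
  unfolding total_der_def
  by (intro sum.cong refl arg_cong2[where f = "(*)"] partial_cong[OF assms(1,2) _ assms(3)]) auto

text \<open>
The commutator of \<open>\<partial>/\<partial>y^(\<beta>)\<close> with \<open>\<Gamma>\<close> is \<open>\<beta> \<partial>/\<partial>y^(\<beta>-1)\<close>: differentiation of the coefficient
\<open>\<beta> y^(\<beta>)\<close> of \<open>\<partial>/\<partial>y^(\<beta>-1)\<close> produces it, and the second derivatives cancel by symmetry.  For \<open>\<beta> = 0\<close> the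
factor \<open>\<beta>\<close> kills the first term, whatever \<open>\<beta> - 1\<close> means.
\<close>
lemma partial_total_der:
  assumes D: "coord_open k D" and f: "coord_smooth k D f" and y: "y \<in> D" and \<beta>: "\<beta> \<le> k"
  shows "partial \<beta> j (total_der k f) y =
    real \<beta> * partial (\<beta> - 1) j f y + total_der k (partial \<beta> j f) y"
proof -
  have "has_partial \<beta> j (total_der k f) (\<Sum>\<alpha><k. \<Sum>i\<in>UNIV.
      (0 * y (\<alpha> + 1) $ i + real (\<alpha> + 1) * (if \<alpha> + 1 = \<beta> \<and> i = j then 1 else 0)) * partial \<alpha> i f y +
        real (\<alpha> + 1) * y (\<alpha> + 1) $ i * partial \<beta> j (partial \<alpha> i f) y) y"
    unfolding total_der_def
    by (intro has_partial_sum has_partial_mult has_partial_const has_partial_component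
        coord_smooth_has_partial[OF _ \<beta> y] coord_smooth_partial f) auto
  note has_partial_partial[OF this]
  also have "(\<Sum>\<alpha><k. \<Sum>i\<in>UNIV.
      (0 * y (\<alpha> + 1) $ i + real (\<alpha> + 1) * (if \<alpha> + 1 = \<beta> \<and> i = j then 1 else 0)) * partial \<alpha> i f y +
        real (\<alpha> + 1) * y (\<alpha> + 1) $ i * partial \<beta> j (partial \<alpha> i f) y) = (\<Sum>\<alpha><k. \<Sum>i\<in>UNIV.
      (if \<alpha> + 1 = \<beta> \<and> i = j then real \<beta> * partial (\<beta> - 1) j f y else 0) +
        real (\<alpha> + 1) * y (\<alpha> + 1) $ i * partial \<beta> j (partial \<alpha> i f) y)"
    by (intro sum.cong refl arg_cong2[where f = "(+)"]) auto
  also have "\<dots> = (\<Sum>\<alpha><k. \<Sum>i\<in>UNIV. if \<alpha> + 1 = \<beta> \<and> i = j then real \<beta> * partial (\<beta> - 1) j f y else 0)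
      + total_der k (partial \<beta> j f) y"
    unfolding total_der_def sum.distrib
    by (intro arg_cong2[where f = "(+)"] refl sum.cong arg_cong2[where f = "(*)"]
        mixed_partials_commute[OF D f y \<beta>]) auto
  also have "(\<Sum>\<alpha><k. \<Sum>i\<in>UNIV. if \<alpha> + 1 = \<beta> \<and> i = j then real \<beta> * partial (\<beta> - 1) j f y else 0)
      = real \<beta> * partial (\<beta> - 1) j f y"
  proof (cases \<beta>)
    case (Suc b)
    have "(\<Sum>\<alpha><k. \<Sum>i\<in>UNIV. if \<alpha> + 1 = \<beta> \<and> i = j then real \<beta> * partial (\<beta> - 1) j f y else 0) =
       (\<Sum>\<alpha><k. if \<alpha> = b then \<Sum>i\<in>UNIV. if i = j then real \<beta> * partial (\<beta> - 1) j f y else 0 else 0)"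
      by (rule sum.cong) (auto simp: Suc)
    then show ?thesis using \<beta> Suc by simp
  qed simp
  finally show ?thesis .
qed

section \<open>Functions of the base point and their prolongations\<close>

lemma smooth_map_on_frechet:
  assumes "smooth_map_on U \<phi>"
  shows "smooth_map_on U (\<lambda>x. frechet_derivative \<phi> (at x) v)"
    and "x \<in> U \<Longrightarrow> (\<phi> has_derivative frechet_derivative \<phi> (at x)) (at x)"
    and "continuous_on U \<phi>"
proof -
  have *: "Ck_on (Suc m) U \<phi>" for m using assms unfolding smooth_map_on_def by blast
  show "smooth_map_on U (\<lambda>x. frechet_derivative \<phi> (at x) v)"
    unfolding smooth_map_on_def using * by simp
  show "x \<in> U \<Longrightarrow> (\<phi> has_derivative frechet_derivative \<phi> (at x)) (at x)"
    using *[of 0] by (simp add: frechet_derivative_works)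
  show "continuous_on U \<phi>"
    using assms unfolding smooth_map_on_def by (metis Ck_on.simps(1))
qed

lemma has_partial_base:
  fixes \<phi> :: "real^'n::finite \<Rightarrow> real^'l::finite"
  assumes "(\<phi> has_derivative F) (at (y 0))"
  shows "has_partial \<beta> j (\<lambda>y. \<phi> (y 0) $ i) (if \<beta> = 0 then F (axis j 1) $ i else 0) y"
proof (cases "\<beta> = 0")
  case True
  have ax: "along_axis y 0 j s 0 = y 0 + s *\<^sub>R axis j 1" for s
    by (simp add: along_axis_def vec_eq_iff axis_def)
  have F: "(\<phi> has_derivative F) (at (y 0 + 0 *\<^sub>R axis j 1))" using assms by simp
  have "((\<lambda>s::real. y 0 + s *\<^sub>R axis j 1) has_derivative (\<lambda>s. s *\<^sub>R axis j 1)) (at 0)"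
    by (auto intro!: derivative_eq_intros)
  from has_derivative_compose[OF this F]
  have "((\<lambda>s. \<phi> (y 0 + s *\<^sub>R axis j 1) $ i) has_derivative (\<lambda>s. F (s *\<^sub>R axis j 1) $ i)) (at 0)"
    by (rule bounded_linear.has_derivative[OF bounded_linear_vec_nth])
  moreover have "F (s *\<^sub>R axis j 1) $ i = F (axis j 1) $ i * s" for s
    using linear_cmul[OF has_derivative_linear[OF assms]] by simp
  ultimately show ?thesis
    using True by (simp add: has_partial_def ax has_field_derivative_def)
next
  case False
  then show ?thesis by (auto intro: has_partial_independent)
qed

lemma coord_smooth_base:
  fixes \<phi> :: "real^'n::finite \<Rightarrow> real^'l::finite"
  assumes D: "coord_open k D" and U: "\<And>y. y \<in> D \<Longrightarrow> y 0 \<in> U" and \<phi>: "smooth_map_on U \<phi>"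
  shows "coord_smooth k D (\<lambda>y. \<phi> (y 0) $ i)"
proof -
  have c: "continuous_on D (\<lambda>y. \<phi> (y 0) $ i)" if "smooth_map_on U \<phi>" for \<phi> :: "real^'n \<Rightarrow> real^'l"
    by (intro continuous_intros continuous_on_compose2[OF smooth_map_on_frechet(3)[OF that]]
        continuous_on_subset[OF continuous_on_product_coordinates]) (auto simp: U)
  have "coord_upto m k D (\<lambda>y. \<phi> (y 0) $ i)" for m
    using \<phi>
  proof (induction m arbitrary: \<phi>)
    case 0
    then show ?case by (simp add: c)
  next
    case (Suc m)
    show ?case
    proof (rule coord_upto_SucI[OF D c[OF Suc.prems]])
      fix \<alpha> j y assume "y \<in> D"
      then show "has_partial \<alpha> j (\<lambda>y. \<phi> (y 0) $ i)
          (if \<alpha> = 0 then frechet_derivative \<phi> (at (y 0)) (axis j 1) $ i else 0) y"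
        by (intro has_partial_base smooth_map_on_frechet(2)[OF Suc.prems] U)
    next
      fix \<alpha> j
      show "coord_upto m k D (\<lambda>y. if \<alpha> = 0 then frechet_derivative \<phi> (at (y 0)) (axis j 1) $ i else 0)"
        using Suc.IH[OF smooth_map_on_frechet(1)[OF Suc.prems]] coord_upto_const[OF D]
        by (cases "\<alpha> = 0") auto
    qed
  qed
  then show ?thesis by (simp add: coord_smooth_iff)
qed

text \<open>
For a function \<open>f\<close> of the base point, \<open>prolong k f \<alpha>\<close> is the Taylor coefficient of order \<open>\<alpha>\<close> of
\<open>f\<close> along a curve, as a function of the jet of that curve.
\<close>
primrec prolong :: "nat \<Rightarrow> ((nat \<Rightarrow> real^'n::finite) \<Rightarrow> real) \<Rightarrow> nat \<Rightarrow> (nat \<Rightarrow> real^'n) \<Rightarrow> real" where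
  "prolong k f 0 = f"
| "prolong k f (Suc \<alpha>) = (\<lambda>y. total_der k (prolong k f \<alpha>) y / real (Suc \<alpha>))"

text \<open>
Smooth functions of the tuple that depend only on its entry of order 0, the base point.
\<close>
locale base_function =
  fixes k :: nat and D :: "(nat \<Rightarrow> real^'n::finite) set" and f :: "(nat \<Rightarrow> real^'n) \<Rightarrow> real"
  assumes D: "coord_open k D" and smooth: "coord_smooth k D f"
    and base: "\<And>y z. y 0 = z 0 \<Longrightarrow> f y = f z"
begin

lemma smooth_prolong: "coord_smooth k D (prolong k f \<alpha>)"
proof (induction \<alpha>)
  case (Suc \<alpha>)
  then show ?case
    using coord_smooth_mult[OF D coord_smooth_total_der[OF D Suc] coord_smooth_const[OF D]]
    by (simp add: divide_inverse)
qed (simp add: smooth)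

lemma partial_prolong_Suc:
  assumes "y \<in> D" "\<beta> \<le> k"
  shows "partial \<beta> j (prolong k f (Suc \<alpha>)) y =
    (real \<beta> * partial (\<beta> - 1) j (prolong k f \<alpha>) y + total_der k (partial \<beta> j (prolong k f \<alpha>)) y) / real (Suc \<alpha>)"
proof -
  have "has_partial \<beta> j (\<lambda>y. total_der k (prolong k f \<alpha>) y * inverse (real (Suc \<alpha>)))
      (partial \<beta> j (total_der k (prolong k f \<alpha>)) y * inverse (real (Suc \<alpha>)) +
        total_der k (prolong k f \<alpha>) y * 0) y"
    by (intro has_partial_mult has_partial_const coord_smooth_has_partial[OF _ assms(2,1)]
        coord_smooth_total_der smooth_prolong D)
  then show ?thesis
    using partial_total_der[OF D smooth_prolong assms] has_partial_partial
    by (simp add: divide_inverse)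
qed

lemma total_der_zero: "(\<And>z. z \<in> D \<Longrightarrow> g z = 0) \<Longrightarrow> y \<in> D \<Longrightarrow> total_der k g y = 0"
proof -
  assume *: "\<And>z. z \<in> D \<Longrightarrow> g z = 0" "y \<in> D"
  have "total_der k g y = total_der k (\<lambda>z. 0) y"
    using * by (intro total_der_cong[OF D]) auto
  also have "\<dots> = 0"
    by (simp add: total_der_def has_partial_partial[OF has_partial_const])
  finally show ?thesis .
qed

lemma partial_base_zero: "0 < \<beta> \<Longrightarrow> partial \<beta> j f y = 0"
  by (intro has_partial_partial has_partial_independent base) simp

text \<open>
A Taylor coefficient of order \<open>\<alpha>\<close> cannot see the coordinates of higher order.
\<close>
lemma partial_prolong_above:
  assumes "\<alpha> < \<beta>" "\<beta> \<le> k" "y \<in> D"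
  shows "partial \<beta> j (prolong k f \<alpha>) y = 0"
  using assms
proof (induction \<alpha> arbitrary: \<beta> y)
  case 0
  then show ?case by (simp add: partial_base_zero)
next
  case (Suc \<alpha>)
  have "total_der k (partial \<beta> j (prolong k f \<alpha>)) y = 0"
    using Suc by (intro total_der_zero) auto
  then show ?case
    using Suc by (simp only: partial_prolong_Suc) simp
qed

text \<open>
Raising the order of both the coefficient and the coordinate by one multiplies the derivative by
\<open>(\<alpha>+1)/(\<alpha>+1)\<close>: in the commutator formula the \<open>\<Gamma>\<close>-term vanishes by the preceding lemma.
\<close>
lemma partial_prolong_top:
  assumes "\<alpha> \<le> k" "y \<in> D"
  shows "partial \<alpha> j (prolong k f \<alpha>) y = partial 0 j f y"
  using assms
proof (induction \<alpha>)
  case (Suc \<alpha>)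
  have "total_der k (partial (Suc \<alpha>) j (prolong k f \<alpha>)) y = 0"
    using Suc.prems by (intro total_der_zero partial_prolong_above) auto
  moreover have "partial \<alpha> j (prolong k f \<alpha>) y = partial 0 j f y"
    using Suc by simp
  ultimately show ?case
    using Suc.prems by (simp only: partial_prolong_Suc) simp
qed simp

text \<open>
Induction with the commutator formula: if the claim holds at one order with value \<open>T\<close>, the next order
gives \<open>((\<alpha>+1) T + T)/(\<alpha>+2) = T\<close>, the second \<open>T\<close> being \<open>\<Gamma>\<close> of the diagonal derivative.
\<close>
lemma partial_prolong_below_top:
  assumes "Suc \<alpha> \<le> k" "y \<in> D"
  shows "partial \<alpha> j (prolong k f (Suc \<alpha>)) y = total_der k (partial 0 j f) y"
  using assms
proof (induction \<alpha>)
  case 0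
  then show ?case by (simp only: partial_prolong_Suc) simp
next
  case (Suc \<alpha>)
  have "total_der k (partial (Suc \<alpha>) j (prolong k f (Suc \<alpha>))) y = total_der k (partial 0 j f) y"
    using Suc.prems by (intro total_der_cong[OF D] partial_prolong_top) auto
  moreover have "partial \<alpha> j (prolong k f (Suc \<alpha>)) y = total_der k (partial 0 j f) y"
    using Suc by simp
  moreover have "(real (Suc \<alpha>) * T + T) / real (Suc (Suc \<alpha>)) = T" for T
    by (simp add: field_simps)
  ultimately show ?case
    using Suc.prems by (simp only: partial_prolong_Suc diff_Suc_1)
qed

lemma partial_base_cong: "y 0 = z 0 \<Longrightarrow> partial \<beta> j f y = partial \<beta> j f z"
  unfolding partial_def by (intro arg_cong2[where f = deriv] refl ext base) (simp add: along_axis_def)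

end

lemma coord_open_base: "open U \<Longrightarrow> coord_open k {y. y 0 \<in> U}"
  unfolding coord_open_def
proof
  fix y :: "nat \<Rightarrow> real^'a"
  assume "open U" "y \<in> {y. y 0 \<in> U}"
  then obtain e where "e > 0" "\<And>x. norm (x - y 0) < e \<Longrightarrow> x \<in> U"
    unfolding open_dist dist_norm by auto
  then show "\<exists>e>0. \<forall>z. (\<forall>\<alpha>>k. z \<alpha> = y \<alpha>) \<and> (\<forall>\<alpha>\<le>k. norm (z \<alpha> - y \<alpha>) < e) \<longrightarrow>
      z \<in> {y. y 0 \<in> U}"
    by (intro exI[of _ e]) simp
qed

lemma base_function_component:
  assumes "open U" "smooth_map_on U \<phi>"
  shows "base_function k {y. y 0 \<in> U} (\<lambda>y. \<phi> (y 0) $ i)"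
proof
  show "coord_open k {y. y 0 \<in> U}" using assms(1) by (rule coord_open_base)
  then show "coord_smooth k {y. y 0 \<in> U} (\<lambda>y. \<phi> (y 0) $ i)"
    by (rule coord_smooth_base[OF _ _ assms(2)]) simp
qed simp

section \<open>Taylor coefficients of curves\<close>

text \<open>
The induced coordinates, at every parameter value, of the lift of a curve in coordinate space.
\<close>
definition jet_coords :: "nat \<Rightarrow> (real \<Rightarrow> real^'n::finite) \<Rightarrow> real \<Rightarrow> nat \<Rightarrow> real^'n" where
  "jet_coords k X t \<alpha> = (if \<alpha> \<le> k then \<chi> i. (deriv ^^ \<alpha>) (\<lambda>s. X s $ i) t / fact \<alpha> else 0)"

text \<open>
Smoothness phrased through the iterated derivatives of the components, which is the form in which jets
refer to curves.
\<close>
definition smooth_curve_on :: "real set \<Rightarrow> (real \<Rightarrow> real^'n::finite) \<Rightarrow> bool" where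
  "smooth_curve_on T X \<longleftrightarrow>
     (\<forall>\<alpha> i. \<forall>t\<in>T. (deriv ^^ \<alpha>) (\<lambda>s. X s $ i) differentiable (at t))"

lemma jet_coords_0 [simp]: "jet_coords k X t 0 = X t"
  by (simp add: jet_coords_def vec_eq_iff)

lemma deriv_funpow_has_derivative:
  assumes "smooth_curve_on T X" "t \<in> T"
  shows "((deriv ^^ \<alpha>) (\<lambda>s. X s $ i) has_real_derivative (deriv ^^ Suc \<alpha>) (\<lambda>s. X s $ i) t) (at t)"
proof -
  have "(deriv ^^ \<alpha>) (\<lambda>s. X s $ i) differentiable (at t)"
    using assms unfolding smooth_curve_on_def by blast
  then obtain d where d: "((deriv ^^ \<alpha>) (\<lambda>s. X s $ i) has_real_derivative d) (at t)"
    unfolding real_differentiable_def ..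
  then show ?thesis using DERIV_imp_deriv[OF d] by simp
qed

text \<open>
On the right the order is \<open>Suc k\<close> so that the formula also covers the top coordinate \<open>\<alpha> = k\<close>.
\<close>
lemma jet_coords_has_derivative:
  assumes "smooth_curve_on T X" "t \<in> T" "\<alpha> \<le> k"
  shows "((\<lambda>s. jet_coords k X s \<alpha> $ i) has_real_derivative
    real (Suc \<alpha>) * jet_coords (Suc k) X t (Suc \<alpha>) $ i) (at t)"
proof -
  have "((\<lambda>s. (deriv ^^ \<alpha>) (\<lambda>s. X s $ i) s / fact \<alpha>) has_real_derivative
      (deriv ^^ Suc \<alpha>) (\<lambda>s. X s $ i) t / fact \<alpha>) (at t)"
    by (rule DERIV_cdivide[OF deriv_funpow_has_derivative[OF assms(1,2)]])
  moreover have "c / fact \<alpha> = real (Suc \<alpha>) * (c / fact (Suc \<alpha>))" for c :: real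
    by (simp del: of_nat_Suc)
  moreover have "jet_coords k X s \<alpha> $ i = (deriv ^^ \<alpha>) (\<lambda>s. X s $ i) s / fact \<alpha>" for s
    using assms(3) by (simp only: jet_coords_def if_True vec_lambda_beta)
  moreover have "jet_coords (Suc k) X t (Suc \<alpha>) $ i = (deriv ^^ Suc \<alpha>) (\<lambda>s. X s $ i) t / fact (Suc \<alpha>)"
    using assms(3) by (simp only: jet_coords_def if_True vec_lambda_beta Suc_le_mono)
  ultimately show ?thesis by (simp only:)
qed

context base_function
begin

text \<open>
Along the lift of a curve the chain rule reproduces \<open>\<Gamma>\<close>, plus a term with the derivative of the top
coordinate; that term vanishes because \<open>\<alpha> < k\<close>.
\<close>
lemma prolong_has_derivative:
  assumes "smooth_curve_on T X" "t \<in> T" "jet_coords k X t \<in> D" "\<alpha> < k"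
  shows "((\<lambda>s. prolong k f \<alpha> (jet_coords k X s)) has_real_derivative
    real (Suc \<alpha>) * prolong k f (Suc \<alpha>) (jet_coords k X t)) (at t)"
proof -
  let ?Y = "jet_coords k X"
  have "((\<lambda>s. prolong k f \<alpha> (?Y s)) has_real_derivative
      (\<Sum>\<beta>\<le>k. \<Sum>i\<in>UNIV. partial \<beta> i (prolong k f \<alpha>) (?Y t) *
        (real (Suc \<beta>) * jet_coords (Suc k) X t (Suc \<beta>) $ i))) (at t)"
    by (rule has_derivative_along_curve[OF D])
      (auto intro!: coord_smooth_has_partial[OF smooth_prolong] assms(3)
        coord_smooth_continuous[OF coord_smooth_partial[OF smooth_prolong]]
        jet_coords_has_derivative[OF assms(1,2)] simp del: of_nat_Suc, simp add: jet_coords_def)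
  also have "(\<Sum>\<beta>\<le>k. \<Sum>i\<in>UNIV. partial \<beta> i (prolong k f \<alpha>) (?Y t) *
        (real (Suc \<beta>) * jet_coords (Suc k) X t (Suc \<beta>) $ i)) =
      (\<Sum>\<beta><k. \<Sum>i\<in>UNIV. partial \<beta> i (prolong k f \<alpha>) (?Y t) *
        (real (Suc \<beta>) * jet_coords (Suc k) X t (Suc \<beta>) $ i))"
    using partial_prolong_above[OF assms(4) order.refl assms(3)]
    by (simp add: lessThan_Suc_atMost[symmetric])
  also have "\<dots> = total_der k (prolong k f \<alpha>) (?Y t)"
    unfolding total_der_def by (intro sum.cong refl) (auto simp: jet_coords_def)
  finally show ?thesis by simp
qed

lemma deriv_funpow_prolong:
  assumes "smooth_curve_on T X" "open T" "\<And>t. t \<in> T \<Longrightarrow> jet_coords k X t \<in> D" "\<alpha> \<le> k" "t \<in> T"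
  shows "(deriv ^^ \<alpha>) (\<lambda>s. f (jet_coords k X s)) t = fact \<alpha> * prolong k f \<alpha> (jet_coords k X t)"
  using assms(4,5)
proof (induction \<alpha> arbitrary: t)
  case (Suc \<alpha>)
  let ?g = "(deriv ^^ \<alpha>) (\<lambda>s. f (jet_coords k X s))"
  have ev: "\<forall>\<^sub>F s in nhds t. ?g s = fact \<alpha> * prolong k f \<alpha> (jet_coords k X s)"
    using eventually_nhds_in_open[OF assms(2) Suc.prems(2)]
    by eventually_elim (use Suc in auto)
  have "deriv ?g t = deriv (\<lambda>s. fact \<alpha> * prolong k f \<alpha> (jet_coords k X s)) t"
    by (rule deriv_cong_ev[OF ev refl])
  also have "\<dots> = fact \<alpha> * (real (Suc \<alpha>) * prolong k f (Suc \<alpha>) (jet_coords k X t))"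
    by (intro DERIV_imp_deriv DERIV_cmult prolong_has_derivative[OF assms(1) Suc.prems(2) assms(3)])
      (use Suc.prems in auto)
  finally show ?case by (simp add: algebra_simps)
qed simp

lemma deriv_funpow_differentiable:
  assumes "smooth_curve_on T X" "open T" "\<And>t. t \<in> T \<Longrightarrow> jet_coords k X t \<in> D" "\<alpha> < k" "t \<in> T"
  shows "(deriv ^^ \<alpha>) (\<lambda>s. f (jet_coords k X s)) differentiable (at t)"
proof -
  have ev: "\<forall>\<^sub>F s in nhds t. fact \<alpha> * prolong k f \<alpha> (jet_coords k X s) =
      (deriv ^^ \<alpha>) (\<lambda>s. f (jet_coords k X s)) s"
    using eventually_nhds_in_open[OF assms(2,5)]
    by eventually_elim (use deriv_funpow_prolong[OF assms(1-3)] assms(4) in simp)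
  have "((\<lambda>s. fact \<alpha> * prolong k f \<alpha> (jet_coords k X s)) has_real_derivative
      fact \<alpha> * (real (Suc \<alpha>) * prolong k f (Suc \<alpha>) (jet_coords k X t))) (at t)"
    by (intro DERIV_cmult prolong_has_derivative[OF assms(1,5) assms(3) assms(4)] assms(5))
  then show ?thesis
    unfolding DERIV_cong_ev[OF refl ev refl] by (auto simp: real_differentiable_def)
qed

end

lemma smooth_curve_on_compose:
  assumes U: "open U" "smooth_map_on U \<phi>" and X: "smooth_curve_on T X" "open T" "\<And>t. t \<in> T \<Longrightarrow> X t \<in> U"
  shows "smooth_curve_on T (\<lambda>t. \<phi> (X t))"
  unfolding smooth_curve_on_def
proof (intro allI ballI)
  fix \<alpha> i t assume t: "t \<in> T"
  interpret base_function "Suc \<alpha>" "{y. y 0 \<in> U}" "\<lambda>y. \<phi> (y 0) $ i"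
    by (rule base_function_component[OF U])
  show "(deriv ^^ \<alpha>) (\<lambda>s. \<phi> (X s) $ i) differentiable (at t)"
    using deriv_funpow_differentiable[OF X(1,2) _ lessI t] X(3) by simp
qed

text \<open>
The jet of \<open>\<phi> \<circ> X\<close> depends only on the jet of \<open>X\<close>, and explicitly so.
\<close>
lemma jet_coords_compose:
  assumes U: "open U" "smooth_map_on U \<phi>" and X: "smooth_curve_on T X" "open T" "\<And>t. t \<in> T \<Longrightarrow> X t \<in> U"
    and t: "t \<in> T"
  shows "jet_coords k (\<lambda>t. \<phi> (X t)) t \<alpha> =
    (if \<alpha> \<le> k then \<chi> i. prolong k (\<lambda>y. \<phi> (y 0) $ i) \<alpha> (jet_coords k X t) else 0)"
proof -
  have "(deriv ^^ \<alpha>) (\<lambda>s. \<phi> (X s) $ i) t =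
      fact \<alpha> * prolong k (\<lambda>y. \<phi> (y 0) $ i) \<alpha> (jet_coords k X t)" if "\<alpha> \<le> k" for i
  proof -
    interpret base_function k "{y. y 0 \<in> U}" "\<lambda>y. \<phi> (y 0) $ i"
      by (rule base_function_component[OF U])
    show ?thesis
      using deriv_funpow_prolong[OF X(1,2) _ that t] X(3) by simp
  qed
  then show ?thesis by (simp add: jet_coords_def[of k "\<lambda>t. \<phi> (X t)"] vec_eq_iff)
qed

lemma smooth_curve_on_smooth_map:
  assumes "smooth_map_on T X" "open T"
  shows "smooth_curve_on T X"
proof -
  have der: "((\<lambda>s. Z s $ i) has_real_derivative frechet_derivative Z (at t) 1 $ i) (at t)"
    if "smooth_map_on T Z" "t \<in> T" for Z :: "real \<Rightarrow> real^'a" and t i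
  proof -
    have Z: "(Z has_derivative frechet_derivative Z (at t)) (at t)"
      by (rule smooth_map_on_frechet(2)[OF that])
    have "(\<lambda>s. frechet_derivative Z (at t) s $ i) = (*) (frechet_derivative Z (at t) 1 $ i)"
    proof
      fix s :: real
      show "frechet_derivative Z (at t) s $ i = frechet_derivative Z (at t) 1 $ i * s"
        using linear_cmul[OF has_derivative_linear[OF Z], of s 1] by simp
    qed
    then show ?thesis
      using bounded_linear.has_derivative[OF bounded_linear_vec_nth Z, of i]
      by (simp add: has_field_derivative_def)
  qed
  \<comment> \<open>Each iterated derivative of a component is a component of an iterated Frechet derivative.\<close>
  have "\<exists>Z. smooth_map_on T Z \<and> (\<forall>t\<in>T. (deriv ^^ \<alpha>) (\<lambda>s. X s $ i) t = Z t $ i)" for \<alpha> i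
  proof (induction \<alpha>)
    case 0
    then show ?case using assms(1) by auto
  next
    case (Suc \<alpha>)
    then obtain Z where Z: "smooth_map_on T Z" "\<And>t. t \<in> T \<Longrightarrow> (deriv ^^ \<alpha>) (\<lambda>s. X s $ i) t = Z t $ i"
      by blast
    have "(deriv ^^ Suc \<alpha>) (\<lambda>s. X s $ i) t = frechet_derivative Z (at t) 1 $ i" if t: "t \<in> T" for t
    proof -
      have "\<forall>\<^sub>F s in nhds t. (deriv ^^ \<alpha>) (\<lambda>s. X s $ i) s = Z s $ i"
        using eventually_nhds_in_open[OF assms(2) t] by eventually_elim (rule Z(2))
      then have "deriv ((deriv ^^ \<alpha>) (\<lambda>s. X s $ i)) t = deriv (\<lambda>s. Z s $ i) t"
        by (rule deriv_cong_ev) simp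
      then show ?thesis using DERIV_imp_deriv[OF der[OF Z(1) t]] by simp
    qed
    then show ?case using smooth_map_on_frechet(1)[OF Z(1), of 1] by blast
  qed
  note representative = this
  show ?thesis
    unfolding smooth_curve_on_def
  proof (intro allI ballI)
    fix \<alpha> i t assume t: "t \<in> T"
    obtain Z where Z: "smooth_map_on T Z" "\<And>t. t \<in> T \<Longrightarrow> (deriv ^^ \<alpha>) (\<lambda>s. X s $ i) t = Z t $ i"
      using representative by blast
    have ev: "\<forall>\<^sub>F s in nhds t. Z s $ i = (deriv ^^ \<alpha>) (\<lambda>s. X s $ i) s"
      using eventually_nhds_in_open[OF assms(2) t] by eventually_elim (simp add: Z(2))
    show "(deriv ^^ \<alpha>) (\<lambda>s. X s $ i) differentiable (at t)"
      using der[OF Z(1) t, of i] unfolding DERIV_cong_ev[OF refl ev refl] by (auto simp: real_differentiable_def)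
  qed
qed

text \<open>
Polynomial curves are needed as representatives of jets with prescribed coordinates; the derivative of a
polynomial is again of the same shape, with the same bound \<open>N\<close>.
\<close>
lemma Ck_on_polynomial:
  fixes w :: "nat \<Rightarrow> 'b::real_normed_vector"
  shows "Ck_on m T (\<lambda>t::real. \<Sum>\<beta>\<le>N. t ^ \<beta> *\<^sub>R w \<beta>)"
proof (induction m arbitrary: w)
  case (Suc m)
  have der: "((\<lambda>t::real. \<Sum>\<beta>\<le>N. t ^ \<beta> *\<^sub>R w \<beta>) has_derivative
      (\<lambda>v. \<Sum>\<beta>\<le>N. (real \<beta> * v * t ^ (\<beta> - 1)) *\<^sub>R w \<beta>)) (at t)" for t
    by (auto intro!: derivative_eq_intros sum.cong simp: mult_ac)
  have "(\<Sum>\<beta>\<le>N. (real \<beta> * v * t ^ (\<beta> - 1)) *\<^sub>R w \<beta>) =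
      (\<Sum>\<beta>\<le>N. t ^ \<beta> *\<^sub>R (if \<beta> < N then (real (Suc \<beta>) * v) *\<^sub>R w (Suc \<beta>) else 0))" for v t
  proof (cases N)
    case (Suc M)
    show ?thesis
      unfolding Suc by (subst sum.atMost_Suc_shift) (simp add: mult_ac)
  qed simp
  then have "frechet_derivative (\<lambda>t::real. \<Sum>\<beta>\<le>N. t ^ \<beta> *\<^sub>R w \<beta>) (at t) v =
      (\<Sum>\<beta>\<le>N. t ^ \<beta> *\<^sub>R (if \<beta> < N then (real (Suc \<beta>) * v) *\<^sub>R w (Suc \<beta>) else 0))" for t v
    using frechet_derivative_at[OF der, symmetric] by simp
  then show ?case
    using der Suc by (auto simp: differentiable_def)
qed (auto intro!: continuous_intros)

section \<open>Locality of jets and smoothness; polynomial curves\<close>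

lemma deriv_funpow_cong:
  fixes f g :: "real \<Rightarrow> real"
  assumes "open T" "\<And>t. t \<in> T \<Longrightarrow> f t = g t" "t \<in> T"
  shows "(deriv ^^ \<alpha>) f t = (deriv ^^ \<alpha>) g t"
  using assms(3)
proof (induction \<alpha> arbitrary: t)
  case (Suc \<alpha>)
  have "\<forall>\<^sub>F s in nhds t. (deriv ^^ \<alpha>) f s = (deriv ^^ \<alpha>) g s"
    using eventually_nhds_in_open[OF assms(1) Suc.prems] by eventually_elim (rule Suc.IH)
  then have "deriv ((deriv ^^ \<alpha>) f) t = deriv ((deriv ^^ \<alpha>) g) t"
    by (rule deriv_cong_ev) simp
  then show ?case by simp
qed (simp add: assms(2))

lemma jet_coords_cong:
  assumes "open T" "\<And>t. t \<in> T \<Longrightarrow> X t = Y t" "t \<in> T"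
  shows "jet_coords k X t = jet_coords k Y t"
proof -
  have "(deriv ^^ \<alpha>) (\<lambda>s. X s $ i) t = (deriv ^^ \<alpha>) (\<lambda>s. Y s $ i) t" for \<alpha> i
    by (rule deriv_funpow_cong[OF assms(1) _ assms(3)]) (simp add: assms(2))
  then show ?thesis by (simp add: jet_coords_def fun_eq_iff)
qed

lemma smooth_curve_on_cong:
  assumes "open T" "\<And>t. t \<in> T \<Longrightarrow> X t = Y t" "smooth_curve_on T X"
  shows "smooth_curve_on T Y"
  unfolding smooth_curve_on_def
proof (intro allI ballI)
  fix \<alpha> i t assume t: "t \<in> T"
  have ev: "\<forall>\<^sub>F s in nhds t. (deriv ^^ \<alpha>) (\<lambda>s. X s $ i) s = (deriv ^^ \<alpha>) (\<lambda>s. Y s $ i) s"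
    using eventually_nhds_in_open[OF assms(1) t]
    by eventually_elim (rule deriv_funpow_cong[OF assms(1)], simp_all add: assms(2))
  show "(deriv ^^ \<alpha>) (\<lambda>s. Y s $ i) differentiable (at t)"
    using deriv_funpow_has_derivative[OF assms(3) t, of \<alpha> i]
    unfolding DERIV_cong_ev[OF refl ev refl] by (auto simp: real_differentiable_def)
qed

lemma smooth_curve_on_subset: "smooth_curve_on T X \<Longrightarrow> T' \<subseteq> T \<Longrightarrow> smooth_curve_on T' X"
  unfolding smooth_curve_on_def by blast

lemma Ck_on_cong:
  assumes "open T" "\<And>x. x \<in> T \<Longrightarrow> f x = g x" "Ck_on m T f"
  shows "Ck_on m T g"
  using assms(2,3)
proof (induction m arbitrary: f g)
  case 0
  then show ?case using continuous_on_cong[of T T f g] by simp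
next
  case (Suc m)
  have iff: "(f has_derivative F) (at x) \<longleftrightarrow> (g has_derivative F) (at x)" if "x \<in> T" for F x
    using that assms(1) Suc.prems(1)
    by (metis has_derivative_transform_within_open)
  then have eq: "frechet_derivative f (at x) v = frechet_derivative g (at x) v" if "x \<in> T" for x v
    using that by (simp add: frechet_derivative_def)
  have "Ck_on m T (\<lambda>x. frechet_derivative g (at x) v)" for v
    using Suc.IH[of "\<lambda>x. frechet_derivative f (at x) v"] eq Suc.prems(2) by simp
  moreover have "g differentiable (at x)" if "x \<in> T" for x
    using that iff Suc.prems(2) by (simp add: differentiable_def)
  ultimately show ?case by simp
qed

lemma deriv_funpow_polynomial:
  "(deriv ^^ \<alpha>) (\<lambda>t::real. \<Sum>\<beta>\<le>N. t ^ \<beta> * w \<beta>) 0 = fact \<alpha> * (if \<alpha> \<le> N then w \<alpha> else 0)"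
proof (induction \<alpha> arbitrary: w)
  case 0
  show ?case by (simp add: power_0_left if_distrib[of "\<lambda>x. x * _"] cong: if_cong)
next
  case (Suc \<alpha>)
  let ?w = "\<lambda>\<beta>. if \<beta> < N then real (Suc \<beta>) * w (Suc \<beta>) else 0"
  have "deriv (\<lambda>t::real. \<Sum>\<beta>\<le>N. t ^ \<beta> * w \<beta>) t = (\<Sum>\<beta>\<le>N. t ^ \<beta> * ?w \<beta>)" for t
  proof -
    have "((\<lambda>t::real. \<Sum>\<beta>\<le>N. t ^ \<beta> * w \<beta>) has_real_derivative
        (\<Sum>\<beta>\<le>N. real \<beta> * t ^ (\<beta> - 1) * w \<beta>)) (at t)"
      by (auto intro!: derivative_eq_intros sum.cong)
    moreover have "(\<Sum>\<beta>\<le>N. real \<beta> * t ^ (\<beta> - 1) * w \<beta>) = (\<Sum>\<beta>\<le>N. t ^ \<beta> * ?w \<beta>)"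
    proof (cases N)
      case (Suc M)
      show ?thesis
        unfolding Suc by (subst sum.atMost_Suc_shift) (simp add: mult_ac)
    qed simp
    ultimately show ?thesis by (simp add: DERIV_imp_deriv)
  qed
  then have "deriv (\<lambda>t::real. \<Sum>\<beta>\<le>N. t ^ \<beta> * w \<beta>) = (\<lambda>t. \<Sum>\<beta>\<le>N. t ^ \<beta> * ?w \<beta>)" by (rule ext)
  then have "(deriv ^^ Suc \<alpha>) (\<lambda>t::real. \<Sum>\<beta>\<le>N. t ^ \<beta> * w \<beta>) 0 = fact \<alpha> * (if \<alpha> \<le> N then ?w \<alpha> else 0)"
    by (simp only: funpow_Suc_right o_apply Suc.IH)
  then show ?case by (simp add: algebra_simps Suc_le_eq)
qed

lemma jet_coords_polynomial:
  fixes y :: "nat \<Rightarrow> real^'n::finite"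
  assumes "\<And>\<alpha>. \<alpha> > k \<Longrightarrow> y \<alpha> = 0"
  shows "jet_coords k (\<lambda>t. \<Sum>\<beta>\<le>k. t ^ \<beta> *\<^sub>R y \<beta>) 0 = y"
proof
  fix \<alpha>
  show "jet_coords k (\<lambda>t. \<Sum>\<beta>\<le>k. t ^ \<beta> *\<^sub>R y \<beta>) 0 \<alpha> = y \<alpha>"
    using assms[of \<alpha>] deriv_funpow_polynomial[of \<alpha> "\<lambda>\<beta>. y \<beta> $ i" k for i]
    by (simp add: jet_coords_def vec_eq_iff)
qed

lemma jet_coords_const: "jet_coords k (\<lambda>t. x) t \<alpha> = (if \<alpha> = 0 then x else 0)"
proof -
  have "(deriv ^^ \<alpha>) (\<lambda>t::real. c) = (\<lambda>t::real. if \<alpha> = 0 then c else 0)" for c :: real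
    by (induction \<alpha>) auto
  then show ?thesis by (simp add: jet_coords_def vec_eq_iff)
qed

section \<open>Charts and jets\<close>

definition transition :: "('m, 'n::finite) chart \<Rightarrow> ('m, 'n) chart \<Rightarrow> real^'n \<Rightarrow> real^'n" where
  "transition c c' = cmap c' \<circ> inv_into (cdom c) (cmap c)"

definition overlap :: "('m, 'n::finite) chart \<Rightarrow> ('m, 'n) chart \<Rightarrow> (real^'n) set" where
  "overlap c c' = cmap c ` (cdom c \<inter> cdom c')"

text \<open>
The coordinate tuples of the jets off the null section whose base point lies in \<open>U\<close>.
\<close>
definition slit_coords :: "nat \<Rightarrow> (real^'n::finite) set \<Rightarrow> (nat \<Rightarrow> real^'n) set" where
  "slit_coords k U = {y. y 0 \<in> U \<and> (\<forall>\<alpha>>k. y \<alpha> = 0) \<and> (\<exists>\<alpha>\<in>{1..k}. y \<alpha> \<noteq> 0)}"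

lemma coord_open_slit_coords:
  assumes "open U"
  shows "coord_open k (slit_coords k U)"
  unfolding coord_open_def
proof
  fix y :: "nat \<Rightarrow> real^'a"
  assume y: "y \<in> slit_coords k U"
  then obtain \<alpha> where \<alpha>: "1 \<le> \<alpha>" "\<alpha> \<le> k" "y \<alpha> \<noteq> 0" by (auto simp: slit_coords_def)
  obtain e where e: "e > 0" "\<And>x. norm (x - y 0) < e \<Longrightarrow> x \<in> U"
    using y assms unfolding open_dist dist_norm slit_coords_def by auto
  have "z \<in> slit_coords k U"
    if z: "\<forall>\<beta>>k. z \<beta> = y \<beta>" "\<forall>\<beta>\<le>k. norm (z \<beta> - y \<beta>) < min e (norm (y \<alpha>))" for z
  proof -
    have "z \<alpha> \<noteq> 0"
    proof
      assume "z \<alpha> = 0"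
      then show False using z(2)[rule_format, OF \<alpha>(2)] by simp
    qed
    moreover have "z 0 \<in> U" using e(2) z(2)[rule_format, of 0] by simp
    ultimately show ?thesis using z(1) y \<alpha> by (auto simp: slit_coords_def)
  qed
  then show "\<exists>e>0. \<forall>z. (\<forall>\<alpha>>k. z \<alpha> = y \<alpha>) \<and> (\<forall>\<alpha>\<le>k. norm (z \<alpha> - y \<alpha>) < e) \<longrightarrow>
      z \<in> slit_coords k U"
    using e(1) \<alpha>(3) by (intro exI[of _ "min e (norm (y \<alpha>))"]) simp
qed

lemma jcoord_eq_jet_coords: "jcoord k c u = jet_coords k (\<lambda>t. cmap c (jet_rep u t)) 0"
  by (simp add: jcoord_def jet_coords_def fun_eq_iff)

lemma jcoord_0: "jcoord k c u 0 = cmap c (jet_rep u 0)"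
  by (simp add: jcoord_eq_jet_coords)

lemma jcoord_above: "\<alpha> > k \<Longrightarrow> jcoord k c u \<alpha> = 0"
  by (simp add: jcoord_def)

locale smooth_atlas =
  fixes A :: "('m::{t2_space, second_countable_topology}, 'n::finite) chart set"
  assumes A: "smooth_structure A"
begin

lemma is_chart: "c \<in> A \<Longrightarrow> is_chart c"
  using A by (simp add: smooth_structure_def)

lemma inj_chart: "c \<in> A \<Longrightarrow> inj_on (cmap c) (cdom c)"
  using is_chart[of c] unfolding is_chart_def homeomorphism_def by (metis inj_onI)

lemma open_chart_image: "c \<in> A \<Longrightarrow> open (cmap c ` cdom c)"
  using is_chart[of c] by (simp add: is_chart_def)

lemma open_overlap:
  assumes "c \<in> A" "c' \<in> A"
  shows "open (overlap c c')"
proof -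
  obtain g where g: "homeomorphism (cdom c) (cmap c ` cdom c) (cmap c) g"
    using is_chart[OF assms(1)] by (auto simp: is_chart_def)
  have "openin (top_of_set (cdom c)) (cdom c \<inter> cdom c')"
    using is_chart[OF assms(2)] by (auto simp: is_chart_def)
  then have "openin (top_of_set (cmap c ` cdom c)) (overlap c c')"
    unfolding overlap_def by (rule homeomorphism_imp_open_map[OF g])
  then show ?thesis using open_chart_image[OF assms(1)] openin_open_trans by blast
qed

lemma transition_cmap: "c \<in> A \<Longrightarrow> p \<in> cdom c \<Longrightarrow> transition c c' (cmap c p) = cmap c' p"
  using inj_chart[of c] by (simp add: transition_def)

lemma smooth_transition: "c \<in> A \<Longrightarrow> c' \<in> A \<Longrightarrow> smooth_map_on (overlap c c') (transition c c')"
  using A by (simp add: smooth_structure_def smooth_transition_def transition_def overlap_def)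

lemma overlap_iff: "c \<in> A \<Longrightarrow> p \<in> cdom c \<Longrightarrow> cmap c p \<in> overlap c c' \<longleftrightarrow> p \<in> cdom c'"
  using inj_chart[of c] unfolding overlap_def inj_on_def by blast

text \<open>
A curve is given as smooth in one chart; composing with the transition map makes it smooth in any chart
around its base point.
\<close>
lemma curve_in_chart:
  assumes \<gamma>: "curve_at_0 A \<gamma>" and c: "c \<in> A" "\<gamma> 0 \<in> cdom c"
  obtains e where "e > 0" "\<And>t. t \<in> {-e<..<e} \<Longrightarrow> \<gamma> t \<in> cdom c"
    "smooth_curve_on {-e<..<e} (\<lambda>t. cmap c (\<gamma> t))"
proof -
  obtain c0 e0 where c0: "c0 \<in> A" and e0: "e0 > 0" "\<forall>t\<in>{-e0<..<e0}. \<gamma> t \<in> cdom c0"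
    and sm0: "smooth_map_on {-e0<..<e0} (cmap c0 \<circ> \<gamma>)"
    using \<gamma> unfolding curve_at_0_def by blast
  define X where "X = (\<lambda>t. cmap c0 (\<gamma> t))"
  have sm: "smooth_map_on {-e0<..<e0} X" using sm0 by (simp add: X_def o_def)
  \<comment> \<open>By continuity in the first chart, nearby points of the curve lie in both domains.\<close>
  have "\<forall>\<^sub>F t in nhds 0. t \<in> {-e0<..<e0}"
    using e0(1) by (intro eventually_nhds_in_open) auto
  moreover have "\<forall>\<^sub>F t in nhds 0. X t \<in> overlap c0 c"
  proof -
    have "isCont X 0"
      using smooth_map_on_frechet(3)[OF sm] e0(1) by (simp add: continuous_on_eq_continuous_at)
    then have "(X \<longlongrightarrow> X 0) (nhds 0)"
      by (simp add: isCont_def tendsto_at_iff_tendsto_nhds)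
    moreover have "X 0 \<in> overlap c0 c"
      using overlap_iff[OF c0, of "\<gamma> 0" c] c e0 by (simp add: X_def)
    ultimately show ?thesis
      by (rule topological_tendstoD[OF _ open_overlap[OF c0 c(1)]])
  qed
  ultimately have "\<forall>\<^sub>F t in nhds 0. t \<in> {-e0<..<e0} \<and> X t \<in> overlap c0 c"
    by (rule eventually_conj)
  then obtain e where e: "e > 0" "\<And>t. \<bar>t\<bar> < e \<Longrightarrow> t \<in> {-e0<..<e0} \<and> X t \<in> overlap c0 c"
    unfolding eventually_nhds_metric by (auto simp: dist_real_def)
  have inside: "\<gamma> t \<in> cdom c0" "\<gamma> t \<in> cdom c" "X t \<in> overlap c0 c" if "t \<in> {-e<..<e}" for t
  proof -
    have "\<bar>t\<bar> < e" using that by auto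
    from e(2)[OF this] show "\<gamma> t \<in> cdom c0" "\<gamma> t \<in> cdom c" "X t \<in> overlap c0 c"
      using e0(2) overlap_iff[OF c0, of "\<gamma> t" c] by (auto simp: X_def)
  qed
  have "{-e<..<e} \<subseteq> {-e0<..<e0}"
  proof
    fix t assume "t \<in> {-e<..<e}"
    then have "\<bar>t\<bar> < e" by auto
    from e(2)[OF this] show "t \<in> {-e0<..<e0}" ..
  qed
  then have "smooth_curve_on {-e<..<e} X"
    by (rule smooth_curve_on_subset[rotated]) (rule smooth_curve_on_smooth_map[OF sm], simp)
  then have "smooth_curve_on {-e<..<e} (\<lambda>t. transition c0 c (X t))"
    by (rule smooth_curve_on_compose[OF open_overlap[OF c0 c(1)] smooth_transition[OF c0 c(1)]
          _ open_greaterThanLessThan inside(3)])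
  then have "smooth_curve_on {-e<..<e} (\<lambda>t. cmap c (\<gamma> t))"
    by (rule smooth_curve_on_cong[OF open_greaterThanLessThan, rotated])
      (simp add: X_def transition_cmap[OF c0 inside(1)])
  then show ?thesis using that[OF e(1) inside(2)] by simp
qed

lemma jet_coords_change_chart:
  assumes \<gamma>: "curve_at_0 A \<gamma>" and c: "c \<in> A" "\<gamma> 0 \<in> cdom c" and c': "c' \<in> A" "\<gamma> 0 \<in> cdom c'"
  shows "jet_coords k (\<lambda>t. cmap c' (\<gamma> t)) 0 \<alpha> = (if \<alpha> \<le> k then
    \<chi> i. prolong k (\<lambda>y. transition c c' (y 0) $ i) \<alpha> (jet_coords k (\<lambda>t. cmap c (\<gamma> t)) 0) else 0)"
proof -
  obtain e where e: "e > 0" "\<And>t. t \<in> {-e<..<e} \<Longrightarrow> \<gamma> t \<in> cdom c"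
    "smooth_curve_on {-e<..<e} (\<lambda>t. cmap c (\<gamma> t))"
    using curve_in_chart[OF \<gamma> c] by blast
  obtain e' where e': "e' > 0" "\<And>t. t \<in> {-e'<..<e'} \<Longrightarrow> \<gamma> t \<in> cdom c'"
    using curve_in_chart[OF \<gamma> c'] by blast
  let ?T = "{- min e e'<..<min e e'}"
  have T: "open ?T" "0 \<in> ?T" "?T \<subseteq> {-e<..<e}" "?T \<subseteq> {-e'<..<e'}" using e e' by auto
  have tr: "cmap c' (\<gamma> t) = transition c c' (cmap c (\<gamma> t))" if "t \<in> ?T" for t
    using transition_cmap[OF c(1) e(2)[OF subsetD[OF T(3) that]]] by simp
  have "jet_coords k (\<lambda>t. cmap c' (\<gamma> t)) 0 = jet_coords k (\<lambda>t. transition c c' (cmap c (\<gamma> t))) 0"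
    by (rule jet_coords_cong[OF T(1) tr T(2)])
  moreover have "cmap c (\<gamma> t) \<in> overlap c c'" if "t \<in> ?T" for t
    using that T(3,4) e(2) e'(2) overlap_iff[OF c(1)] by blast
  ultimately show ?thesis
    using jet_coords_compose[OF open_overlap[OF c(1) c'(1)] smooth_transition[OF c(1) c'(1)]
        smooth_curve_on_subset[OF e(3) T(3)] T(1) _ T(2)] by simp
qed

lemma jet_coords_eq_iff: "jet_coords k X t = jet_coords k Y t \<longleftrightarrow>
    (\<forall>\<alpha>\<le>k. \<forall>i. (deriv ^^ \<alpha>) (\<lambda>s. X s $ i) t = (deriv ^^ \<alpha>) (\<lambda>s. Y s $ i) t)"
  by (auto simp: jet_coords_def fun_eq_iff vec_eq_iff)

lemma mem_jet_of_iff: "\<delta> \<in> jet_of A k \<gamma> \<longleftrightarrow> curve_at_0 A \<delta> \<and> \<delta> 0 = \<gamma> 0 \<and>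
    (\<forall>c\<in>A. \<gamma> 0 \<in> cdom c \<longrightarrow>
      jet_coords k (\<lambda>t. cmap c (\<delta> t)) 0 = jet_coords k (\<lambda>t. cmap c (\<gamma> t)) 0)"
  by (simp add: jet_of_def jet_coords_eq_iff)

text \<open>
Jets are defined by agreement in all charts.  One chart is enough because the jet in another chart is a
function of the jet in this one.
\<close>
lemma mem_jet_of_iff_chart:
  assumes "curve_at_0 A \<gamma>" "curve_at_0 A \<delta>" "c \<in> A" "\<gamma> 0 \<in> cdom c" "\<delta> 0 \<in> cdom c"
  shows "\<delta> \<in> jet_of A k \<gamma> \<longleftrightarrow>
    jet_coords k (\<lambda>t. cmap c (\<delta> t)) 0 = jet_coords k (\<lambda>t. cmap c (\<gamma> t)) 0" (is "_ \<longleftrightarrow> ?eq")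
proof
  assume eq: ?eq
  then have "cmap c (\<delta> 0) = cmap c (\<gamma> 0)" by (metis jet_coords_0)
  then have 0: "\<delta> 0 = \<gamma> 0" using inj_chart[OF assms(3)] assms(4,5) by (simp add: inj_on_eq_iff)
  have "jet_coords k (\<lambda>t. cmap c' (\<delta> t)) 0 \<alpha> = jet_coords k (\<lambda>t. cmap c' (\<gamma> t)) 0 \<alpha>"
    if "c' \<in> A" "\<gamma> 0 \<in> cdom c'" for c' \<alpha>
    using that 0 assms eq by (simp only: jet_coords_change_chart[where c = c])
  then show "\<delta> \<in> jet_of A k \<gamma>" using 0 assms by (auto simp: mem_jet_of_iff fun_eq_iff)
qed (use assms in \<open>simp add: mem_jet_of_iff\<close>)

lemma jet_of_eq: "\<delta> \<in> jet_of A k \<gamma> \<Longrightarrow> jet_of A k \<delta> = jet_of A k \<gamma>"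
  by (auto simp: mem_jet_of_iff)

lemma jet_rep_jet_of:
  assumes "curve_at_0 A \<gamma>"
  shows "jet_rep (jet_of A k \<gamma>) \<in> jet_of A k \<gamma>"
  unfolding jet_rep_def by (rule someI[of _ \<gamma>]) (simp add: mem_jet_of_iff assms)

lemma jet_rep:
  assumes "u \<in> jets A k"
  shows "curve_at_0 A (jet_rep u)" "jet_of A k (jet_rep u) = u"
proof -
  obtain \<gamma> where \<gamma>: "curve_at_0 A \<gamma>" "u = jet_of A k \<gamma>" using assms by (auto simp: jets_def)
  show "jet_of A k (jet_rep u) = u" using jet_of_eq[OF jet_rep_jet_of[OF \<gamma>(1)]] \<gamma>(2) by simp
  show "curve_at_0 A (jet_rep u)" using jet_rep_jet_of[OF \<gamma>(1)] \<gamma>(2) by (simp add: mem_jet_of_iff)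
qed

lemma jcoord_jet_of:
  assumes "curve_at_0 A \<gamma>" "c \<in> A" "\<gamma> 0 \<in> cdom c"
  shows "jet_of A k \<gamma> \<in> jdom A k c" "jcoord k c (jet_of A k \<gamma>) = jet_coords k (\<lambda>t. cmap c (\<gamma> t)) 0"
  using jet_rep_jet_of[OF assms(1), of k] assms
  by (auto simp: mem_jet_of_iff jdom_def jets_def jcoord_eq_jet_coords)

lemma jdomD: "u \<in> jdom A k c \<Longrightarrow> u \<in> jets A k" "u \<in> jdom A k c \<Longrightarrow> jet_rep u 0 \<in> cdom c"
  by (auto simp: jdom_def)

lemma inj_jcoord:
  assumes "c \<in> A"
  shows "inj_on (jcoord k c) (jdom A k c)"
proof (rule inj_onI)
  fix u v assume u: "u \<in> jdom A k c" and v: "v \<in> jdom A k c" and eq: "jcoord k c u = jcoord k c v"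
  have "jet_rep u \<in> jet_of A k (jet_rep v)"
    using u v eq assms
    by (subst mem_jet_of_iff_chart[where c = c]) (auto simp: jcoord_eq_jet_coords jet_rep(1) dest: jdomD)
  then show "u = v"
    using jet_of_eq jet_rep(2) jdomD(1)[OF u] jdomD(1)[OF v] by metis
qed

lemma jcoord_change_chart:
  assumes "c \<in> A" "c' \<in> A" "u \<in> jdom A k c" "u \<in> jdom A k c'"
  shows "jcoord k c' u \<alpha> =
    (if \<alpha> \<le> k then \<chi> i. prolong k (\<lambda>y. transition c c' (y 0) $ i) \<alpha> (jcoord k c u) else 0)"
  unfolding jcoord_eq_jet_coords
  using assms by (intro jet_coords_change_chart) (auto dest: jdomD jet_rep(1))

lemma curve_at_0_const: "curve_at_0 A (\<lambda>t. p)"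
proof -
  have "p \<in> (\<Union>c\<in>A. cdom c)" using A by (simp add: smooth_structure_def)
  then obtain c where "c \<in> A" "p \<in> cdom c" by blast
  moreover have "smooth_map_on {-1<..<1} (\<lambda>t::real. cmap c p)"
    unfolding smooth_map_on_def
    using Ck_on_polynomial[of _ "{-1<..<1}" "\<lambda>_. cmap c p" 0] by simp
  ultimately show ?thesis
    unfolding curve_at_0_def by (auto intro!: bexI[of _ c] exI[of _ 1] simp: o_def)
qed

text \<open>
Both directions compare \<open>u\<close> with the jet of the constant curve at its base point.
\<close>
lemma null_section_iff:
  assumes "c \<in> A" "u \<in> jdom A k c"
  shows "u \<in> null_section A k \<longleftrightarrow> (\<forall>\<alpha>\<in>{1..k}. jcoord k c u \<alpha> = 0)"
proof
  assume "u \<in> null_section A k"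
  then obtain p where p: "u = jet_of A k (\<lambda>t. p)" by (auto simp: null_section_def)
  have "jet_rep u 0 = p"
    using jet_rep_jet_of[OF curve_at_0_const, of k p] p by (simp add: mem_jet_of_iff)
  then have "p \<in> cdom c" using jdomD(2)[OF assms(2)] by simp
  then show "\<forall>\<alpha>\<in>{1..k}. jcoord k c u \<alpha> = 0"
    using jcoord_jet_of(2)[OF curve_at_0_const assms(1)] p by (simp add: jet_coords_const)
next
  assume 0: "\<forall>\<alpha>\<in>{1..k}. jcoord k c u \<alpha> = 0"
  let ?v = "jet_of A k (\<lambda>t. jet_rep u 0)"
  have c: "jet_rep u 0 \<in> cdom c" using jdomD(2)[OF assms(2)] .
  have v: "?v \<in> jdom A k c" "jcoord k c ?v = jet_coords k (\<lambda>t. cmap c (jet_rep u 0)) 0"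
    using jcoord_jet_of[OF curve_at_0_const assms(1) c] by auto
  have "jcoord k c u = jcoord k c ?v"
  proof
    fix \<alpha>
    show "jcoord k c u \<alpha> = jcoord k c ?v \<alpha>"
      using 0 jcoord_above[of k \<alpha> c u]
      by (cases "\<alpha> = 0"; cases "\<alpha> \<le> k") (auto simp: v(2) jet_coords_const jcoord_0)
  qed
  then have "u = ?v" by (rule inj_onD[OF inj_jcoord[OF assms(1)] _ assms(2) v(1)])
  then show "u \<in> null_section A k" by (auto simp: null_section_def)
qed

text \<open>
The jet is represented by the curve that is polynomial in the chart with the given coordinates as
coefficients.
\<close>
lemma jcoord_surj:
  assumes c: "c \<in> A" and y: "y 0 \<in> cmap c ` cdom c" "\<And>\<alpha>. \<alpha> > k \<Longrightarrow> y \<alpha> = 0"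
  shows "y \<in> jcoord k c ` jdom A k c"
proof -
  define X where "X = (\<lambda>t::real. \<Sum>\<beta>\<le>k. t ^ \<beta> *\<^sub>R y \<beta>)"
  define \<gamma> where "\<gamma> t = inv_into (cdom c) (cmap c) (X t)" for t
  have X0: "X 0 = y 0"
    by (simp add: X_def power_0_left if_distrib[of "\<lambda>x. x *\<^sub>R _"] cong: if_cong)
  have "isCont X 0" unfolding X_def by (intro continuous_intros)
  then have "(X \<longlongrightarrow> X 0) (nhds 0)"
    by (simp add: isCont_def tendsto_at_iff_tendsto_nhds)
  then have "\<forall>\<^sub>F t in nhds 0. X t \<in> cmap c ` cdom c"
    by (rule topological_tendstoD[OF _ open_chart_image[OF c]]) (simp add: X0 y)
  then obtain e where e: "e > 0" "\<And>t. \<bar>t\<bar> < e \<Longrightarrow> X t \<in> cmap c ` cdom c"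
    unfolding eventually_nhds_metric by (auto simp: dist_real_def)
  have \<gamma>: "\<gamma> t \<in> cdom c" "cmap c (\<gamma> t) = X t" if "t \<in> {-e<..<e}" for t
    using e(2)[of t] that unfolding \<gamma>_def
    by (auto intro: inv_into_into f_inv_into_f simp: abs_less_iff)
  have "Ck_on m {-e<..<e} (cmap c \<circ> \<gamma>)" for m
    by (rule Ck_on_cong[of _ X]) (auto simp: \<gamma>(2) X_def intro: Ck_on_polynomial)
  then have curve: "curve_at_0 A \<gamma>"
    using c e(1) \<gamma>(1) unfolding curve_at_0_def smooth_map_on_def by blast
  have "\<gamma> 0 \<in> cdom c" using \<gamma>(1) e(1) by simp
  moreover have "jet_coords k (\<lambda>t. cmap c (\<gamma> t)) 0 = jet_coords k X 0"
    by (rule jet_coords_cong[of "{-e<..<e}"]) (use e(1) \<gamma>(2) in auto)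
  moreover have "jet_coords k X 0 = y"
    unfolding X_def by (rule jet_coords_polynomial[OF y(2)])
  ultimately show ?thesis
    using jcoord_jet_of[OF curve c, of k] by (metis imageI)
qed

lemma jpoint_jcoord: "c \<in> A \<Longrightarrow> u \<in> jdom A k c \<Longrightarrow> jpoint A k c (jcoord k c u) = u"
  by (simp add: jpoint_def inj_jcoord)

lemma jcoord_slit_iff:
  assumes "c \<in> A" "c' \<in> A" "u \<in> jdom A k c"
  shows "jcoord k c u \<in> slit_coords k (overlap c c') \<longleftrightarrow> u \<in> slit_jets A k \<and> u \<in> jdom A k c'"
  using assms null_section_iff[OF assms(1,3)] overlap_iff[OF assms(1) jdomD(2)[OF assms(3)], of c']
  by (auto simp: slit_coords_def jcoord_0 jcoord_above slit_jets_def jdom_def)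

lemma jcoord_slit_image:
  assumes "c \<in> A" "c' \<in> A"
  shows "jcoord k c ` (slit_jets A k \<inter> jdom A k c \<inter> jdom A k c') = slit_coords k (overlap c c')"
proof (intro equalityI subsetI)
  fix y assume y: "y \<in> slit_coords k (overlap c c')"
  then have "y \<in> jcoord k c ` jdom A k c"
    by (intro jcoord_surj assms) (auto simp: slit_coords_def overlap_def)
  then obtain u where u: "u \<in> jdom A k c" "y = jcoord k c u" by blast
  then show "y \<in> jcoord k c ` (slit_jets A k \<inter> jdom A k c \<inter> jdom A k c')"
    using jcoord_slit_iff[OF assms u(1)] y by auto
qed (use jcoord_slit_iff[OF assms] in auto)

lemma jpoint_slit:
  assumes "c \<in> A" "c' \<in> A" "y \<in> slit_coords k (overlap c c')"
  shows "jpoint A k c y \<in> slit_jets A k" "jpoint A k c y \<in> jdom A k c" "jpoint A k c y \<in> jdom A k c'"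
    "jcoord k c (jpoint A k c y) = y"
proof -
  obtain u where u: "u \<in> slit_jets A k" "u \<in> jdom A k c" "u \<in> jdom A k c'" "y = jcoord k c u"
    using assms(3) unfolding jcoord_slit_image[OF assms(1,2), symmetric] by blast
  then have "jpoint A k c y = u" using jpoint_jcoord[OF assms(1)] by simp
  with u show "jpoint A k c y \<in> slit_jets A k" "jpoint A k c y \<in> jdom A k c" "jpoint A k c y \<in> jdom A k c'"
    "jcoord k c (jpoint A k c y) = y" by auto
qed

end

section \<open>Change of chart on the jet bundle\<close>

text \<open>
The existence counterpart of \<open>jpartial\<close>.
\<close>
abbreviation has_jpartial ::
  "('m, 'n::finite) chart set \<Rightarrow> nat \<Rightarrow> ('m, 'n) chart \<Rightarrow> nat \<Rightarrow> 'n \<Rightarrow> ('m jet \<Rightarrow> real) \<Rightarrow> real \<Rightarrow> 'm jet \<Rightarrow> bool" where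
  "has_jpartial A k c \<alpha> i f d u \<equiv> has_partial \<alpha> i (f \<circ> jpoint A k c) d (jcoord k c u)"

lemma has_jpartial_jpartial: "has_jpartial A k c \<alpha> i f d u \<Longrightarrow> jpartial A k c \<alpha> i f u = d"
  unfolding jpartial_def by (rule has_partial_partial)

lemma has_jpartial_self:
  assumes "has_jpartial A k c \<alpha> i f d u"
  shows "has_jpartial A k c \<alpha> i f (jpartial A k c \<alpha> i f u) u"
  unfolding has_jpartial_jpartial[OF assms] by (rule assms)

lemma Gam_eq_total_der: "Gam A k c f u = total_der k (f \<circ> jpoint A k c) (jcoord k c u)"
  by (simp add: Gam_def total_der_def jpartial_def)

context smooth_atlas
begin

lemma smooth_in_chart_iff:
  assumes "c \<in> A"
  shows "smooth_in_chart A k c (slit_jets A k) f \<longleftrightarrow>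
    coord_smooth k (slit_coords k (overlap c c)) (f \<circ> jpoint A k c)"
  using jcoord_slit_image[OF assms assms, of k]
  by (simp add: smooth_in_chart_def Int_assoc)

lemma coord_open_slit: "c \<in> A \<Longrightarrow> c' \<in> A \<Longrightarrow> coord_open k (slit_coords k (overlap c c'))"
  by (intro coord_open_slit_coords open_overlap)

lemma jcoord_in_slit: "c \<in> A \<Longrightarrow> u \<in> slit_jets A k \<Longrightarrow> u \<in> jdom A k c \<Longrightarrow>
    jcoord k c u \<in> slit_coords k (overlap c c)"
  by (simp add: jcoord_slit_iff)

lemma smooth_in_chart_jpartial:
  assumes "c \<in> A" "\<alpha> \<le> k" "smooth_in_chart A k c (slit_jets A k) f"
  shows "smooth_in_chart A k c (slit_jets A k) (jpartial A k c \<alpha> i f)"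
  unfolding smooth_in_chart_iff[OF assms(1)]
  by (rule coord_smooth_cong[OF coord_open_slit[OF assms(1,1)] _ coord_smooth_partial])
    (use assms in \<open>auto simp: jpartial_def jpoint_slit smooth_in_chart_iff\<close>)

end

text \<open>
Two fixed charts, so that the change of induced coordinates and its Jacobian can be named.
\<close>
locale chart_change = smooth_atlas A
  for A :: "('m::{t2_space, second_countable_topology}, 'n::finite) chart set" +
  fixes k :: nat and c c' :: "('m, 'n) chart"
  assumes c: "c \<in> A" and c': "c' \<in> A"
begin

definition region :: "'m jet set" where
  "region = slit_jets A k \<inter> jdom A k c \<inter> jdom A k c'"

lemma regionD: "u \<in> region \<Longrightarrow> u \<in> slit_jets A k" "u \<in> region \<Longrightarrow> u \<in> jdom A k c"
    "u \<in> region \<Longrightarrow> u \<in> jdom A k c'"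
  by (auto simp: region_def)

abbreviation region_coords where "region_coords \<equiv> slit_coords k (overlap c c')"

lemma jcoord_region: "u \<in> region \<Longrightarrow> jcoord k c u \<in> region_coords"
  using c c' by (auto simp: region_def jcoord_slit_iff)

lemma jpoint_region: "y \<in> region_coords \<Longrightarrow> jpoint A k c y \<in> region"
    "y \<in> region_coords \<Longrightarrow> jcoord k c (jpoint A k c y) = y"
  using jpoint_slit[OF c c'] by (auto simp: region_def)

lemma coord_open_region: "coord_open k region_coords"
  by (rule coord_open_slit[OF c c'])

lemma has_jpartial_cong:
  assumes "u \<in> region" "\<alpha> \<le> k" "\<And>w. w \<in> region \<Longrightarrow> f w = g w"
  shows "has_jpartial A k c \<alpha> i f d u \<longleftrightarrow> has_jpartial A k c \<alpha> i g d u"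
  by (rule has_partial_cong[OF coord_open_region jcoord_region[OF assms(1)] assms(2)])
    (simp add: assms(3) jpoint_region)

definition jac :: "nat \<Rightarrow> 'n \<Rightarrow> nat \<Rightarrow> 'n \<Rightarrow> 'm jet \<Rightarrow> real" where
  "jac \<alpha> i \<beta> j u = jpartial A k c \<beta> j (\<lambda>w. jcoord k c' w \<alpha> $ i) u"

text \<open>
The coordinate functions \<open>x'^i\<close> of the new chart, read as functions of the tuple in the old one.
\<close>
definition base :: "'n \<Rightarrow> (nat \<Rightarrow> real^'n) \<Rightarrow> real" where
  "base i y = transition c c' (y 0) $ i"

lemma base_function: "base_function k {y. y 0 \<in> overlap c c'} (base i)"
  using base_function_component[OF open_overlap[OF c c'] smooth_transition[OF c c']]
  by (simp add: base_def[abs_def])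

lemma region_coords_base: "y \<in> region_coords \<Longrightarrow> y \<in> {y. y 0 \<in> overlap c c'}"
  by (simp add: slit_coords_def)

lemma jcoord_prolong:
  assumes "y \<in> region_coords" "\<alpha> \<le> k"
  shows "((\<lambda>w. jcoord k c' w \<alpha> $ i) \<circ> jpoint A k c) y = prolong k (base i) \<alpha> y"
  using jcoord_change_chart[OF c c' jpoint_slit(2,3)[OF c c' assms(1)], of \<alpha>] assms
  by (simp add: jpoint_region base_def[abs_def])

lemma jac_eq:
  assumes "u \<in> region" "\<alpha> \<le> k" "\<beta> \<le> k"
  shows "jac \<alpha> i \<beta> j u = partial \<beta> j (prolong k (base i) \<alpha>) (jcoord k c u)"
  unfolding jac_def jpartial_def
  by (rule partial_cong[OF coord_open_region jcoord_region[OF assms(1)] assms(3)])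
    (rule jcoord_prolong[OF _ assms(2)])

lemma has_jpartial_jac:
  assumes "u \<in> region" "\<alpha> \<le> k" "\<beta> \<le> k"
  shows "has_jpartial A k c \<beta> j (\<lambda>w. jcoord k c' w \<alpha> $ i) (jac \<alpha> i \<beta> j u) u"
proof -
  interpret base_function k "{y. y 0 \<in> overlap c c'}" "base i" by (rule base_function)
  have "has_partial \<beta> j (prolong k (base i) \<alpha>) (jac \<alpha> i \<beta> j u) (jcoord k c u)"
    unfolding jac_eq[OF assms]
    by (rule coord_smooth_has_partial[OF smooth_prolong assms(3) region_coords_base[OF jcoord_region[OF assms(1)]]])
  then show ?thesis
    by (subst has_partial_cong[OF coord_open_region jcoord_region[OF assms(1)] assms(3)
          jcoord_prolong[OF _ assms(2)]])
qed

lemma jac_above: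
  assumes "u \<in> region" "\<alpha> < \<beta>" "\<beta> \<le> k"
  shows "jac \<alpha> i \<beta> j u = 0"
  using base_function.partial_prolong_above[OF base_function assms(2,3) region_coords_base[OF jcoord_region[OF assms(1)]]]
    assms by (subst jac_eq) auto

lemma jac_diag:
  assumes "u \<in> region" "\<alpha> \<le> k"
  shows "jac \<alpha> i \<alpha> j u = jac 0 i 0 j u"
  using base_function.partial_prolong_top[OF base_function assms(2) region_coords_base[OF jcoord_region[OF assms(1)]]]
    assms by (simp add: jac_eq)

lemma jac_subdiag:
  assumes "u \<in> region" "Suc \<alpha> \<le> k"
  shows "jac (Suc \<alpha>) i \<alpha> j u = Gam A k c (jac 0 i 0 j) u"
proof -
  have "jac (Suc \<alpha>) i \<alpha> j u = total_der k (partial 0 j (base i)) (jcoord k c u)"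
    using base_function.partial_prolong_below_top[OF base_function assms(2) region_coords_base[OF jcoord_region[OF assms(1)]]]
      assms by (subst jac_eq) auto
  also have "\<dots> = Gam A k c (jac 0 i 0 j) u"
    unfolding Gam_eq_total_der
    by (rule total_der_cong[OF coord_open_region jcoord_region[OF assms(1)]])
      (simp add: jac_eq jpoint_region)
  finally show ?thesis .
qed

text \<open>
The recursion that defines \<open>prolong\<close>, read on the jet bundle.
\<close>
lemma Gam_jcoord:
  assumes "u \<in> region" "\<alpha> < k"
  shows "Gam A k c (\<lambda>w. jcoord k c' w \<alpha> $ i) u = real (Suc \<alpha>) * jcoord k c' u (Suc \<alpha>) $ i"
proof -
  have "Gam A k c (\<lambda>w. jcoord k c' w \<alpha> $ i) u = total_der k (prolong k (base i) \<alpha>) (jcoord k c u)"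
    unfolding Gam_eq_total_der
    by (rule total_der_cong[OF coord_open_region jcoord_region[OF assms(1)]])
      (use assms(2) in \<open>intro jcoord_prolong, auto\<close>)
  also have "\<dots> = real (Suc \<alpha>) * prolong k (base i) (Suc \<alpha>) (jcoord k c u)"
    by simp
  also have "prolong k (base i) (Suc \<alpha>) (jcoord k c u) = jcoord k c' u (Suc \<alpha>) $ i"
    using jcoord_prolong[OF jcoord_region[OF assms(1)], of "Suc \<alpha>" i] assms
    by (simp add: jpoint_jcoord[OF c] regionD)
  finally show ?thesis .
qed

text \<open>
Moving along an old coordinate axis is a curve in the new coordinates, with velocity a column of the
Jacobian matrix.
\<close>
lemma has_jpartial_chain:
  assumes u: "u \<in> region" and \<beta>: "\<beta> \<le> k" and h: "smooth_in_chart A k c' (slit_jets A k) h"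
  shows "has_jpartial A k c \<beta> j h
    (\<Sum>\<alpha>\<le>k. \<Sum>i\<in>UNIV. jac \<alpha> i \<beta> j u * jpartial A k c' \<alpha> i h u) u"
proof -
  let ?y = "jcoord k c u"
  define g where "g = h \<circ> jpoint A k c'"
  define Y where "Y s = jcoord k c' (jpoint A k c (along_axis ?y \<beta> j s))" for s
  have g: "coord_smooth k (slit_coords k (overlap c' c')) g"
    using h by (simp add: smooth_in_chart_iff[OF c'] g_def)
  have Y0: "Y 0 = jcoord k c' u"
    using jpoint_jcoord[OF c regionD(2)[OF u]] by (simp add: Y_def)
  have "((\<lambda>s. g (Y s)) has_real_derivative
      (\<Sum>\<alpha>\<le>k. \<Sum>i\<in>UNIV. partial \<alpha> i g (Y 0) * jac \<alpha> i \<beta> j u)) (at 0)"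
  proof (rule has_derivative_along_curve[OF coord_open_slit[OF c' c', of k]])
    show "Y 0 \<in> slit_coords k (overlap c' c')"
      unfolding Y0 using u by (intro jcoord_in_slit c') (auto dest: regionD)
    show "((\<lambda>s. Y s \<alpha> $ i) has_real_derivative jac \<alpha> i \<beta> j u) (at 0)" if "\<alpha> \<le> k" for \<alpha> i
      using has_jpartial_jac[OF u that \<beta>, of j i] by (simp add: has_partial_def Y_def)
    show "Y s \<alpha> = Y 0 \<alpha>" if "\<alpha> > k" for s \<alpha>
      using that by (simp add: Y_def jcoord_above)
  qed (auto intro: coord_smooth_has_partial[OF g] coord_smooth_continuous coord_smooth_partial[OF g])
  moreover have ev: "\<forall>\<^sub>F s in nhds 0. g (Y s) = (h \<circ> jpoint A k c) (along_axis ?y \<beta> j s)"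
    using coord_open_along_axis[OF coord_open_region jcoord_region[OF u] \<beta>, of j]
    by eventually_elim (simp add: g_def Y_def jpoint_jcoord[OF c'] regionD(3) jpoint_region)
  ultimately have "((\<lambda>s. (h \<circ> jpoint A k c) (along_axis ?y \<beta> j s)) has_real_derivative
      (\<Sum>\<alpha>\<le>k. \<Sum>i\<in>UNIV. partial \<alpha> i g (Y 0) * jac \<alpha> i \<beta> j u)) (at 0)"
    unfolding DERIV_cong_ev[OF refl ev refl] by simp
  then show ?thesis
    unfolding has_partial_def jpartial_def Y0 g_def by (simp only: mult.commute)
qed

text \<open>
The operator \<open>\<Gamma>\<close> is not invariant: it is a vector field without its components of order \<open>k\<close>, and the
components of order \<open>k\<close> in the new chart are what the last sum restores.
\<close>
lemma Gam_chain:
  assumes u: "u \<in> region" and h: "smooth_in_chart A k c' (slit_jets A k) h"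
  shows "Gam A k c h u = Gam A k c' h u +
    (\<Sum>i\<in>UNIV. Gam A k c (\<lambda>w. jcoord k c' w k $ i) u * jpartial A k c' k i h u)"
proof -
  let ?y = "jcoord k c u"
  have "Gam A k c h u = (\<Sum>\<beta><k. \<Sum>j\<in>UNIV. \<Sum>\<alpha>\<le>k. \<Sum>i\<in>UNIV.
      real (\<beta> + 1) * ?y (\<beta> + 1) $ j * jac \<alpha> i \<beta> j u * jpartial A k c' \<alpha> i h u)"
    unfolding Gam_def
    by (intro sum.cong refl)
      (simp add: has_jpartial_jpartial[OF has_jpartial_chain[OF u _ h]] sum_distrib_left mult.assoc)
  also have "\<dots> = (\<Sum>\<beta><k. \<Sum>\<alpha>\<le>k. \<Sum>j\<in>UNIV. \<Sum>i\<in>UNIV.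
      real (\<beta> + 1) * ?y (\<beta> + 1) $ j * jac \<alpha> i \<beta> j u * jpartial A k c' \<alpha> i h u)"
    by (intro sum.cong refl, subst sum.swap) (rule refl)
  also have "\<dots> = (\<Sum>\<alpha>\<le>k. \<Sum>\<beta><k. \<Sum>j\<in>UNIV. \<Sum>i\<in>UNIV.
      real (\<beta> + 1) * ?y (\<beta> + 1) $ j * jac \<alpha> i \<beta> j u * jpartial A k c' \<alpha> i h u)"
    by (rule sum.swap)
  also have "\<dots> = (\<Sum>\<alpha>\<le>k. \<Sum>\<beta><k. \<Sum>i\<in>UNIV. \<Sum>j\<in>UNIV.
      real (\<beta> + 1) * ?y (\<beta> + 1) $ j * jac \<alpha> i \<beta> j u * jpartial A k c' \<alpha> i h u)"
    by (intro sum.cong refl sum.swap)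
  also have "\<dots> = (\<Sum>\<alpha>\<le>k. \<Sum>i\<in>UNIV. \<Sum>\<beta><k. \<Sum>j\<in>UNIV.
      real (\<beta> + 1) * ?y (\<beta> + 1) $ j * jac \<alpha> i \<beta> j u * jpartial A k c' \<alpha> i h u)"
    by (intro sum.cong refl sum.swap)
  also have "\<dots> = (\<Sum>\<alpha>\<le>k. \<Sum>i\<in>UNIV. Gam A k c (\<lambda>w. jcoord k c' w \<alpha> $ i) u * jpartial A k c' \<alpha> i h u)"
    by (simp only: Gam_def jac_def sum_distrib_right)
  also have "\<dots> = (\<Sum>\<alpha><k. \<Sum>i\<in>UNIV. Gam A k c (\<lambda>w. jcoord k c' w \<alpha> $ i) u * jpartial A k c' \<alpha> i h u)
      + (\<Sum>i\<in>UNIV. Gam A k c (\<lambda>w. jcoord k c' w k $ i) u * jpartial A k c' k i h u)"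
    by (simp add: lessThan_Suc_atMost[symmetric])
  also have "(\<Sum>\<alpha><k. \<Sum>i\<in>UNIV. Gam A k c (\<lambda>w. jcoord k c' w \<alpha> $ i) u * jpartial A k c' \<alpha> i h u)
      = Gam A k c' h u"
    unfolding Gam_def[of A k c' h]
    by (intro sum.cong refl) (simp add: Gam_jcoord[OF u])
  finally show ?thesis .
qed

end

section \<open>Matrices\<close>

lemma matrix_inv_right:
  assumes "invertible (M :: real^'n::finite^'n)"
  shows "M ** matrix_inv M = mat 1"
  using someI_ex[OF assms[unfolded invertible_def]] by (simp add: matrix_inv_def)

text \<open>
Exhibits the entries of the inverse as rational functions of the entries of \<open>M\<close>, hence as smooth functions
of a parameter.
\<close>
lemma matrix_inv_cramer:
  assumes "invertible (M :: real^'n::finite^'n)"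
  shows "matrix_inv M $ i $ j = det (\<chi> r s. if s = i then axis j 1 $ r else M $ r $ s) / det M"
proof -
  have "M *v column j (matrix_inv M) = column j (M ** matrix_inv M)"
    by (simp add: vec_eq_iff column_def matrix_vector_mult_def matrix_matrix_mult_def)
  also have "\<dots> = axis j 1"
    by (simp add: matrix_inv_right[OF assms] column_def mat_def axis_def vec_eq_iff)
  finally have "column j (matrix_inv M) =
      (\<chi> i. det (\<chi> r s. if s = i then axis j 1 $ r else M $ r $ s) / det M)"
    using cramer[of M] assms by (simp add: invertible_det_nz)
  then show ?thesis by (simp add: column_def vec_eq_iff)
qed

lemma inj_matrix_vector_mult: "invertible (M :: real^'n::finite^'n) \<Longrightarrow> inj ((*v) M)"
  using matrix_left_invertible_injective[of M] invertible_left_inverse[of M] by blast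

text \<open>
A matrix congruent to a diagonal one is symmetric.  This yields the symmetry of the metric directly from
the signature condition.
\<close>
lemma has_signature_symmetric:
  assumes "has_signature M p q"
  shows "transpose M = (M :: real^'n::finite^'n)"
proof -
  obtain P :: "real^'n^'n" and d where P: "invertible P"
    and eq: "transpose P ** M ** P = (\<chi> i j. if i = j then d i else 0)"
    using assms unfolding has_signature_def by blast
  obtain Q where Q: "P ** Q = mat 1" using P unfolding invertible_def by blast
  \<comment> \<open>Congruence by \<open>P\<close> is injective, so the symmetry of the diagonal matrix carries back to \<open>M\<close>.\<close>
  have cancel: "transpose Q ** (transpose P ** N ** P) ** Q = N" for N :: "real^'n^'n"
  proof -
    have "transpose Q ** (transpose P ** N ** P) ** Q = (transpose Q ** transpose P) ** N ** (P ** Q)"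
      by (simp add: matrix_mul_assoc)
    also have "transpose Q ** transpose P = mat 1"
      by (simp add: matrix_transpose_mul[symmetric] Q transpose_mat)
    finally show ?thesis by (simp add: Q)
  qed
  have "transpose P ** transpose M ** P = transpose (transpose P ** M ** P)"
    by (simp add: matrix_transpose_mul matrix_mul_assoc)
  also have "\<dots> = transpose P ** M ** P"
    unfolding eq by (simp add: transpose_def vec_eq_iff)
  finally show ?thesis using cancel[of M] cancel[of "transpose M"] by simp
qed

section \<open>Smooth functions on the slit jet bundle\<close>

context smooth_atlas
begin

lemma smooth_in_chart_cong:
  assumes "c \<in> A" "\<And>u. u \<in> slit_jets A k \<Longrightarrow> u \<in> jdom A k c \<Longrightarrow> f u = g u"
    "smooth_in_chart A k c (slit_jets A k) f"
  shows "smooth_in_chart A k c (slit_jets A k) g"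
  using assms(3) unfolding smooth_in_chart_iff[OF assms(1)]
  by (rule coord_smooth_cong[OF coord_open_slit[OF assms(1,1)], rotated])
    (simp add: jpoint_slit[OF assms(1,1)] assms(2))

lemma smooth_in_chart_const: "c \<in> A \<Longrightarrow> smooth_in_chart A k c (slit_jets A k) (\<lambda>u. x)"
  by (simp add: smooth_in_chart_iff o_def coord_smooth_const coord_open_slit)

lemma smooth_in_chart_jcoord:
  assumes "c \<in> A" shows "smooth_in_chart A k c (slit_jets A k) (\<lambda>u. jcoord k c u \<alpha> $ i)"
  unfolding smooth_in_chart_iff[OF assms]
  by (rule coord_smooth_cong[OF coord_open_slit[OF assms assms] _
        coord_smooth_component[OF coord_open_slit[OF assms assms], of k \<alpha> i]])
    (simp add: jpoint_slit[OF assms assms])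

lemma smooth_in_chart_add:
  "c \<in> A \<Longrightarrow> smooth_in_chart A k c (slit_jets A k) f \<Longrightarrow> smooth_in_chart A k c (slit_jets A k) g \<Longrightarrow>
    smooth_in_chart A k c (slit_jets A k) (\<lambda>u. f u + g u)"
  by (simp add: smooth_in_chart_iff o_def coord_smooth_add coord_open_slit)

lemma smooth_in_chart_minus:
  "c \<in> A \<Longrightarrow> smooth_in_chart A k c (slit_jets A k) f \<Longrightarrow>
    smooth_in_chart A k c (slit_jets A k) (\<lambda>u. - f u)"
  by (simp add: smooth_in_chart_iff o_def coord_smooth_minus coord_open_slit)

lemma smooth_in_chart_mult:
  "c \<in> A \<Longrightarrow> smooth_in_chart A k c (slit_jets A k) f \<Longrightarrow> smooth_in_chart A k c (slit_jets A k) g \<Longrightarrow>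
    smooth_in_chart A k c (slit_jets A k) (\<lambda>u. f u * g u)"
  by (simp add: smooth_in_chart_iff o_def coord_smooth_mult coord_open_slit)

lemma smooth_in_chart_sum:
  "c \<in> A \<Longrightarrow> (\<And>x. x \<in> X \<Longrightarrow> smooth_in_chart A k c (slit_jets A k) (f x)) \<Longrightarrow>
    smooth_in_chart A k c (slit_jets A k) (\<lambda>u. \<Sum>x\<in>X. f x u)"
  by (simp add: smooth_in_chart_iff o_def coord_smooth_sum coord_open_slit)

lemma smooth_in_chart_prod:
  "c \<in> A \<Longrightarrow> (\<And>x. x \<in> X \<Longrightarrow> smooth_in_chart A k c (slit_jets A k) (f x)) \<Longrightarrow>
    smooth_in_chart A k c (slit_jets A k) (\<lambda>u. \<Prod>x\<in>X. f x u)"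
  by (simp add: smooth_in_chart_iff o_def coord_smooth_prod coord_open_slit)

lemma smooth_in_chart_inverse:
  assumes "c \<in> A" "smooth_in_chart A k c (slit_jets A k) f"
    "\<And>u. u \<in> slit_jets A k \<Longrightarrow> u \<in> jdom A k c \<Longrightarrow> f u \<noteq> 0"
  shows "smooth_in_chart A k c (slit_jets A k) (\<lambda>u. inverse (f u))"
  using assms coord_smooth_inverse[OF coord_open_slit[OF assms(1,1)], of k "f \<circ> jpoint A k c"]
  by (simp add: smooth_in_chart_iff o_def jpoint_slit)

lemma smooth_in_chart_det:
  fixes M :: "'m jet \<Rightarrow> real^'l::finite^'l"
  assumes "c \<in> A" "\<And>i j. smooth_in_chart A k c (slit_jets A k) (\<lambda>u. M u $ i $ j)"
  shows "smooth_in_chart A k c (slit_jets A k) (\<lambda>u. det (M u))"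
  unfolding det_def
  by (intro smooth_in_chart_sum smooth_in_chart_mult smooth_in_chart_const smooth_in_chart_prod assms)

lemma smooth_in_chart_Gam:
  assumes "c \<in> A" "smooth_in_chart A k c (slit_jets A k) f"
  shows "smooth_in_chart A k c (slit_jets A k) (Gam A k c f)"
  unfolding Gam_def
  by (intro smooth_in_chart_sum smooth_in_chart_mult smooth_in_chart_const smooth_in_chart_jcoord
      smooth_in_chart_jpartial assms) auto

end

section \<open>Lagrangians in a chart\<close>

locale lagrangian = smooth_atlas A
  for A :: "('m::{t2_space, second_countable_topology}, 'n::finite) chart set" +
  fixes k :: nat and L :: "'m jet \<Rightarrow> real"
  assumes k: "k \<ge> 1" and space: "lagrange_space A k L"
begin

abbreviation momentum where "momentum c i \<equiv> jpartial A k c k i L"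

text \<open>
The part of the Euler-Lagrange covector \<open>d/dt \<partial>L/\<partial>y^(k) - \<partial>L/\<partial>y^(k-1)\<close> that does not involve the derivative
of \<open>y^(k)\<close>.
\<close>
definition euler :: "('m, 'n) chart \<Rightarrow> 'm jet \<Rightarrow> real^'n" where
  "euler c u = (\<chi> i. Gam A k c (momentum c i) u - jpartial A k c (k - 1) i L u)"

lemma smooth_L: "c \<in> A \<Longrightarrow> smooth_in_chart A k c (slit_jets A k) L"
  using space by (simp add: lagrange_space_def)

lemma smooth_momentum: "c \<in> A \<Longrightarrow> smooth_in_chart A k c (slit_jets A k) (momentum c i)"
  by (intro smooth_in_chart_jpartial smooth_L) auto

lemma invertible_metric:
  "c \<in> A \<Longrightarrow> u \<in> slit_jets A k \<Longrightarrow> u \<in> jdom A k c \<Longrightarrow> invertible (metric A k L c u)"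
  using space unfolding lagrange_space_def by blast

lemma metric_symmetric:
  assumes "c \<in> A" "u \<in> slit_jets A k" "u \<in> jdom A k c"
  shows "metric A k L c u $ i $ j = metric A k L c u $ j $ i"
proof -
  obtain p q where "has_signature (metric A k L c u) p q"
    using space assms unfolding lagrange_space_def by blast
  then have "transpose (metric A k L c u) = metric A k L c u" by (rule has_signature_symmetric)
  then have "transpose (metric A k L c u) $ j $ i = metric A k L c u $ j $ i" by (rule arg_cong)
  then show ?thesis by (simp only: transpose_def vec_lambda_beta)
qed

lemma metric_Gring:
  assumes "c \<in> A" "u \<in> slit_jets A k" "u \<in> jdom A k c"
  shows "(2 * real (k + 1)) *\<^sub>R (metric A k L c u *v Gring A k L c u) = euler c u"
proof -
  have "Gring A k L c u = (1 / (2 * real (k + 1))) *\<^sub>R (matrix_inv (metric A k L c u) *v euler c u)"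
    by (simp add: Gring_def euler_def vec_eq_iff matrix_vector_mult_def)
  then have "metric A k L c u *v Gring A k L c u = (1 / (2 * real (k + 1))) *\<^sub>R euler c u"
    using matrix_inv_right[OF invertible_metric[OF assms]]
    by (simp only: matrix_vector_mult_scaleR matrix_vector_mul_assoc matrix_vector_mul_lid)
  then show ?thesis by simp
qed

lemma smooth_in_chart_Gring:
  assumes "c \<in> A"
  shows "smooth_in_chart A k c (slit_jets A k) (\<lambda>u. Gring A k L c u $ i)"
proof -
  have metric: "smooth_in_chart A k c (slit_jets A k) (\<lambda>u. metric A k L c u $ r $ s)" for r s
    unfolding metric_def vec_lambda_beta
    by (intro smooth_in_chart_mult smooth_in_chart_const smooth_in_chart_jpartial smooth_momentum assms) auto
  have inv: "smooth_in_chart A k c (slit_jets A k) (\<lambda>u. matrix_inv (metric A k L c u) $ r $ s)" for r s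
  proof (rule smooth_in_chart_cong[OF assms])
    show "smooth_in_chart A k c (slit_jets A k) (\<lambda>u.
        det (\<chi> r' s'. if s' = r then axis s 1 $ r' else metric A k L c u $ r' $ s')
          * inverse (det (metric A k L c u)))"
    proof (intro smooth_in_chart_mult smooth_in_chart_inverse smooth_in_chart_det metric assms)
      fix r' s'
      show "smooth_in_chart A k c (slit_jets A k) (\<lambda>u. (\<chi> r' s'. if s' = r then axis s 1 $ r'
          else metric A k L c u $ r' $ s') $ r' $ s')"
        by (cases "s' = r") (simp_all add: metric smooth_in_chart_const assms)
    qed (use invertible_metric[OF assms] in \<open>simp add: invertible_det_nz\<close>)
  qed (use matrix_inv_cramer[OF invertible_metric[OF assms]] in \<open>simp add: divide_inverse\<close>)
  have "smooth_in_chart A k c (slit_jets A k) (\<lambda>u. 1 / real (k + 1) * (1 / 2 * (\<Sum>j\<in>UNIV.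
      matrix_inv (metric A k L c u) $ i $ j *
        (Gam A k c (momentum c j) u + - jpartial A k c (k - 1) j L u))))"
    by (intro smooth_in_chart_mult smooth_in_chart_const smooth_in_chart_sum smooth_in_chart_add
        smooth_in_chart_minus inv smooth_in_chart_Gam smooth_in_chart_jpartial smooth_momentum
        smooth_L assms) auto
  then show ?thesis by (simp add: Gring_def)
qed

end

section \<open>Lagrangians under a change of chart\<close>

locale lagrangian_change = lagrangian A k L + chart_change A k c c'
  for A :: "('m::{t2_space, second_countable_topology}, 'n::finite) chart set" and k L c c'
begin

lemma has_jpartial_jac_base:
  assumes "u \<in> region" "\<beta> \<le> k"
  shows "has_jpartial A k c \<beta> l (jac 0 i 0 j) (jpartial A k c \<beta> l (jac 0 i 0 j) u) u"
proof -
  interpret base_function k "{y. y 0 \<in> overlap c c'}" "base i" by (rule base_function)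
  have y: "jcoord k c u \<in> {y. y 0 \<in> overlap c c'}"
    by (rule region_coords_base[OF jcoord_region[OF assms(1)]])
  have eq: "(jac 0 i 0 j \<circ> jpoint A k c) y = partial 0 j (base i) y" if "y \<in> region_coords" for y
    using that by (simp add: jac_eq jpoint_region)
  have "has_partial \<beta> l (partial 0 j (base i)) (partial \<beta> l (partial 0 j (base i)) (jcoord k c u))
      (jcoord k c u)"
    by (rule coord_smooth_has_partial[OF coord_smooth_partial[OF smooth] assms(2) y]) simp
  then have "has_jpartial A k c \<beta> l (jac 0 i 0 j) (partial \<beta> l (partial 0 j (base i)) (jcoord k c u)) u"
    by (subst has_partial_cong[OF coord_open_region jcoord_region[OF assms(1)] assms(2) eq])
  then show ?thesis by (rule has_jpartial_self)
qed

lemma jpartial_jac_base_top: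
  assumes "u \<in> region"
  shows "jpartial A k c k l (jac 0 i 0 j) u = 0"
proof -
  interpret base_function k "{y. y 0 \<in> overlap c c'}" "base i" by (rule base_function)
  have eq: "(jac 0 i 0 j \<circ> jpoint A k c) y = partial 0 j (base i) y" if "y \<in> region_coords" for y
    using that by (simp add: jac_eq jpoint_region)
  have "jpartial A k c k l (jac 0 i 0 j) u = partial k l (partial 0 j (base i)) (jcoord k c u)"
    unfolding jpartial_def
    by (rule partial_cong[OF coord_open_region jcoord_region[OF assms] order.refl eq])
  also have "\<dots> = 0"
    by (intro has_partial_partial has_partial_independent partial_base_cong) (use k in simp)
  finally show ?thesis .
qed

text \<open>
Only \<open>y'^(k)\<close> depends on \<open>y^(k)\<close>, through the diagonal block of the Jacobian.
\<close>
lemma momentum_change: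
  assumes "u \<in> region"
  shows "momentum c j u = (\<Sum>i\<in>UNIV. jac 0 i 0 j u * momentum c' i u)"
proof -
  have "momentum c j u = (\<Sum>\<alpha>\<le>k. \<Sum>i\<in>UNIV. jac \<alpha> i k j u * jpartial A k c' \<alpha> i L u)"
    by (rule has_jpartial_jpartial[OF has_jpartial_chain[OF assms order.refl smooth_L[OF c']]])
  also have "\<dots> = (\<Sum>i\<in>UNIV. jac k i k j u * momentum c' i u)"
    by (simp add: lessThan_Suc_atMost[symmetric] jac_above[OF assms])
  finally show ?thesis by (simp add: jac_diag[OF assms order.refl])
qed

text \<open>
Both \<open>y'^(k-1)\<close> and \<open>y'^(k)\<close> depend on \<open>y^(k-1)\<close>, through a diagonal and a subdiagonal block.
\<close>
lemma jpartial_L_change: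
  assumes "u \<in> region"
  shows "jpartial A k c (k - 1) j L u = (\<Sum>i\<in>UNIV. jac 0 i 0 j u * jpartial A k c' (k - 1) i L u)
    + (\<Sum>i\<in>UNIV. Gam A k c (jac 0 i 0 j) u * momentum c' i u)"
proof -
  obtain m where m: "k = Suc m" using k by (cases k) auto
  then have mk: "m < k" "k - 1 = m" by simp_all
  have "jpartial A k c (k - 1) j L u =
      (\<Sum>\<alpha>\<le>k. \<Sum>i\<in>UNIV. jac \<alpha> i (k - 1) j u * jpartial A k c' \<alpha> i L u)"
    by (rule has_jpartial_jpartial[OF has_jpartial_chain[OF assms _ smooth_L[OF c']]]) simp
  also have "\<dots> = (\<Sum>\<alpha><m. \<Sum>i\<in>UNIV. jac \<alpha> i m j u * jpartial A k c' \<alpha> i L u)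
      + (\<Sum>i\<in>UNIV. jac m i m j u * jpartial A k c' m i L u)
      + (\<Sum>i\<in>UNIV. jac (Suc m) i m j u * momentum c' i u)"
    using m by (simp add: lessThan_Suc_atMost[symmetric])
  also have "(\<Sum>\<alpha><m. \<Sum>i\<in>UNIV. jac \<alpha> i m j u * jpartial A k c' \<alpha> i L u) = 0"
    using mk(1) by (intro sum.neutral ballI) (simp add: jac_above[OF assms])
  also have "(\<Sum>i\<in>UNIV. jac m i m j u * jpartial A k c' m i L u) =
      (\<Sum>i\<in>UNIV. jac 0 i 0 j u * jpartial A k c' (k - 1) i L u)"
    by (simp only: jac_diag[OF assms less_imp_le[OF mk(1)]] mk(2))
  also have "(\<Sum>i\<in>UNIV. jac (Suc m) i m j u * momentum c' i u) =
      (\<Sum>i\<in>UNIV. Gam A k c (jac 0 i 0 j) u * momentum c' i u)"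
    by (simp only: jac_subdiag[OF assms Suc_leI[OF mk(1)]])
  finally show ?thesis by simp
qed

lemma has_jpartial_momentum:
  assumes u: "u \<in> region" and \<beta>: "\<beta> \<le> k"
  shows "has_jpartial A k c \<beta> l (momentum c j) (\<Sum>i\<in>UNIV.
    jpartial A k c \<beta> l (jac 0 i 0 j) u * momentum c' i u +
    jac 0 i 0 j u * jpartial A k c \<beta> l (momentum c' i) u) u"
proof -
  have jp: "jpoint A k c (jcoord k c u) = u" using jpoint_jcoord[OF c regionD(2)[OF u]] .
  have "has_jpartial A k c \<beta> l (momentum c' i) (jpartial A k c \<beta> l (momentum c' i) u) u" for i
    by (rule has_jpartial_self[OF has_jpartial_chain[OF u \<beta> smooth_momentum[OF c']]])
  then have "has_partial \<beta> l (\<lambda>y. \<Sum>i\<in>UNIV.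
      (jac 0 i 0 j \<circ> jpoint A k c) y * (momentum c' i \<circ> jpoint A k c) y)
    (\<Sum>i\<in>UNIV. jpartial A k c \<beta> l (jac 0 i 0 j) u * (momentum c' i \<circ> jpoint A k c) (jcoord k c u) +
      (jac 0 i 0 j \<circ> jpoint A k c) (jcoord k c u) * jpartial A k c \<beta> l (momentum c' i) u) (jcoord k c u)"
    by (intro has_partial_sum has_partial_mult has_jpartial_jac_base[OF u \<beta>])
  then have "has_jpartial A k c \<beta> l (\<lambda>w. \<Sum>i\<in>UNIV. jac 0 i 0 j w * momentum c' i w)
    (\<Sum>i\<in>UNIV. jpartial A k c \<beta> l (jac 0 i 0 j) u * momentum c' i u +
      jac 0 i 0 j u * jpartial A k c \<beta> l (momentum c' i) u) u"
    by (simp add: o_def jp)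
  then show ?thesis
    by (subst has_jpartial_cong[OF u \<beta> momentum_change])
qed

text \<open>
The factor \<open>a\<close> in \<open>p = a\<^sup>T p'\<close> depends on the base point only, so differentiation with respect to
\<open>y^(k)\<close>, of order \<open>k \<ge> 1\<close>, does not touch it.
\<close>
lemma metric_change:
  assumes u: "u \<in> region"
  shows "metric A k L c u =
    transpose (\<chi> i j. jac 0 i 0 j u) ** metric A k L c' u ** (\<chi> i j. jac 0 i 0 j u)"
proof -
  have top: "jpartial A k c k l (momentum c' i) u =
      (\<Sum>m\<in>UNIV. jac 0 m 0 l u * jpartial A k c' k m (momentum c' i) u)" for i l
  proof -
    have "jpartial A k c k l (momentum c' i) u =
        (\<Sum>\<alpha>\<le>k. \<Sum>m\<in>UNIV. jac \<alpha> m k l u * jpartial A k c' \<alpha> m (momentum c' i) u)"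
      by (rule has_jpartial_jpartial[OF has_jpartial_chain[OF u order.refl smooth_momentum[OF c']]])
    also have "\<dots> = (\<Sum>m\<in>UNIV. jac k m k l u * jpartial A k c' k m (momentum c' i) u)"
      by (simp add: lessThan_Suc_atMost[symmetric] jac_above[OF u])
    finally show ?thesis by (simp add: jac_diag[OF u order.refl])
  qed
  have "jpartial A k c k l (momentum c j) u = (\<Sum>i\<in>UNIV. \<Sum>m\<in>UNIV.
      jac 0 m 0 l u * jpartial A k c' k m (momentum c' i) u * jac 0 i 0 j u)" for l j
    using has_jpartial_jpartial[OF has_jpartial_momentum[OF u order.refl]]
    by (simp add: jpartial_jac_base_top[OF u] top sum_distrib_left mult_ac)
  then show ?thesis
    by (simp add: vec_eq_iff metric_def matrix_matrix_mult_def transpose_def sum_distrib_left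
        sum_distrib_right mult_ac)
qed

lemma Gam_momentum:
  assumes u: "u \<in> region"
  shows "Gam A k c (momentum c j) u = (\<Sum>i\<in>UNIV. Gam A k c (jac 0 i 0 j) u * momentum c' i u)
    + (\<Sum>i\<in>UNIV. jac 0 i 0 j u * Gam A k c (momentum c' i) u)"
proof -
  have "Gam A k c (momentum c j) u = (\<Sum>\<alpha><k. \<Sum>l\<in>UNIV. \<Sum>i\<in>UNIV.
      real (\<alpha> + 1) * jcoord k c u (\<alpha> + 1) $ l * jpartial A k c \<alpha> l (jac 0 i 0 j) u * momentum c' i u +
      jac 0 i 0 j u * (real (\<alpha> + 1) * jcoord k c u (\<alpha> + 1) $ l * jpartial A k c \<alpha> l (momentum c' i) u))"
    unfolding Gam_def
    by (intro sum.cong refl)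
      (simp add: has_jpartial_jpartial[OF has_jpartial_momentum[OF u]] sum_distrib_left algebra_simps)
  also have "\<dots> = (\<Sum>\<alpha><k. \<Sum>i\<in>UNIV. \<Sum>l\<in>UNIV.
      real (\<alpha> + 1) * jcoord k c u (\<alpha> + 1) $ l * jpartial A k c \<alpha> l (jac 0 i 0 j) u * momentum c' i u +
      jac 0 i 0 j u * (real (\<alpha> + 1) * jcoord k c u (\<alpha> + 1) $ l * jpartial A k c \<alpha> l (momentum c' i) u))"
    by (intro sum.cong refl sum.swap)
  also have "\<dots> = (\<Sum>i\<in>UNIV. \<Sum>\<alpha><k. \<Sum>l\<in>UNIV.
      real (\<alpha> + 1) * jcoord k c u (\<alpha> + 1) $ l * jpartial A k c \<alpha> l (jac 0 i 0 j) u * momentum c' i u +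
      jac 0 i 0 j u * (real (\<alpha> + 1) * jcoord k c u (\<alpha> + 1) $ l * jpartial A k c \<alpha> l (momentum c' i) u))"
    by (rule sum.swap)
  finally show ?thesis
    unfolding Gam_def by (simp only: sum.distrib sum_distrib_left sum_distrib_right)
qed

text \<open>
The terms \<open>\<Gamma>(a)\<^sup>T p'\<close> of \<open>Gam_momentum\<close> and \<open>jpartial_L_change\<close> cancel; the second summand is
the defect of invariance of \<open>\<Gamma>\<close> from \<open>Gam_chain\<close>.
\<close>
lemma euler_change:
  assumes u: "u \<in> region"
  shows "euler c u = transpose (\<chi> i j. jac 0 i 0 j u) *v (euler c' u +
    2 *\<^sub>R (metric A k L c' u *v (\<chi> m. Gam A k c (\<lambda>w. jcoord k c' w k $ m) u)))"
proof -
  have G: "Gam A k c (momentum c' i) u = Gam A k c' (momentum c' i) u +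
      (\<Sum>m\<in>UNIV. 2 * metric A k L c' u $ i $ m * Gam A k c (\<lambda>w. jcoord k c' w k $ m) u)" for i
  proof -
    have "metric A k L c' u $ i $ m = 1/2 * jpartial A k c' k m (momentum c' i) u" for m
      using metric_symmetric[OF c' regionD(1)[OF u] regionD(3)[OF u], of i m] by (simp add: metric_def)
    then show ?thesis
      using Gam_chain[OF u smooth_momentum[OF c', of i]] by (simp add: mult.commute)
  qed
  have "euler c u $ j = (\<Sum>i\<in>UNIV. jac 0 i 0 j u * (Gam A k c (momentum c' i) u
      - jpartial A k c' (k - 1) i L u))" for j
    unfolding euler_def vec_lambda_beta Gam_momentum[OF u] jpartial_L_change[OF u]
    by (simp add: right_diff_distrib sum_subtractf)
  then show ?thesis
    by (simp add: vec_eq_iff G euler_def matrix_vector_mult_def transpose_def sum_distrib_left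
        mult.assoc algebra_simps)
qed

text \<open>
Substitution of \<open>E = 2(k+1) g G\<close> in both charts and of \<open>g = a\<^sup>T g' a\<close> into \<open>euler_change\<close>, followed by
cancelling \<open>a\<^sup>T g'\<close>.
\<close>
lemma Gring_change:
  assumes u: "u \<in> region"
  shows "- (real (k + 1) *\<^sub>R Gring A k L c' u) = (\<chi> m. Gam A k c (\<lambda>w. jcoord k c' w k $ m) u) -
    real (k + 1) *\<^sub>R ((\<chi> i j. jac 0 i 0 j u) *v Gring A k L c u)"
proof -
  define a where "a = (\<chi> i j. jac 0 i 0 j u)"
  define h where "h = (\<chi> m. Gam A k c (\<lambda>w. jcoord k c' w k $ m) u)"
  define g where "g = metric A k L c u"
  define g' where "g' = metric A k L c' u"
  let ?M = "real (k + 1)" and ?G = "Gring A k L c u" and ?G' = "Gring A k L c' u"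
  have g: "g = transpose a ** g' ** a"
    unfolding g_def g'_def a_def by (rule metric_change[OF u])
  have "euler c u = (2 * ?M) *\<^sub>R (g *v ?G)"
    unfolding g_def using metric_Gring[OF c] u by (simp add: regionD)
  also have "\<dots> = transpose a *v (g' *v ((2 * ?M) *\<^sub>R (a *v ?G)))"
    by (simp only: g matrix_vector_mul_assoc[symmetric] matrix_vector_mult_scaleR)
  finally have 1: "euler c u = transpose a *v (g' *v ((2 * ?M) *\<^sub>R (a *v ?G)))" .
  have "euler c' u = (2 * ?M) *\<^sub>R (g' *v ?G')"
    unfolding g'_def using metric_Gring[OF c'] u by (simp add: regionD)
  then have 2: "euler c u = transpose a *v (g' *v ((2 * ?M) *\<^sub>R ?G' + 2 *\<^sub>R h))"
    using euler_change[OF u] unfolding a_def[symmetric] h_def[symmetric] g'_def[symmetric]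
    by (simp only: matrix_vector_mult_scaleR matrix_vector_right_distrib)
  \<comment> \<open>Invertibility of \<open>g = a\<^sup>T g' a\<close> forces that of all three factors.\<close>
  have "det g \<noteq> 0"
    unfolding g_def using invertible_metric[OF c] u by (simp add: regionD invertible_det_nz[symmetric])
  then have "det (transpose a) \<noteq> 0" "det g' \<noteq> 0" by (auto simp: g det_mul)
  then have "inj ((*v) (transpose a))" "inj ((*v) g')"
    by (auto intro!: inj_matrix_vector_mult simp: invertible_det_nz)
  then have "(2 * ?M) *\<^sub>R (a *v ?G) = (2 * ?M) *\<^sub>R ?G' + 2 *\<^sub>R h"
    using 1 2 by (simp only: inj_eq)
  then have "2 *\<^sub>R (?M *\<^sub>R (a *v ?G)) = 2 *\<^sub>R (?M *\<^sub>R ?G' + h)"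
    by (simp only: scaleR_scaleR scaleR_add_right)
  then have "?M *\<^sub>R (a *v ?G) = ?M *\<^sub>R ?G' + h" by (rule scaleR_left_imp_eq[rotated]) simp
  then show ?thesis unfolding a_def[symmetric] h_def[symmetric] by (simp add: algebra_simps)
qed

end

section \<open>The semispray of a mechanical system and its integral curves\<close>

lemma has_vector_derivative_vec_iff:
  fixes f :: "real \<Rightarrow> real^'n::finite"
  shows "(f has_vector_derivative v) (at t) \<longleftrightarrow> (\<forall>i. ((\<lambda>s. f s $ i) has_real_derivative v $ i) (at t))"
proof (intro iffI allI)
  fix i assume "(f has_vector_derivative v) (at t)"
  then show "((\<lambda>s. f s $ i) has_real_derivative v $ i) (at t)"
    unfolding has_real_derivative_iff_has_vector_derivative
    by (rule bounded_linear.has_vector_derivative[OF bounded_linear_vec_nth])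
next
  have expand: "(\<Sum>i\<in>UNIV. x $ i *\<^sub>R axis i 1) = x" for x :: "real^'n"
    using basis_expansion[of x] by (simp add: scalar_mult_eq_scaleR)
  assume "\<forall>i. ((\<lambda>s. f s $ i) has_real_derivative v $ i) (at t)"
  then have "((\<lambda>s. \<Sum>i\<in>UNIV. f s $ i *\<^sub>R (axis i 1 :: real^'n)) has_vector_derivative
      (\<Sum>i\<in>UNIV. v $ i *\<^sub>R axis i 1)) (at t)"
    by (auto intro!: has_vector_derivative_sum derivative_eq_intros)
  then show "(f has_vector_derivative v) (at t)" by (simp only: expand)
qed

locale mechanics = lagrangian A k L
  for A :: "('m::{t2_space, second_countable_topology}, 'n::finite) chart set" and k L +
  fixes Fe :: "'m jet \<Rightarrow> ('m, 'n) tangent"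
  assumes system: "mechanical_system A k L Fe"
begin

abbreviation S where "S \<equiv> mech_semispray A k L Fe"

lemma S_low: "\<alpha> < k \<Longrightarrow> S u c \<alpha> = real (\<alpha> + 1) *\<^sub>R jcoord k c u (\<alpha> + 1)"
  by (simp add: mech_semispray_def)

lemma S_top: "S u c k = - (real (k + 1) *\<^sub>R Gring A k L c u) + (1/2) *\<^sub>R Fe u c k"
  by (simp add: mech_semispray_def)

lemma force_vertical:
  "u \<in> slit_jets A k \<Longrightarrow> c \<in> A \<Longrightarrow> u \<in> jdom A k c \<Longrightarrow> \<beta> < k \<Longrightarrow> Fe u c \<beta> = 0"
  using system unfolding mechanical_system_def by blast

lemma tangent_force: "u \<in> slit_jets A k \<Longrightarrow> tangent_vector A k u (Fe u)"
  using system unfolding mechanical_system_def vector_field_def by blast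

lemma smooth_force: "c \<in> A \<Longrightarrow> smooth_in_chart A k c (slit_jets A k) (\<lambda>u. Fe u c k $ i)"
  using system unfolding mechanical_system_def vector_field_def by blast

text \<open>
Below the order \<open>k\<close> the transformation law is the recursion for the new coordinates; at the order \<open>k\<close> it is
\<open>Gring_change\<close> together with the law for the vertical vector \<open>Fe\<close>.
\<close>
lemma tangent_semispray:
  assumes u: "u \<in> slit_jets A k"
  shows "tangent_vector A k u (S u)"
  unfolding tangent_vector_def
proof (intro ballI impI allI)
  fix c c' \<alpha> i
  assume c: "c \<in> A" and c': "c' \<in> A" and uc: "u \<in> jdom A k c \<inter> jdom A k c'" and \<alpha>: "\<alpha> \<le> k"
  interpret lagrangian_change A k L c c' by unfold_locales (fact c c')+
  have r: "u \<in> region" using u uc by (simp add: region_def)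
  have "(\<Sum>\<beta>\<le>k. \<Sum>j\<in>UNIV. jac \<alpha> i \<beta> j u * S u c \<beta> $ j) =
      (\<Sum>\<beta><k. \<Sum>j\<in>UNIV. jac \<alpha> i \<beta> j u * S u c \<beta> $ j) + (\<Sum>j\<in>UNIV. jac \<alpha> i k j u * S u c k $ j)"
    by (simp add: lessThan_Suc_atMost[symmetric])
  also have "(\<Sum>\<beta><k. \<Sum>j\<in>UNIV. jac \<alpha> i \<beta> j u * S u c \<beta> $ j) =
      Gam A k c (\<lambda>w. jcoord k c' w \<alpha> $ i) u"
    unfolding Gam_def by (intro sum.cong refl) (simp add: S_low jac_def)
  finally have split: "(\<Sum>\<beta>\<le>k. \<Sum>j\<in>UNIV. jac \<alpha> i \<beta> j u * S u c \<beta> $ j) =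
      Gam A k c (\<lambda>w. jcoord k c' w \<alpha> $ i) u + (\<Sum>j\<in>UNIV. jac \<alpha> i k j u * S u c k $ j)" .
  have "S u c' \<alpha> $ i = (\<Sum>\<beta>\<le>k. \<Sum>j\<in>UNIV. jac \<alpha> i \<beta> j u * S u c \<beta> $ j)"
  proof (cases "\<alpha> < k")
    case True
    then show ?thesis
      unfolding split by (simp add: S_low Gam_jcoord[OF r] jac_above[OF r])
  next
    case False
    then have \<alpha>k: "\<alpha> = k" using \<alpha> by simp
    have "Fe u c' k $ i = (\<Sum>\<beta>\<le>k. \<Sum>j\<in>UNIV. jac k i \<beta> j u * Fe u c \<beta> $ j)"
      using tangent_force[OF u] c c' uc unfolding tangent_vector_def jac_def by blast
    also have "\<dots> = (\<Sum>j\<in>UNIV. jac k i k j u * Fe u c k $ j)"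
      using force_vertical[OF u c] uc by (simp add: lessThan_Suc_atMost[symmetric])
    finally have F: "Fe u c' k $ i = (\<Sum>j\<in>UNIV. jac k i k j u * Fe u c k $ j)" .
    have "(- (real (k + 1) *\<^sub>R Gring A k L c' u)) $ i = Gam A k c (\<lambda>w. jcoord k c' w k $ i) u
        - real (k + 1) * (\<Sum>j\<in>UNIV. jac k i k j u * Gring A k L c u $ j)"
      unfolding Gring_change[OF r]
      by (simp add: matrix_vector_mult_def jac_diag[OF r order.refl])
    then show ?thesis
      unfolding \<alpha>k split[unfolded \<alpha>k] S_top
      by (simp add: F sum_distrib_left sum.distrib sum_subtractf algebra_simps)
  qed
  then show "S u c' \<alpha> $ i = (\<Sum>\<beta>\<le>k. \<Sum>j\<in>UNIV.
      jpartial A k c \<beta> j (\<lambda>w. jcoord k c' w \<alpha> $ i) u * S u c \<beta> $ j)"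
    by (simp only: jac_def)
qed

lemma smooth_semispray:
  assumes "c \<in> A" "\<alpha> \<le> k"
  shows "smooth_in_chart A k c (slit_jets A k) (\<lambda>u. S u c \<alpha> $ i)"
proof (cases "\<alpha> < k")
  case True
  have "smooth_in_chart A k c (slit_jets A k) (\<lambda>u. real (\<alpha> + 1) * jcoord k c u (\<alpha> + 1) $ i)"
    by (intro smooth_in_chart_mult smooth_in_chart_const smooth_in_chart_jcoord assms(1))
  then show ?thesis by (simp add: S_low True)
next
  case False
  have "smooth_in_chart A k c (slit_jets A k)
      (\<lambda>u. - (real (k + 1) * Gring A k L c u $ i) + (1/2) * Fe u c k $ i)"
    by (intro smooth_in_chart_add smooth_in_chart_minus smooth_in_chart_mult smooth_in_chart_const
        smooth_in_chart_Gring smooth_force assms(1))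
  moreover have "\<alpha> = k" using False assms(2) by simp
  ultimately show ?thesis by (simp add: S_top)
qed

lemma semispray: "k_semispray A k (slit_jets A k) S"
  unfolding k_semispray_def vector_field_def
proof (intro conjI ballI allI impI)
  fix u
  show "tangent_eq A k u (tangent_structure k (S u)) (liouville k u)"
    unfolding tangent_eq_def
  proof (intro ballI impI allI)
    fix c \<alpha> assume "\<alpha> \<le> k"
    then show "tangent_structure k (S u) c \<alpha> = liouville k u c \<alpha>"
      by (cases \<alpha>) (simp_all add: tangent_structure_def liouville_def S_low)
  qed
qed (simp_all add: tangent_semispray smooth_semispray)

text \<open>
Two tangent vectors with the same components in one chart have the same components in every chart.
\<close>
lemma semispray_unique:
  assumes X: "vector_field A k (slit_jets A k) X" and u: "u \<in> slit_jets A k"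
    and c: "c \<in> A" "u \<in> jdom A k c" and eq: "\<And>\<alpha>. \<alpha> \<le> k \<Longrightarrow> X u c \<alpha> = S u c \<alpha>"
  shows "tangent_eq A k u (X u) (S u)"
  unfolding tangent_eq_def
proof (intro ballI impI allI)
  fix c' \<alpha> assume c': "c' \<in> A" "u \<in> jdom A k c'" and \<alpha>: "\<alpha> \<le> k"
  have "X u c' \<alpha> $ i = S u c' \<alpha> $ i" for i
  proof -
    have "tangent_vector A k u (X u)" using X u by (simp add: vector_field_def)
    then have "X u c' \<alpha> $ i = (\<Sum>\<beta>\<le>k. \<Sum>j\<in>UNIV.
        jpartial A k c \<beta> j (\<lambda>w. jcoord k c' w \<alpha> $ i) u * X u c \<beta> $ j)"
      using c c' \<alpha> unfolding tangent_vector_def by blast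
    moreover have "S u c' \<alpha> $ i = (\<Sum>\<beta>\<le>k. \<Sum>j\<in>UNIV.
        jpartial A k c \<beta> j (\<lambda>w. jcoord k c' w \<alpha> $ i) u * S u c \<beta> $ j)"
      using tangent_semispray[OF u] c c' \<alpha> unfolding tangent_vector_def by blast
    ultimately show ?thesis using eq by simp
  qed
  then show "X u c' \<alpha> = S u c' \<alpha>" by (simp add: vec_eq_iff)
qed

text \<open>
The chain rule for \<open>p\<close> along a lifted curve: the derivatives of the lower coordinates assemble to
\<open>\<Gamma>(p)\<close>, and \<open>\<partial>p/\<partial>y^(k) = 2 g\<close>.
\<close>
lemma momentum_has_derivative:
  assumes c: "c \<in> A" and t: "\<sigma> t \<in> slit_jets A k" "\<sigma> t \<in> jdom A k c"
    and ev: "\<forall>\<^sub>F s in at t. \<sigma> s \<in> jdom A k c"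
    and low: "\<And>\<alpha>. \<alpha> < k \<Longrightarrow> ((\<lambda>s. jcoord k c (\<sigma> s) \<alpha>) has_vector_derivative
        (real (\<alpha> + 1) *\<^sub>R jcoord k c (\<sigma> t) (\<alpha> + 1))) (at t)"
    and top: "((\<lambda>s. jcoord k c (\<sigma> s) k) has_vector_derivative d) (at t)"
  shows "((\<lambda>s. momentum c i (\<sigma> s)) has_real_derivative
    Gam A k c (momentum c i) (\<sigma> t) + 2 * (metric A k L c (\<sigma> t) *v d) $ i) (at t)"
proof -
  let ?y = "\<lambda>s. jcoord k c (\<sigma> s)"
  define g where "g = momentum c i \<circ> jpoint A k c"
  have g: "coord_smooth k (slit_coords k (overlap c c)) g"
    using smooth_momentum[OF c, of i] unfolding smooth_in_chart_iff[OF c] g_def .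
  define y' where "y' \<alpha> = (if \<alpha> < k then real (\<alpha> + 1) *\<^sub>R ?y t (\<alpha> + 1) else d)" for \<alpha>
  have "((\<lambda>s. g (?y s)) has_real_derivative
      (\<Sum>\<alpha>\<le>k. \<Sum>j\<in>UNIV. partial \<alpha> j g (?y t) * y' \<alpha> $ j)) (at t)"
  proof (rule has_derivative_along_curve[OF coord_open_slit[OF c c, of k]])
    show "?y t \<in> slit_coords k (overlap c c)"
      by (rule jcoord_in_slit[OF c t])
    show "((\<lambda>s. ?y s \<alpha> $ j) has_real_derivative y' \<alpha> $ j) (at t)" if "\<alpha> \<le> k" for \<alpha> j
    proof -
      have "((\<lambda>s. ?y s \<alpha>) has_vector_derivative y' \<alpha>) (at t)"
        using low[of \<alpha>] top that by (cases "\<alpha> = k") (simp_all add: y'_def)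
      then show ?thesis unfolding has_vector_derivative_vec_iff by blast
    qed
    show "?y s \<alpha> = ?y t \<alpha>" if "\<alpha> > k" for s \<alpha>
      using that by (simp add: jcoord_above)
  qed (auto intro: coord_smooth_has_partial[OF g] coord_smooth_continuous coord_smooth_partial[OF g])
  moreover have ev': "\<forall>\<^sub>F s in nhds t. g (?y s) = momentum c i (\<sigma> s)"
  proof -
    have "\<forall>\<^sub>F s in nhds t. \<sigma> s \<in> jdom A k c"
      using ev t by (simp add: eventually_nhds_conv_at)
    then show ?thesis by eventually_elim (simp add: g_def jpoint_jcoord[OF c])
  qed
  ultimately have "((\<lambda>s. momentum c i (\<sigma> s)) has_real_derivative
      (\<Sum>\<alpha>\<le>k. \<Sum>j\<in>UNIV. partial \<alpha> j g (?y t) * y' \<alpha> $ j)) (at t)"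
    unfolding DERIV_cong_ev[OF refl ev' refl] by simp
  also have "(\<Sum>\<alpha>\<le>k. \<Sum>j\<in>UNIV. partial \<alpha> j g (?y t) * y' \<alpha> $ j) =
      (\<Sum>\<alpha><k. \<Sum>j\<in>UNIV. partial \<alpha> j g (?y t) * y' \<alpha> $ j) +
      (\<Sum>j\<in>UNIV. partial k j g (?y t) * y' k $ j)"
    by (simp add: lessThan_Suc_atMost[symmetric])
  also have "(\<Sum>\<alpha><k. \<Sum>j\<in>UNIV. partial \<alpha> j g (?y t) * y' \<alpha> $ j) = Gam A k c (momentum c i) (\<sigma> t)"
    unfolding Gam_eq_total_der total_der_def g_def[symmetric]
    by (intro sum.cong refl) (simp add: y'_def)
  also have "(\<Sum>j\<in>UNIV. partial k j g (?y t) * y' k $ j) =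
      (\<Sum>j\<in>UNIV. 2 * (metric A k L c (\<sigma> t) $ i $ j * d $ j))"
  proof (intro sum.cong refl)
    fix j
    have "partial k j g (?y t) = 2 * metric A k L c (\<sigma> t) $ j $ i"
      by (simp add: metric_def jpartial_def g_def)
    then show "partial k j g (?y t) * y' k $ j = 2 * (metric A k L c (\<sigma> t) $ i $ j * d $ j)"
      by (simp add: metric_symmetric[OF c t, of i j] y'_def)
  qed
  also have "\<dots> = 2 * (metric A k L c (\<sigma> t) *v d) $ i"
    by (simp add: matrix_vector_mult_def sum_distrib_left)
  finally show ?thesis .
qed

text \<open>
The recursion \<open>dy^(\<alpha>)/dt = (\<alpha>+1) y^(\<alpha>+1)\<close> is solved by the Taylor coefficients.  Both sides must be
taken on a whole open set of times, since derivatives of order \<open>\<alpha>\<close> at one time involve the neighbouring times.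
\<close>
lemma lifted_iff:
  assumes \<sigma>: "diff_curve A k W I \<sigma>" and I: "open I" and c: "c \<in> A"
  shows "(\<forall>t\<in>I. \<sigma> t \<in> jdom A k c \<longrightarrow> lifted_at k c \<sigma> t) \<longleftrightarrow>
    (\<forall>t\<in>I. \<sigma> t \<in> jdom A k c \<longrightarrow> (\<forall>\<alpha><k. ((\<lambda>s. jcoord k c (\<sigma> s) \<alpha>) has_vector_derivative
      (real (\<alpha> + 1) *\<^sub>R jcoord k c (\<sigma> t) (\<alpha> + 1))) (at t)))"
    (is "?lifted \<longleftrightarrow> ?flow")
proof -
  \<comment> \<open>An open set because the curve is continuous.\<close>
  define T where "T = {t \<in> I. \<sigma> t \<in> jdom A k c}"
  have T: "open T"
    unfolding open_subopen[of T]
  proof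
    fix t assume t: "t \<in> T"
    then have "\<forall>\<^sub>F s in nhds t. \<sigma> s \<in> jdom A k c"
      using \<sigma> c by (simp add: T_def diff_curve_def eventually_nhds_conv_at)
    moreover have "\<forall>\<^sub>F s in nhds t. s \<in> I"
      using t I by (intro eventually_nhds_in_open) (simp_all add: T_def)
    ultimately have "\<forall>\<^sub>F s in nhds t. s \<in> T"
      by eventually_elim (simp add: T_def)
    then show "\<exists>U. open U \<and> t \<in> U \<and> U \<subseteq> T"
      unfolding eventually_nhds by blast
  qed
  let ?x = "\<lambda>i s. jcoord k c (\<sigma> s) 0 $ i"
  have ?flow if lifted: ?lifted
  proof -
    have y: "jcoord k c (\<sigma> t) \<alpha> $ i = (deriv ^^ \<alpha>) (?x i) t / fact \<alpha>" if "t \<in> T" "\<alpha> \<le> k" for t \<alpha> i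
      using lifted that by (cases "\<alpha> = 0") (simp_all add: T_def lifted_at_def)
    show ?thesis
    proof (intro ballI impI allI)
      fix t \<alpha> assume "t \<in> I" "\<sigma> t \<in> jdom A k c" and \<alpha>: "\<alpha> < k"
      then have t: "t \<in> T" by (simp add: T_def)
      have "(\<lambda>s. jcoord k c (\<sigma> s) \<alpha>) differentiable (at t)"
        using \<sigma> c t \<alpha> by (simp add: T_def diff_curve_def)
      then obtain d where d: "((\<lambda>s. jcoord k c (\<sigma> s) \<alpha>) has_vector_derivative d) (at t)"
        using vector_derivative_works by blast
      have "d $ i = real (\<alpha> + 1) * jcoord k c (\<sigma> t) (\<alpha> + 1) $ i" for i
      proof -
        have di: "((\<lambda>s. jcoord k c (\<sigma> s) \<alpha> $ i) has_real_derivative d $ i) (at t)"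
          using d unfolding has_vector_derivative_vec_iff by blast
        have "\<forall>\<^sub>F s in nhds t. fact \<alpha> * jcoord k c (\<sigma> s) \<alpha> $ i = (deriv ^^ \<alpha>) (?x i) s"
          using eventually_nhds_in_open[OF T t] by eventually_elim (use y \<alpha> in simp)
        then have "deriv (\<lambda>s. fact \<alpha> * jcoord k c (\<sigma> s) \<alpha> $ i) t = (deriv ^^ Suc \<alpha>) (?x i) t"
          by (simp add: deriv_cong_ev)
        then have "(deriv ^^ Suc \<alpha>) (?x i) t = fact \<alpha> * d $ i"
          using DERIV_imp_deriv[OF DERIV_cmult[OF di]] by simp
        then show ?thesis
          using y[OF t, of "Suc \<alpha>" i] \<alpha> by (simp del: funpow.simps of_nat_Suc)
      qed
      then have "d = real (\<alpha> + 1) *\<^sub>R jcoord k c (\<sigma> t) (\<alpha> + 1)" by (simp add: vec_eq_iff)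
      then show "((\<lambda>s. jcoord k c (\<sigma> s) \<alpha>) has_vector_derivative
          (real (\<alpha> + 1) *\<^sub>R jcoord k c (\<sigma> t) (\<alpha> + 1))) (at t)"
        using d by simp
    qed
  qed
  moreover have ?lifted if flow: ?flow
  proof -
    have "(deriv ^^ \<alpha>) (?x i) t = fact \<alpha> * jcoord k c (\<sigma> t) \<alpha> $ i" if "t \<in> T" "\<alpha> \<le> k" for t \<alpha> i
      using that
    proof (induction \<alpha> arbitrary: t)
      case (Suc \<alpha>)
      have "\<forall>\<^sub>F s in nhds t. (deriv ^^ \<alpha>) (?x i) s = fact \<alpha> * jcoord k c (\<sigma> s) \<alpha> $ i"
        using eventually_nhds_in_open[OF T Suc.prems(1)] by eventually_elim (use Suc in simp)
      then have "(deriv ^^ Suc \<alpha>) (?x i) t = deriv (\<lambda>s. fact \<alpha> * jcoord k c (\<sigma> s) \<alpha> $ i) t"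
        by (simp add: deriv_cong_ev)
      also have "\<dots> = fact \<alpha> * (real (\<alpha> + 1) *\<^sub>R jcoord k c (\<sigma> t) (\<alpha> + 1)) $ i"
        using flow Suc.prems unfolding has_vector_derivative_vec_iff T_def
        by (intro DERIV_imp_deriv DERIV_cmult) auto
      finally show ?case by (simp add: algebra_simps)
    qed simp
    then show ?thesis by (auto simp: lifted_at_def T_def)
  qed
  ultimately show ?thesis by blast
qed

lemma integral_curve_split:
  assumes "open I"
  shows "integral_curve A k (slit_jets A k) S I \<sigma> \<longleftrightarrow> diff_curve A k (slit_jets A k) I \<sigma> \<and>
    (\<forall>t\<in>I. \<forall>c\<in>A. \<sigma> t \<in> jdom A k c \<longrightarrow> lifted_at k c \<sigma> t \<and>
      ((\<lambda>s. jcoord k c (\<sigma> s) k) has_vector_derivative S (\<sigma> t) c k) (at t))"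
proof (cases "diff_curve A k (slit_jets A k) I \<sigma>")
  case True
  \<comment> \<open>The block of order \<open>k\<close> is split off from the lower ones, which \<open>lifted_iff\<close> handles.\<close>
  have all: "(\<forall>\<alpha>\<le>k. P \<alpha>) \<longleftrightarrow> (\<forall>\<alpha><k. P \<alpha>) \<and> P k" for P :: "nat \<Rightarrow> bool"
    by (auto simp: le_less)
  have "integral_curve A k (slit_jets A k) S I \<sigma> \<longleftrightarrow>
      (\<forall>c\<in>A. \<forall>t\<in>I. \<sigma> t \<in> jdom A k c \<longrightarrow>
        (\<forall>\<alpha>\<le>k. ((\<lambda>s. jcoord k c (\<sigma> s) \<alpha>) has_vector_derivative S (\<sigma> t) c \<alpha>) (at t)))"
    unfolding integral_curve_def using True by blast
  also have "\<dots> \<longleftrightarrow> (\<forall>c\<in>A. (\<forall>t\<in>I. \<sigma> t \<in> jdom A k c \<longrightarrow>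
        (\<forall>\<alpha><k. ((\<lambda>s. jcoord k c (\<sigma> s) \<alpha>) has_vector_derivative
          (real (\<alpha> + 1) *\<^sub>R jcoord k c (\<sigma> t) (\<alpha> + 1))) (at t))) \<and>
      (\<forall>t\<in>I. \<sigma> t \<in> jdom A k c \<longrightarrow>
        ((\<lambda>s. jcoord k c (\<sigma> s) k) has_vector_derivative S (\<sigma> t) c k) (at t)))"
    unfolding all by (auto simp: S_low)
  also have "\<dots> \<longleftrightarrow> (\<forall>c\<in>A. (\<forall>t\<in>I. \<sigma> t \<in> jdom A k c \<longrightarrow> lifted_at k c \<sigma> t) \<and>
      (\<forall>t\<in>I. \<sigma> t \<in> jdom A k c \<longrightarrow>
        ((\<lambda>s. jcoord k c (\<sigma> s) k) has_vector_derivative S (\<sigma> t) c k) (at t)))"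
    using lifted_iff[OF True assms] by (intro ball_cong refl) simp
  finally show ?thesis using True by blast
qed (simp add: integral_curve_def)

lemma integral_iff_evolution:
  assumes "open I"
  shows "integral_curve A k (slit_jets A k) S I \<sigma> \<longleftrightarrow> evolution_curve A k L Fe I \<sigma>"
proof -
  have "((\<lambda>s. jcoord k c (\<sigma> s) k) has_vector_derivative S (\<sigma> t) c k) (at t) \<longleftrightarrow>
      (\<forall>i. \<exists>y'. ((\<lambda>s. jcoord k c (\<sigma> s) k $ i) has_real_derivative y') (at t) \<and>
        y' + real (k + 1) * Gring A k L c (\<sigma> t) $ i = 1/2 * Fe (\<sigma> t) c k $ i)" for c t
  proof -
    have "y' + real (k + 1) * Gring A k L c (\<sigma> t) $ i = 1/2 * Fe (\<sigma> t) c k $ i \<longleftrightarrow>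
        y' = S (\<sigma> t) c k $ i" for y' i
      by (auto simp: S_top)
    then show ?thesis unfolding has_vector_derivative_vec_iff by simp
  qed
  then show ?thesis
    unfolding integral_curve_split[OF assms] evolution_curve_def by simp
qed

text \<open>
Multiplication by the invertible matrix \<open>2 g\<close> turns \<open>d = -(k+1) G + F/2\<close> into \<open>2 g d = g F - E\<close>.
\<close>
lemma lagrange_equation_iff:
  assumes u: "c \<in> A" "u \<in> slit_jets A k" "u \<in> jdom A k c"
  shows "(\<forall>i. Gam A k c (momentum c i) u + 2 * (metric A k L c u *v d) $ i - jpartial A k c (k - 1) i L u =
      (\<Sum>j\<in>UNIV. metric A k L c u $ i $ j * Fe u c k $ j)) \<longleftrightarrow> d = S u c k"
proof -
  let ?g = "metric A k L c u" and ?G = "Gring A k L c u"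
  have S2: "2 *\<^sub>R S u c k = Fe u c k - (2 * real (k + 1)) *\<^sub>R ?G"
    by (simp add: S_top vec_eq_iff algebra_simps)
  have "inj ((*v) ?g)"
    by (rule inj_matrix_vector_mult[OF invertible_metric[OF u]])
  then have "d = S u c k \<longleftrightarrow> ?g *v (2 *\<^sub>R d) = ?g *v (2 *\<^sub>R S u c k)"
    by (simp add: inj_eq)
  also have "?g *v (2 *\<^sub>R S u c k) = ?g *v Fe u c k - euler c u"
    by (simp only: S2 matrix_vector_mult_diff_distrib matrix_vector_mult_scaleR metric_Gring[OF u])
  also have "?g *v (2 *\<^sub>R d) = ?g *v Fe u c k - euler c u \<longleftrightarrow>
      (\<forall>i. Gam A k c (momentum c i) u + 2 * (?g *v d) $ i - jpartial A k c (k - 1) i L u =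
        (\<Sum>j\<in>UNIV. ?g $ i $ j * Fe u c k $ j))"
    unfolding matrix_vector_mult_scaleR vec_eq_iff
    by (simp add: euler_def matrix_vector_mult_def[of _ "Fe u c k"] algebra_simps)
  finally show ?thesis by simp
qed

text \<open>
A differentiable curve has some derivative \<open>d\<close> of \<open>y^(k)\<close>.  If it is lifted, the derivative of \<open>p\<close>
exists and is determined by \<open>d\<close>, so that both conditions are equations for \<open>d\<close>.
\<close>
lemma integral_iff_lagrange:
  assumes I: "open I"
  shows "integral_curve A k (slit_jets A k) S I \<sigma> \<longleftrightarrow> lagrange_curve A k L Fe I \<sigma>"
proof (cases "diff_curve A k (slit_jets A k) I \<sigma> \<and>
    (\<forall>t\<in>I. \<forall>c\<in>A. \<sigma> t \<in> jdom A k c \<longrightarrow> lifted_at k c \<sigma> t)")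
  case True
  have "((\<lambda>s. jcoord k c (\<sigma> s) k) has_vector_derivative S (\<sigma> t) c k) (at t) \<longleftrightarrow>
      (\<forall>i. \<exists>p'. ((\<lambda>s. momentum c i (\<sigma> s)) has_real_derivative p') (at t) \<and>
         p' - jpartial A k c (k - 1) i L (\<sigma> t) =
           (\<Sum>j\<in>UNIV. metric A k L c (\<sigma> t) $ i $ j * Fe (\<sigma> t) c k $ j))"
    if t: "t \<in> I" and c: "c \<in> A" "\<sigma> t \<in> jdom A k c" for t c
  proof -
    have slit: "\<sigma> t \<in> slit_jets A k" and ev: "\<forall>\<^sub>F s in at t. \<sigma> s \<in> jdom A k c"
      and "(\<lambda>s. jcoord k c (\<sigma> s) k) differentiable (at t)"
      using True t c by (auto simp: diff_curve_def)
    then obtain d where d: "((\<lambda>s. jcoord k c (\<sigma> s) k) has_vector_derivative d) (at t)"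
      using vector_derivative_works by blast
    have low: "((\<lambda>s. jcoord k c (\<sigma> s) \<alpha>) has_vector_derivative
        (real (\<alpha> + 1) *\<^sub>R jcoord k c (\<sigma> t) (\<alpha> + 1))) (at t)" if "\<alpha> < k" for \<alpha>
      using lifted_iff[OF conjunct1[OF True] I c(1)] True t c that by blast
    let ?p = "\<lambda>i. Gam A k c (momentum c i) (\<sigma> t) + 2 * (metric A k L c (\<sigma> t) *v d) $ i"
    have p: "((\<lambda>s. momentum c i (\<sigma> s)) has_real_derivative p') (at t) \<longleftrightarrow> p' = ?p i" for i p'
      using momentum_has_derivative[OF c(1) slit c(2) ev low d, of i] DERIV_unique by blast
    have "((\<lambda>s. jcoord k c (\<sigma> s) k) has_vector_derivative S (\<sigma> t) c k) (at t) \<longleftrightarrow> d = S (\<sigma> t) c k"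
      using d vector_derivative_unique_at by blast
    then show ?thesis
      unfolding p lagrange_equation_iff[OF c(1) slit c(2), symmetric] by simp
  qed
  then show ?thesis
    unfolding integral_curve_split[OF I] lagrange_curve_def using True by blast
next
  case False
  then show ?thesis
    unfolding integral_curve_split[OF I] lagrange_curve_def by blast
qed

end

theorem theorem5p3p2:
  fixes A :: "('m::{t2_space, second_countable_topology}, 'n::finite) chart set"
    and k :: nat
    and L :: "'m jet \<Rightarrow> real"
    and Fe :: "'m jet \<Rightarrow> ('m, 'n) tangent"
  assumes "k \<ge> 1"
    and "mechanical_system A k L Fe"
  shows "k_semispray A k (slit_jets A k) (mech_semispray A k L Fe) \<and>
    (\<forall>X. vector_field A k (slit_jets A k) X \<and>
         (\<forall>u\<in>slit_jets A k. \<exists>c\<in>A. u \<in> jdom A k c \<and>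
            (\<forall>\<alpha>\<le>k. X u c \<alpha> = mech_semispray A k L Fe u c \<alpha>)) \<longrightarrow>
         (\<forall>u\<in>slit_jets A k. tangent_eq A k u (X u) (mech_semispray A k L Fe u))) \<and>
    (\<forall>I \<sigma>. open I \<and> is_interval I \<longrightarrow>
       (integral_curve A k (slit_jets A k) (mech_semispray A k L Fe) I \<sigma> \<longleftrightarrow>
          lagrange_curve A k L Fe I \<sigma>) \<and>
       (integral_curve A k (slit_jets A k) (mech_semispray A k L Fe) I \<sigma> \<longleftrightarrow>
          evolution_curve A k L Fe I \<sigma>))"
proof -
  have space: "lagrange_space A k L" using assms(2) by (simp add: mechanical_system_def)
  interpret mechanics A k L Fe
  proof
    show "smooth_structure A" using space by (simp add: lagrange_space_def)
  qed (fact assms space)+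
  show ?thesis
    using semispray semispray_unique integral_iff_lagrange integral_iff_evolution by blast
qed

end
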